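(* Let $\alpha\in\ell^{1,\infty}_{++}$. Then the kernels of $\Gamma_\alpha$, $\Gamma_{S^*\alpha}$ are trivial if and only if both of the following conditions hold true: $$\int_0^1 \frac{\xi_\alpha(\lambda)}{\lambda}\,d\lambda=\infty,\qquad \int_0^1 \frac{1-\xi_\alpha(\lambda)}{\lambda}\,d\lambda=\infty.$$
   Context: Let $\ell^2=\ell^2(\mathbb{Z}_+)$, $\mathbb{Z}_+=\{0,1,2,\dots\}$. For a sequence $\alpha=\{\alpha_n\}_{n=0}^\infty$, the Hankel operator $\Gamma_\alpha$ in $\ell^2$ is $(\Gamma_\alpha x)_n=\sum_{m=0}^\infty\alpha_{n+m}x_m$. $S^*\alpha$ denotes the shifted sequence $\{\alpha_{n+1}\}_{n=0}^\infty$, so $\Gamma_{S^*\alpha}$ has matrix entries $\alpha_{n+m+1}$. All sequences $\alpha$ defining Hankel operators are assumed real-valued. $\ell^{1,\infty}$ is the set of sequences $x=\{x_n\}_{n\ge0}$ of complex numbers with $\|x\|_{\ell^{1,\infty}}=\sup_{n\geq0}(n+1)|x_n|<\infty$. If $\alpha\in\ell^{1,\infty}$ then $\Gamma_\alpha$ and $\Gamma_{S^*\alpha}$ are bounded on $\ell^2$. $\ell^{1,\infty}_{++}$ is the class of all $\alpha\in\ell^{1,\infty}$ such that $\Gamma_\alpha\geq0$ and $\Gamma_{S^*\alpha}\geq0$ (positivity in the quadratic form sense: $(\Gamma x,x)\ge0$ for all $x\in\ell^2$). Spectral shift function: if $A,B$ are bounded self-adjoint operators in a Hilbert space with $B-A$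 trace class, then $\xi(\cdot;B,A)$ is the unique (up to a.e. equality) real-valued function in $L^1(\mathbb{R})$ such that $\mathrm{Tr}(\varphi(B)-\varphi(A))=\int_{-\infty}^\infty\xi(\lambda;B,A)\varphi'(\lambda)\,d\lambda$ for all $\varphi\in C_0^\infty(\mathbb{R})$. For $\alpha\in\ell^{1,\infty}_{++}$ one has $\Gamma_{S^*\alpha}^2=\Gamma_\alpha^2-(\cdot,\alpha)\alpha$ (a rank one perturbation), and one sets $\xi_\alpha(\lambda)=\xi(\lambda;\Gamma_\alpha^2,\Gamma_{S^*\alpha}^2)$; it takes values in $[0,1]$ and is supported in $[0,\|\Gamma_\alpha\|^2]$. *)

theory Defs
  imports "HOL-Analysis.Analysis"
begin

text \<open>
  The complex Hilbert space \<open>\<ell>\<^sup>2(\<int>\<^sub>+)\<close> is a set of sequences, and an operator on it is a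
  function on all sequences of which only the values on \<open>ell2\<close> matter.
\<close>

type_synonym seq = "nat \<Rightarrow> complex"

definition ell2 :: "seq set" where
  "ell2 = {x. summable (\<lambda>n. (cmod (x n))\<^sup>2)}"

definition ell2_norm :: "seq \<Rightarrow> real" where
  "ell2_norm x = sqrt (\<Sum>n. (cmod (x n))\<^sup>2)"

definition ell2_inner :: "seq \<Rightarrow> seq \<Rightarrow> complex" where
  "ell2_inner x y = (\<Sum>n. x n * cnj (y n))"

definition unit_seq :: "nat \<Rightarrow> seq" where
  "unit_seq k = (\<lambda>n. if n = k then 1 else 0)"

definition bounded_op :: "(seq \<Rightarrow> seq) \<Rightarrow> bool" where
  "bounded_op T \<longleftrightarrow>
     (\<forall>x\<in>ell2. T x \<in> ell2) \<and>
     (\<forall>x\<in>ell2. \<forall>y\<in>ell2. \<forall>a b. T (\<lambda>n. a * x n + b * y n) = (\<lambda>n. a * T x n + b * T y n)) \<and>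
     (\<exists>C. \<forall>x\<in>ell2. ell2_norm (T x) \<le> C * ell2_norm x)"

definition op_norm :: "(seq \<Rightarrow> seq) \<Rightarrow> real" where
  "op_norm T = (SUP x\<in>{x \<in> ell2. ell2_norm x \<le> 1}. ell2_norm (T x))"

definition op_minus :: "(seq \<Rightarrow> seq) \<Rightarrow> (seq \<Rightarrow> seq) \<Rightarrow> seq \<Rightarrow> seq" where
  "op_minus S T = (\<lambda>x n. S x n - T x n)"

definition positive_op :: "(seq \<Rightarrow> seq) \<Rightarrow> bool" where
  "positive_op T \<longleftrightarrow> (\<forall>x\<in>ell2. ell2_inner (T x) x \<in> \<real>\<^sub>\<ge>\<^sub>0)"

definition op_kernel :: "(seq \<Rightarrow> seq) \<Rightarrow> seq set" where
  "op_kernel T = {x \<in> ell2. T x = (\<lambda>n. 0)}"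

definition hankel :: "seq \<Rightarrow> seq \<Rightarrow> seq" where
  "hankel \<alpha> x = (\<lambda>n. \<Sum>m. \<alpha> (n + m) * x m)"

definition shift :: "seq \<Rightarrow> seq" where
  "shift \<alpha> = (\<lambda>n. \<alpha> (n + 1))"

definition weak_ell1 :: "seq set" where
  "weak_ell1 = {x. bdd_above (range (\<lambda>n. real (n + 1) * cmod (x n)))}"

definition weak_ell1_pp :: "seq set" where
  "weak_ell1_pp = {\<alpha> \<in> weak_ell1.
     (\<forall>n. \<alpha> n \<in> \<real>) \<and> positive_op (hankel \<alpha>) \<and> positive_op (hankel (shift \<alpha>))}"

text \<open>
  In \<open>trace_class\<close> the operator \<open>R\<close> is \<open>\<bar>T\<bar> = (T\<^sup>*T)\<^sup>1\<^sup>/\<^sup>2\<close>: the second line says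
  \<open>(R\<^sup>2 x, y) = (T x, T y)\<close>, which avoids naming the adjoint.
\<close>

definition trace_class :: "(seq \<Rightarrow> seq) \<Rightarrow> bool" where
  "trace_class T \<longleftrightarrow> bounded_op T \<and>
     (\<exists>R. bounded_op R \<and> positive_op R \<and>
       (\<forall>x\<in>ell2. \<forall>y\<in>ell2. ell2_inner (R (R x)) y = ell2_inner (T x) (T y)) \<and>
       summable (\<lambda>k. Re (ell2_inner (R (unit_seq k)) (unit_seq k))))"

definition op_trace :: "(seq \<Rightarrow> seq) \<Rightarrow> complex" where
  "op_trace T = (\<Sum>k. ell2_inner (T (unit_seq k)) (unit_seq k))"

definition op_poly :: "complex poly \<Rightarrow> (seq \<Rightarrow> seq) \<Rightarrow> seq \<Rightarrow> seq" where
  "op_poly p A = (\<lambda>x n. \<Sum>k\<le>degree p. coeff p k * (A ^^ k) x n)"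

text \<open>
  Continuous functional calculus of a bounded self-adjoint \<open>A\<close>, for \<open>\<phi>\<close> continuous on the
  real line: \<open>\<phi>(A)\<close> is the limit in operator norm of \<open>p\<^sub>j(A)\<close> whenever the polynomials
  \<open>p\<^sub>j\<close> converge to \<open>\<phi>\<close> uniformly on \<open>[-\<parallel>A\<parallel>, \<parallel>A\<parallel>]\<close>, an interval containing the spectrum.
  This determines \<open>\<phi>(A)\<close> on \<open>ell2\<close>.
\<close>

definition is_fun_calc :: "(real \<Rightarrow> complex) \<Rightarrow> (seq \<Rightarrow> seq) \<Rightarrow> (seq \<Rightarrow> seq) \<Rightarrow> bool" where
  "is_fun_calc \<phi> A F \<longleftrightarrow> bounded_op F \<and>
     (\<forall>p :: nat \<Rightarrow> complex poly.
        uniform_limit {- op_norm A .. op_norm A} (\<lambda>j t. poly (p j) (complex_of_real t)) \<phi> sequentially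
        \<longrightarrow> (\<lambda>j. op_norm (op_minus (op_poly (p j) A) F)) \<longlonglongrightarrow> 0)"

definition fun_calc :: "(real \<Rightarrow> complex) \<Rightarrow> (seq \<Rightarrow> seq) \<Rightarrow> seq \<Rightarrow> seq" where
  "fun_calc \<phi> A = (SOME F. is_fun_calc \<phi> A F)"

definition test_function :: "(real \<Rightarrow> complex) \<Rightarrow> bool" where
  "test_function \<phi> \<longleftrightarrow>
     (\<exists>D :: nat \<Rightarrow> real \<Rightarrow> complex. D 0 = \<phi> \<and>
        (\<forall>k t. (D k has_vector_derivative D (Suc k) t) (at t))) \<and>
     (\<exists>R. \<forall>t. \<bar>t\<bar> > R \<longrightarrow> \<phi> t = 0)"

text \<open>
  \<open>is_spectral_shift \<xi> B A\<close>: \<open>\<xi>\<close> is a version of \<open>\<xi>(\<cdot>; B, A)\<close>, for bounded self-adjoint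
  \<open>A\<close>, \<open>B\<close> with \<open>B - A\<close> of trace class. The function is only determined almost everywhere,
  hence a predicate.
\<close>

definition is_spectral_shift ::
    "(real \<Rightarrow> real) \<Rightarrow> (seq \<Rightarrow> seq) \<Rightarrow> (seq \<Rightarrow> seq) \<Rightarrow> bool" where
  "is_spectral_shift \<xi> B A \<longleftrightarrow> integrable lborel \<xi> \<and>
     (\<forall>\<phi>. test_function \<phi> \<longrightarrow>
        trace_class (op_minus (fun_calc \<phi> B) (fun_calc \<phi> A)) \<and>
        op_trace (op_minus (fun_calc \<phi> B) (fun_calc \<phi> A)) =
          (LINT t|lborel. \<xi> t *\<^sub>R vector_derivative \<phi> (at t)))"

end

theory Submission
  imports Defs
    "HOL-Computational_Algebra.Polynomial_FPS"
begin

text \<open>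
  Write \<open>H = \<Gamma>\<^sub>\<alpha>\<close>, \<open>G = \<Gamma>\<^bsub>S*\<alpha>\<^esub>\<close> and \<open>v = \<alpha>\<close>. Since \<open>H S = G\<close> for the shift \<open>S\<close>, \<open>H e\<^sub>0 = v\<close> and
  \<open>H\<^sup>2 = G\<^sup>2 + (\<cdot>, v) v\<close>, both kernels are trivial iff \<open>v\<close> is orthogonal to the kernel of \<open>G\<close> but
  not in its range. In terms of \<open>d\<^sub>j = ((I - G\<^sup>2/c)\<^sup>j v, v)\<close> this says \<open>d\<^sub>j \<longlonglongrightarrow> 0\<close> and \<open>\<Sum>d\<^sub>j = \<infinity>\<close>,
  and \<open>\<Sum>\<^sub>j\<^sub><\<^sub>n d\<^sub>j\<close> is comparable to \<open>c ((G\<^sup>2 + c/n)\<^sup>-\<^sup>1 v, v)\<close>.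

  The perturbation determinant gives \<open>1 + ((G\<^sup>2 + \<epsilon>)\<^sup>-\<^sup>1 v, v) = exp (\<integral> \<xi>(t) / (t + \<epsilon>) dt)\<close>. To obtain
  this identity together with \<open>0 \<le> \<xi> \<le> 1\<close> without the spectral theorem, the spectral measure of
  \<open>G\<^sup>2\<close> at \<open>v\<close> is approximated by discrete measures with Bernstein weights. For a discrete measure
  the determinant is a rational function with interlacing zeros and poles, so its shift function is
  the indicator of the intervals from the poles to the zeros. Its moments satisfy the same recursion
  as the traces of \<open>H\<^sup>2\<^sup>n - G\<^sup>2\<^sup>n\<close>, hence converge to the moments of \<open>\<xi>\<close>. The trace formula is needed
  only for test functions that agree with \<open>t\<^sup>n\<close> or with \<open>0\<close> on an interval containing the spectra.
\<close>

section \<open>Smooth cutoff functions\<close>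

text \<open>Both conditions are growth statements about one sequence. With \<open>I n\<close> the
  integral of \<open>\<xi> t / (t + c / n)\<close>, the partial sums of \<open>d\<close> equal
  \<open>exp (I n) - 1\<close> up to constant factors, so they are bounded iff
  \<open>\<xi> t / t\<close> is integrable at 0. Since \<open>d\<close> decreases, it tends to 0 iff
  its means do. Dividing by \<open>n\<close> turns \<open>exp (I n)\<close> into
  \<open>exp (I n - ln n)\<close>, and \<open>ln n\<close> is, up to a bounded term, the integral of
  \<open>1 / (t + c / n)\<close> over \<open>[0, 1]\<close>; this is where \<open>1 - \<xi>\<close>
  comes from. The trace formula admits only compactly supported smooth functions, and the chosen
  functional calculus is easily identified where such a function agrees with a polynomial on the
  interval given by the operator norm. Hence \<open>\<xi>\<close> is accessed through its moments.
  These control a function once its support is known to be bounded, so the support has to be settled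
  before the sign and the upper bound, which follow by weak convergence.\<close>

definition smooth :: "(real \<Rightarrow> real) \<Rightarrow> bool" where
  "smooth f \<longleftrightarrow> (\<exists>D :: nat \<Rightarrow> real \<Rightarrow> real. D 0 = f \<and>
     (\<forall>k t. (D k has_real_derivative D (Suc k) t) (at t)))"

lemma smooth_derivE:
  assumes "smooth f"
  obtains f' where "smooth f'" "\<And>t. (f has_real_derivative f' t) (at t)"
proof -
  obtain D where D: "D 0 = f" "\<And>k t. (D k has_real_derivative D (Suc k) t) (at t)"
    using assms unfolding smooth_def by blast
  have "smooth (D 1)"
    unfolding smooth_def by (rule exI[of _ "\<lambda>k. D (Suc k)"]) (use D(2) in auto)
  with D show ?thesis by (metis One_nat_def that)
qed

text \<open>Choosing one derivative for each member and iterating the choice yields the whole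
  sequence of derivatives, so no formula for higher derivatives is needed.\<close>

lemma smooth_coinduct:
  assumes "f \<in> C" "\<And>f. f \<in> C \<Longrightarrow> \<exists>f'\<in>C. \<forall>t. (f has_real_derivative f' t) (at t)"
  shows "smooth f"
proof -
  obtain d where d: "\<And>f. f \<in> C \<Longrightarrow> d f \<in> C \<and> (\<forall>t. (f has_real_derivative d f t) (at t))"
    using assms(2) by metis
  have "(d ^^ k) f \<in> C" for k
    by (induction k) (use assms(1) d in auto)
  with d show ?thesis
    unfolding smooth_def by (intro exI[of _ "\<lambda>k. (d ^^ k) f"]) auto
qed

text \<open>Differentiation leads from a function to sums and products of a few others. After
  closing \<open>C\<close> under sums and products, only the members of \<open>C\<close> themselves
  have to be differentiated.\<close>

inductive_set function_algebra :: "(real \<Rightarrow> real) set \<Rightarrow> (real \<Rightarrow> real) set" for C where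
  alg_base: "f \<in> C \<Longrightarrow> f \<in> function_algebra C"
| alg_const: "(\<lambda>_. c) \<in> function_algebra C"
| alg_add: "f \<in> function_algebra C \<Longrightarrow> g \<in> function_algebra C \<Longrightarrow> (\<lambda>t. f t + g t) \<in> function_algebra C"
| alg_mult: "f \<in> function_algebra C \<Longrightarrow> g \<in> function_algebra C \<Longrightarrow> (\<lambda>t. f t * g t) \<in> function_algebra C"

lemma smooth_alg:
  assumes "f \<in> function_algebra C" "\<And>f. f \<in> C \<Longrightarrow> \<exists>f'\<in>function_algebra C. \<forall>t. (f has_real_derivative f' t) (at t)"
  shows "smooth f"
proof (rule smooth_coinduct[OF assms(1)])
  fix f assume "f \<in> function_algebra C"
  then show "\<exists>f'\<in>function_algebra C. \<forall>t. (f has_real_derivative f' t) (at t)"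
  proof induction
    case (alg_base f)
    then show ?case using assms(2) by blast
  next
    case (alg_const c)
    then show ?case by (intro bexI[of _ "\<lambda>_. 0"]) (auto intro: function_algebra.alg_const)
  next
    case (alg_add f g)
    then obtain f' g' where "f' \<in> function_algebra C" "g' \<in> function_algebra C"
      "\<forall>t. (f has_real_derivative f' t) (at t)" "\<forall>t. (g has_real_derivative g' t) (at t)" by blast
    then show ?case
      by (intro bexI[of _ "\<lambda>t. f' t + g' t"]) (auto intro: function_algebra.alg_add derivative_intros)
  next
    case (alg_mult f g)
    then obtain f' g' where *: "f' \<in> function_algebra C" "g' \<in> function_algebra C"
      "\<forall>t. (f has_real_derivative f' t) (at t)" "\<forall>t. (g has_real_derivative g' t) (at t)" by blast
    then show ?case using alg_mult.hyps
      by (intro bexI[of _ "\<lambda>t. f' t * g t + g' t * f t"])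
        (auto intro: function_algebra.alg_add function_algebra.alg_mult DERIV_mult)
  qed
qed

lemma smooth_in_alg: "f \<in> function_algebra {f. smooth f} \<Longrightarrow> smooth f"
  by (erule smooth_alg) (metis alg_base mem_Collect_eq smooth_derivE)

lemma smooth_const: "smooth (\<lambda>_. c)"
  by (rule smooth_in_alg) (rule alg_const)

lemma smooth_add: "smooth f \<Longrightarrow> smooth g \<Longrightarrow> smooth (\<lambda>t. f t + g t)"
  by (rule smooth_in_alg) (auto intro: function_algebra.intros)

lemma smooth_mult: "smooth f \<Longrightarrow> smooth g \<Longrightarrow> smooth (\<lambda>t. f t * g t)"
  by (rule smooth_in_alg) (auto intro: function_algebra.intros)

lemma smooth_diff: "smooth f \<Longrightarrow> smooth g \<Longrightarrow> smooth (\<lambda>t. f t - g t)"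
  using smooth_add[of f "\<lambda>t. (-1) * g t"] smooth_mult[OF smooth_const[of "-1"], of g] by simp

lemma smooth_ident: "smooth (\<lambda>t. t)"
  by (rule smooth_alg[of _ "{\<lambda>t. t}"])
    (auto intro!: alg_base bexI[of _ "\<lambda>_. 1"] alg_const derivative_eq_intros)

lemma smooth_power: "smooth f \<Longrightarrow> smooth (\<lambda>t. f t ^ n)"
  by (induction n) (auto intro: smooth_const smooth_mult)

text \<open>The derivative of \<open>1 / h\<close> is \<open>- h' / h^2\<close>, a product of smooth
  functions and of \<open>1 / h\<close> itself. Adjoining this single function to the smooth ones
  thus gives an algebra closed under differentiation.\<close>

lemma smooth_inverse:
  assumes "smooth h" "\<And>t. h t \<noteq> 0"
  shows "smooth (\<lambda>t. inverse (h t))"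
proof (rule smooth_alg[of _ "insert (\<lambda>t. inverse (h t)) {f. smooth f}"])
  let ?C = "insert (\<lambda>t. inverse (h t)) {f. smooth f}"
  show "(\<lambda>t. inverse (h t)) \<in> function_algebra ?C" by (auto intro: alg_base)
  fix f assume f: "f \<in> ?C"
  show "\<exists>f'\<in>function_algebra ?C. \<forall>t. (f has_real_derivative f' t) (at t)"
  proof (cases "smooth f")
    case True
    then show ?thesis by (metis smooth_derivE alg_base insertCI mem_Collect_eq)
  next
    case False
    then have f: "f = (\<lambda>t. inverse (h t))" using f by auto
    obtain h' where h': "smooth h'" "\<And>t. (h has_real_derivative h' t) (at t)"
      using smooth_derivE assms(1) by blast
    have "(\<lambda>t. (-1) * (h' t * (f t * f t))) \<in> function_algebra ?C"
      using h'(1) by (intro alg_mult alg_const) (auto intro: alg_base simp: f)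
    moreover have "(f has_real_derivative (-1) * (h' t * (f t * f t))) (at t)" for t
      unfolding f using assms(2)[of t]
      by (auto intro!: derivative_eq_intros h'(2) simp: divide_simps power2_eq_square)
    ultimately show ?thesis by (intro bexI) auto
  qed
qed

lemma smooth_affine:
  assumes "smooth f" shows "smooth (\<lambda>t. f (a * t + b))"
proof (rule smooth_coinduct[of _ "{\<lambda>t. c * f (a * t + b) | c f. smooth f}"])
  show "(\<lambda>t. f (a * t + b)) \<in> {\<lambda>t. c * f (a * t + b) | c f. smooth f}"
    using assms by (auto intro!: exI[of _ 1] exI[of _ f])
  fix g assume "g \<in> {\<lambda>t. c * f (a * t + b) | c f. smooth f}"
  then obtain c f where g: "g = (\<lambda>t. c * f (a * t + b))" "smooth f" by auto
  then obtain f' where f': "smooth f'" "\<And>t. (f has_real_derivative f' t) (at t)"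
    using smooth_derivE by blast
  have "((\<lambda>t. f (a * t + b)) has_real_derivative f' (a * t + b) * a) (at t)" for t
    by (rule DERIV_chain2[OF f'(2)]) (auto intro!: derivative_eq_intros)
  then have "(g has_real_derivative (c * a) * f' (a * t + b)) (at t)" for t
    unfolding g by (auto intro!: derivative_eq_intros)
  then show "\<exists>g'\<in>{\<lambda>t. c * f (a * t + b) | c f. smooth f}. \<forall>t. (g has_real_derivative g' t) (at t)"
    using f'(1) by (intro bexI[of _ "\<lambda>t. (c * a) * f' (a * t + b)"]) auto
qed

text \<open>The derivatives of \<open>exp (- 1 / t)\<close>, extended by 0, are all of this shape.
  Carrying the polynomial as a parameter makes the family closed under differentiation.\<close>

definition flat_exp :: "real poly \<Rightarrow> real \<Rightarrow> real" where
  "flat_exp p t = (if t > 0 then poly p (1 / t) * exp (- (1 / t)) else 0)"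

lemma poly_times_exp_tendsto_0: "((\<lambda>x. poly p x * exp (- x)) \<longlongrightarrow> (0 :: real)) at_top"
proof -
  have "((\<lambda>x. \<Sum>i\<le>degree p. coeff p i * (x ^ i / exp x)) \<longlongrightarrow> (\<Sum>i\<le>degree p. coeff p i * 0)) at_top"
    by (intro tendsto_sum tendsto_mult tendsto_const tendsto_power_div_exp_0)
  then show ?thesis
    by (simp add: poly_altdef exp_minus divide_inverse sum_distrib_right mult.assoc)
qed

lemma flat_has_derivative:
  "(flat_exp p has_real_derivative flat_exp ([:0, 0, 1:] * (p - pderiv p)) t) (at t)"
proof -
  consider "t < 0" | "t = 0" | "t > 0" by linarith
  then show ?thesis
  proof cases
    case 1
    have "((\<lambda>_. 0) has_real_derivative 0) (at t)" by simp
    then have "(flat_exp p has_real_derivative 0) (at t)"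
      by (rule DERIV_cong_ev[THEN iffD1, rotated -1])
        (use 1 in \<open>auto simp: flat_exp_def intro!: eventually_mono[OF eventually_nhds_in_open[of "{..<0}"]]\<close>)
    then show ?thesis using 1 by (simp add: flat_exp_def)
  next
    case 2
    have "((\<lambda>h. (flat_exp p h - flat_exp p 0) / h) \<longlongrightarrow> 0) (at 0)"
    proof (rule filterlim_split_at)
      show "((\<lambda>h. (flat_exp p h - flat_exp p 0) / h) \<longlongrightarrow> 0) (at_left 0)"
        by (rule tendsto_eventually) (auto simp: flat_exp_def eventually_at_filter)
      \<comment> \<open>In the variable \<open>1 / h\<close> the difference quotient at 0 is again a
        polynomial times \<open>exp\<close>, with one more factor \<open>1 / h\<close>.\<close>
      have "((\<lambda>h. poly ([:0, 1:] * p) (inverse h) * exp (- inverse h)) \<longlongrightarrow> 0) (at_right 0)"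
        by (rule filterlim_compose[OF poly_times_exp_tendsto_0 filterlim_inverse_at_top_right])
      moreover have "\<forall>\<^sub>F h in at_right 0. poly ([:0, 1:] * p) (inverse h) * exp (- inverse h)
          = (flat_exp p h - flat_exp p 0) / h"
        by (auto simp: flat_exp_def eventually_at_filter divide_inverse)
      ultimately show "((\<lambda>h. (flat_exp p h - flat_exp p 0) / h) \<longlongrightarrow> 0) (at_right 0)"
        by (rule Lim_transform_eventually)
    qed
    then show ?thesis using 2 by (simp add: DERIV_def flat_exp_def)
  next
    case 3
    have "((\<lambda>t. poly p (1 / t) * exp (- (1 / t))) has_real_derivative
        poly ([:0, 0, 1:] * (p - pderiv p)) (1 / t) * exp (- (1 / t))) (at t)"
      using 3 by (auto intro!: derivative_eq_intros simp: field_simps power2_eq_square)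
    then have "(flat_exp p has_real_derivative
        poly ([:0, 0, 1:] * (p - pderiv p)) (1 / t) * exp (- (1 / t))) (at t)"
      by (rule DERIV_cong_ev[THEN iffD1, rotated -1])
        (use 3 in \<open>auto simp: flat_exp_def intro!: eventually_mono[OF eventually_nhds_in_open[of "{0<..}"]]\<close>)
    then show ?thesis using 3 by (simp add: flat_exp_def)
  qed
qed

lemma smooth_flat: "smooth (flat_exp p)"
  by (rule smooth_coinduct[of _ "range flat_exp"]) (use flat_has_derivative in blast)+

definition smooth_step :: "real \<Rightarrow> real" where
  "smooth_step t = flat_exp 1 t * inverse (flat_exp 1 t + flat_exp 1 (1 - t))"

lemma flat_1_nonneg: "flat_exp 1 t \<ge> 0" and flat_1_pos: "t > 0 \<Longrightarrow> flat_exp 1 t > 0"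
  and flat_1_zero: "t \<le> 0 \<Longrightarrow> flat_exp 1 t = 0"
  by (auto simp: flat_exp_def)

lemma flat_1_sum_pos: "flat_exp 1 t + flat_exp 1 (1 - t) > 0"
  using flat_1_nonneg[of t] flat_1_nonneg[of "1 - t"] flat_1_pos[of t] flat_1_pos[of "1 - t"]
  by (cases "t > 0") auto

lemma smooth_smooth_step: "smooth smooth_step"
proof -
  have "smooth (\<lambda>t. flat_exp 1 (1 - t))"
    using smooth_affine[OF smooth_flat[of 1], of "-1" 1] by simp
  then have "smooth (\<lambda>t. flat_exp 1 t * inverse (flat_exp 1 t + flat_exp 1 (1 - t)))"
    using flat_1_sum_pos
    by (intro smooth_mult smooth_inverse smooth_add smooth_flat) (auto simp: less_le)
  then show ?thesis by (simp add: smooth_step_def[abs_def])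
qed

lemma smooth_step_0: "t \<le> 0 \<Longrightarrow> smooth_step t = 0"
  and smooth_step_1: "t \<ge> 1 \<Longrightarrow> smooth_step t = 1"
  using flat_1_pos[of t] by (auto simp: smooth_step_def flat_1_zero)

section \<open>Nonnegativity of a function from its integrals\<close>

text \<open>The hypothesis makes the distribution function \<open>G\<close> of \<open>h\<close>
  increasing, so it defines an interval measure. Adding the measure whose density is the negative
  part of \<open>h\<close> gives the one whose density is the positive part, first on half-open
  intervals and then on Borel sets. The latter has no mass on \<open>{h < 0}\<close>, hence the
  negative part has none there either.\<close>

lemma AE_nonneg_if_set_integral_Ioc_nonneg:
  fixes h :: "real \<Rightarrow> real"
  assumes h: "integrable lborel h"
    and nonneg: "\<And>x y. x < y \<Longrightarrow> 0 \<le> (LINT t:{x<..y}|lborel. h t)"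
  shows "AE t in lborel. 0 \<le> h t"
proof -
  define G where "G x = (LINT t:{..x}|lborel. h t)" for x
  have si: "set_integrable lborel A h" if "A \<in> sets borel" for A
    unfolding set_integrable_def using integrable_mult_indicator[OF _ h, of A] that by auto
  have Gdiff: "G y - G x = (LINT t:{x<..y}|lborel. h t)" if "x \<le> y" for x y
  proof -
    have "G y = (LINT t:({..x} \<union> {x<..y})|lborel. h t)"
      unfolding G_def using that by (intro arg_cong[of _ _ "\<lambda>A. LINT t:A|lborel. h t"]) auto
    also have "\<dots> = G x + (LINT t:{x<..y}|lborel. h t)"
      unfolding G_def by (intro set_integral_Un si) auto
    finally show ?thesis by simp
  qed
  have mono: "G x \<le> G y" if "x \<le> y" for x y
    using nonneg[of x y] Gdiff[of x y] that by (cases "x = y") auto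
  have cont: "continuous (at_right x) G" for x
    unfolding continuous_within
  proof (rule tendsto_at_right_sequentially[where b = "x + 1"])
    show "x < x + 1" by simp
    fix S :: "nat \<Rightarrow> real" assume S: "\<And>n. x < S n" "S \<longlonglongrightarrow> x"
    show "(\<lambda>n. G (S n)) \<longlonglongrightarrow> G x"
      unfolding G_def set_lebesgue_integral_def
    proof (rule integral_dominated_convergence[where w = "\<lambda>t. \<bar>h t\<bar>"])
      show "AE t in lborel. (\<lambda>n. indicat_real {..S n} t *\<^sub>R h t) \<longlonglongrightarrow> indicat_real {..x} t *\<^sub>R h t"
      proof (rule AE_I2)
        fix t
        have "\<forall>\<^sub>F n in sequentially. indicat_real {..S n} t = indicat_real {..x} t"
        proof (cases "t \<le> x")
          case True
          then show ?thesis using S(1) by (auto intro!: always_eventually simp: indicator_def) (meson less_eq_real_def order_trans)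
        next
          case False
          then have "\<forall>\<^sub>F n in sequentially. S n < t"
            using order_tendstoD(2)[OF S(2)] by simp
          then show ?thesis by eventually_elim (use False in \<open>auto simp: indicator_def\<close>)
        qed
        then have "(\<lambda>n. indicat_real {..S n} t) \<longlonglongrightarrow> indicat_real {..x} t"
          by (rule tendsto_eventually)
        then show "(\<lambda>n. indicat_real {..S n} t *\<^sub>R h t) \<longlonglongrightarrow> indicat_real {..x} t *\<^sub>R h t"
          by (intro tendsto_intros)
      qed
    qed (use h in \<open>auto simp: indicator_def\<close>)
  qed
  define N1 where "N1 = density lborel (\<lambda>t. ennreal (h t))"
  define N2 where "N2 = density lborel (\<lambda>t. ennreal (- h t))"
  define R where "R = interval_measure G"
  \<comment> \<open>Moving the negative part to the side of \<open>R\<close> replaces a difference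
    of measures by a sum; the decomposition of \<open>h\<close> then reads
    \<open>M = N1\<close>.\<close>
  define M where "M = measure_of UNIV (sets borel) (\<lambda>X. emeasure R X + emeasure N2 X)"
  have hb[measurable]: "h \<in> borel_measurable borel" using h by auto
  have sM: "sets M = sets borel" by (simp add: M_def) (metis sets.sigma_sets_eq space_borel)
  have eM: "emeasure M X = emeasure R X + emeasure N2 X" if "X \<in> sets borel" for X
    unfolding M_def
  proof (rule emeasure_measure_of_sigma)
    show "sigma_algebra UNIV (sets borel)" by (metis sets.sigma_algebra_axioms space_borel)
    show "positive (sets borel) (\<lambda>X. emeasure R X + emeasure N2 X)" by (simp add: positive_def)
    show "countably_additive (sets borel) (\<lambda>X. emeasure R X + emeasure N2 X)"
    proof (rule countably_additiveI)
      fix A :: "nat \<Rightarrow> real set" assume A: "range A \<subseteq> sets borel" "disjoint_family A"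
      have "(\<Sum>i. emeasure R (A i) + emeasure N2 (A i)) = (\<Sum>i. emeasure R (A i)) + (\<Sum>i. emeasure N2 (A i))"
        by (intro suminf_add[symmetric] summableI)
      also have "(\<Sum>i. emeasure R (A i)) = emeasure R (\<Union>i. A i)"
        using A by (intro suminf_emeasure) (auto simp: R_def)
      also have "(\<Sum>i. emeasure N2 (A i)) = emeasure N2 (\<Union>i. A i)"
        using A by (intro suminf_emeasure) (auto simp: N2_def)
      finally show "(\<Sum>i. emeasure R (A i) + emeasure N2 (A i)) = emeasure R (\<Union>i. A i) + emeasure N2 (\<Union>i. A i)" .
    qed
    show "X \<in> sets borel" by fact
  qed
  have Ioc: "emeasure M {x<..y} = emeasure N1 {x<..y} \<and> emeasure N1 {x<..y} \<noteq> \<infinity>" for x y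
  proof (cases "x \<le> y")
    case True
    let ?I = "{x<..y}"
    have i1: "integrable lborel (\<lambda>t. indicator ?I t * max 0 (h t))"
      and i2: "integrable lborel (\<lambda>t. indicator ?I t * max 0 (- h t))"
      by (rule Bochner_Integration.integrable_bound[OF h]; auto simp: indicator_def)+
    have e1: "emeasure N1 ?I = ennreal (LINT t|lborel. indicator ?I t * max 0 (h t))"
    proof -
      have "emeasure N1 ?I = (\<integral>\<^sup>+t. ennreal (h t) * indicator ?I t \<partial>lborel)"
        unfolding N1_def by (subst emeasure_density) auto
      also have "\<dots> = (\<integral>\<^sup>+t. ennreal (indicator ?I t * max 0 (h t)) \<partial>lborel)"
        by (intro nn_integral_cong) (auto simp: indicator_def max_def ennreal_neg)
      also have "\<dots> = ennreal (LINT t|lborel. indicator ?I t * max 0 (h t))"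
        by (rule nn_integral_eq_integral[OF i1]) (auto simp: indicator_def)
      finally show ?thesis .
    qed
    have e2: "emeasure N2 ?I = ennreal (LINT t|lborel. indicator ?I t * max 0 (- h t))"
    proof -
      have "emeasure N2 ?I = (\<integral>\<^sup>+t. ennreal (- h t) * indicator ?I t \<partial>lborel)"
        unfolding N2_def by (subst emeasure_density) auto
      also have "\<dots> = (\<integral>\<^sup>+t. ennreal (indicator ?I t * max 0 (- h t)) \<partial>lborel)"
        by (intro nn_integral_cong) (auto simp: indicator_def max_def ennreal_neg)
      also have "\<dots> = ennreal (LINT t|lborel. indicator ?I t * max 0 (- h t))"
        by (rule nn_integral_eq_integral[OF i2]) (auto simp: indicator_def)
      finally show ?thesis .
    qed
    have "emeasure R ?I = ennreal (G y - G x)"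
      unfolding R_def by (rule emeasure_interval_measure_Ioc[OF True mono cont])
    moreover have "G y - G x + (LINT t|lborel. indicator ?I t * max 0 (- h t))
        = (LINT t|lborel. indicator ?I t * max 0 (h t))"
    proof -
      have "(LINT t|lborel. indicator ?I t * max 0 (h t)) - (LINT t|lborel. indicator ?I t * max 0 (- h t))
        = (LINT t|lborel. indicator ?I t * max 0 (h t) - indicator ?I t * max 0 (- h t))"
        by (rule Bochner_Integration.integral_diff[OF i1 i2, symmetric])
      also have "\<dots> = G y - G x"
        unfolding Gdiff[OF True] set_lebesgue_integral_def by (intro Bochner_Integration.integral_cong) (auto simp: max_def algebra_simps)
      finally show ?thesis by simp
    qed
    ultimately show ?thesis
      using mono[OF True] by (auto simp: eM e1 e2 simp flip: ennreal_plus)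
  qed simp
  have "M = N1"
  proof (rule measure_eqI_generator_eq[where \<Omega> = UNIV and E = "range (\<lambda>(a, b). {a<..b})"
        and A = "\<lambda>n :: nat. {- real n<..real n}"])
    show "Int_stable (range (\<lambda>(a, b :: real). {a<..b}))"
    proof (rule Int_stableI_image)
      fix i j :: "real \<times> real"
      show "\<exists>k\<in>UNIV. (case i of (a, b) \<Rightarrow> {a<..b}) \<inter> (case j of (a, b) \<Rightarrow> {a<..b}) = (case k of (a, b) \<Rightarrow> {a<..b})"
        by (intro bexI[of _ "(max (fst i) (fst j), min (snd i) (snd j))"]) (auto split: prod.splits)
    qed
    show "sets M = sigma_sets UNIV (range (\<lambda>(a, b). {a<..b}))"
      unfolding sM by (subst borel_sigma_sets_Ioc) simp
    show "sets N1 = sigma_sets UNIV (range (\<lambda>(a, b). {a<..b}))"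
      unfolding N1_def by (subst sets_density, subst sets_lborel, subst borel_sigma_sets_Ioc) simp
    show "(\<Union>n :: nat. {- real n<..real n}) = UNIV"
    proof (intro set_eqI iffI UNIV_I UN_iff[THEN iffD2])
      fix x :: real
      obtain n :: nat where "real n > \<bar>x\<bar>" using reals_Archimedean2 by blast
      then show "\<exists>n\<in>UNIV. x \<in> {- real n<..real n}" by (intro bexI[of _ n]) auto
    qed
    show "emeasure M X = emeasure N1 X" if "X \<in> range (\<lambda>(a, b). {a<..b})" for X
      using Ioc that by auto
    show "emeasure M {- real n<..real n} \<noteq> \<infinity>" for n
      using Ioc[of "- real n" "real n"] by simp
  qed auto
  define E where "E = {t. h t < 0}"
  have E: "E \<in> sets borel" unfolding E_def by measurable
  have "emeasure N1 E = (\<integral>\<^sup>+t. ennreal (h t) * indicator E t \<partial>lborel)"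
    unfolding N1_def using E by (subst emeasure_density) auto
  also have "\<dots> = (\<integral>\<^sup>+(t :: real). 0 \<partial>lborel)"
    by (rule nn_integral_cong) (auto simp: E_def indicator_def ennreal_neg)
  finally have "emeasure N1 E = 0" by simp
  then have "emeasure N2 E = 0" using eM[OF E] \<open>M = N1\<close> by simp
  then have "(\<integral>\<^sup>+t. ennreal (- h t) * indicator E t \<partial>lborel) = 0"
    unfolding N2_def using E by (subst (asm) emeasure_density) auto
  then have "AE t in lborel. ennreal (- h t) * indicator E t = 0"
    using E by (subst (asm) nn_integral_0_iff_AE) auto
  then show ?thesis
    by eventually_elim (auto simp: E_def indicator_def ennreal_eq_0_iff split: if_splits)
qed

section \<open>Bernstein weights of a positive functional\<close>

text \<open>Bernstein weights reproduce moments with \<open>(k choose m) / (N choose m)\<close> in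
  place of \<open>(k / N)^m\<close>. The former is a product of factors
  \<open>(k - i) / (N - i)\<close>, each within \<open>m / (N - m)\<close> of \<open>k / N\<close>,
  and two products of factors of modulus at most 1 differ by at most the sum of the differences of
  the factors.\<close>

lemma binomial_ratio_approx:
  assumes "k \<le> N" "2 * m \<le> N" "0 < N"
  shows "\<bar>real (k choose m) / real (N choose m) - (real k / real N) ^ m\<bar> \<le> real m * (real m / real (N - m))"
proof -
  let ?z = "\<lambda>i. (real k - real i) / (real N - real i)"
  have "real (k choose m) / real (N choose m) = (\<Prod>i=0..<m. ?z i)"
    by (simp add: binomial_gbinomial gbinomial_prod_rev prod_dividef)
  moreover have "(real k / real N) ^ m = (\<Prod>i=0..<m. real k / real N)" by simp
  moreover have "\<bar>(\<Prod>i=0..<m. ?z i) - (\<Prod>i=0..<m. real k / real N)\<bar> \<le> (\<Sum>i=0..<m. \<bar>?z i - real k / real N\<bar>)"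
  proof (rule norm_prod_diff[where 'a = real, unfolded real_norm_def])
    fix i assume i: "i \<in> {0..<m}"
    \<comment> \<open>A factor with \<open>k < i\<close> is negative; \<open>2 * m \<le> N\<close>
      keeps its modulus below 1.\<close>
    show "\<bar>?z i\<bar> \<le> 1" using i assms by (auto simp: abs_le_iff divide_simps)
    show "\<bar>real k / real N\<bar> \<le> 1" using assms by auto
  qed
  moreover have "(\<Sum>i=0..<m. \<bar>?z i - real k / real N\<bar>) \<le> (\<Sum>i=0..<m. real m / real (N - m))"
  proof (rule sum_mono)
    fix i assume i: "i \<in> {0..<m}"
    have pos: "real N - real i > 0" "real (N - m) > 0" using i assms by auto
    have "?z i - real k / real N = - (real i * (real N - real k)) / ((real N - real i) * real N)"
      using pos assms(3) by (simp add: field_simps)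
    then have "\<bar>?z i - real k / real N\<bar> = real i * (real N - real k) / ((real N - real i) * real N)"
      using pos assms by (simp add: abs_mult)
    also have "\<dots> \<le> real m * real N / (real (N - m) * real N)"
      using i assms pos by (intro frac_le mult_mono) auto
    finally show "\<bar>?z i - real k / real N\<bar> \<le> real m / real (N - m)" using assms by simp
  qed
  ultimately show ?thesis by simp
qed

text \<open>Stands for integration against a positive measure on \<open>[0, c]\<close>. Positivity
  is asked on the products \<open>t^k (c - t)^l\<close>, which is what Bernstein weights require and
  what can be verified directly for operators.\<close>

locale interval_positive_functional =
  fixes L :: "real poly \<Rightarrow> real" and c :: real
  assumes add: "L (p + q) = L p + L q"
    and smult: "L (smult a p) = a * L p"
    and c_pos: "c > 0"
    and nonneg: "L ([:0, 1:] ^ k * [:c, -1:] ^ l) \<ge> 0"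
begin

text \<open>The value of \<open>L\<close> on the Bernstein basis polynomial of index
  \<open>k\<close> and degree \<open>N\<close> on \<open>[0, c]\<close>; it serves as the mass at
  the point \<open>c * k / N\<close>.\<close>

definition w :: "nat \<Rightarrow> nat \<Rightarrow> real" where
  "w N k = real (N choose k) / c ^ N * L ([:0, 1:] ^ k * [:c, -1:] ^ (N - k))"

lemma w_nonneg: "w N k \<ge> 0"
  using nonneg c_pos by (simp add: w_def)

lemma L_0: "L 0 = 0"
  using smult[of 0 0] by simp

lemma L_sum: "L (\<Sum>i\<in>I. f i) = (\<Sum>i\<in>I. L (f i))"
  by (induction I rule: infinite_finite_induct) (auto simp: add L_0)

text \<open>Multiplying by \<open>(X + (c - X))^(N - m) = c^(N - m)\<close> and expanding raises
  every term to total degree \<open>N\<close>; the identity \<open>choose_mult\<close> then turns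
  the coefficients into weights.\<close>

lemma L_X_power:
  assumes "m \<le> N"
  shows "L ([:0, 1:] ^ m) = c ^ m * (\<Sum>k\<le>N. w N k * (real (k choose m) / real (N choose m)))"
proof -
  let ?X = "[:0, 1:] :: real poly" and ?Y = "[:c, -1:]"
  have "smult (c ^ (N - m)) (?X ^ m) = (?X + ?Y) ^ (N - m) * ?X ^ m"
    by (simp add: poly_const_pow)
  also have "\<dots> = (\<Sum>i\<le>N - m. of_nat (N - m choose i) * ?X ^ i * ?Y ^ (N - m - i)) * ?X ^ m"
    by (simp only: binomial_ring)
  also have "\<dots> = (\<Sum>i\<le>N - m. smult (real (N - m choose i)) (?X ^ (i + m) * ?Y ^ (N - (i + m))))"
    unfolding sum_distrib_right by (intro sum.cong) (auto simp: power_add of_nat_poly mult_ac add.commute)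
  also have "\<dots> = (\<Sum>k\<in>{m..N}. smult (real (N - m choose (k - m))) (?X ^ k * ?Y ^ (N - k)))"
    by (rule sum.reindex_bij_witness[of _ "\<lambda>k. k - m" "\<lambda>i. i + m"]) (use assms in auto)
  finally have "c ^ (N - m) * L (?X ^ m) = (\<Sum>k\<in>{m..N}. real (N - m choose (k - m)) * L (?X ^ k * ?Y ^ (N - k)))"
    by (metis (no_types, lifting) L_sum smult sum.cong)
  also have "\<dots> = (\<Sum>k\<in>{m..N}. c ^ N * (w N k * (real (k choose m) / real (N choose m))))"
  proof (rule sum.cong[OF refl])
    fix k assume k: "k \<in> {m..N}"
    then have "real (N choose k) * real (k choose m) = real (N choose m) * real (N - m choose (k - m))"
      using choose_mult[of m k N] by (metis atLeastAtMost_iff of_nat_mult)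
    moreover have "real (N choose m) > 0" using assms by simp
    ultimately have "real (N - m choose (k - m)) = real (N choose k) * (real (k choose m) / real (N choose m))"
      by (simp add: field_simps)
    then show "real (N - m choose (k - m)) * L (?X ^ k * ?Y ^ (N - k))
        = c ^ N * (w N k * (real (k choose m) / real (N choose m)))"
      using c_pos by (simp add: w_def)
  qed
  also have "\<dots> = (\<Sum>k\<le>N. c ^ N * (w N k * (real (k choose m) / real (N choose m))))"
    by (rule sum.mono_neutral_left) auto
  also have "\<dots> = c ^ (N - m) * (c ^ m * (\<Sum>k\<le>N. w N k * (real (k choose m) / real (N choose m))))"
    using assms by (simp add: sum_distrib_left mult.assoc flip: power_add mult.assoc)
  finally show ?thesis using c_pos by simp
qed

lemma sum_w: "(\<Sum>k\<le>N. w N k) = L 1"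
  using L_X_power[of 0 N] by simp

lemma tendsto_L_X_power:
  "(\<lambda>N. \<Sum>k\<le>N. w N k * (c * (real k / real N)) ^ m) \<longlonglongrightarrow> L ([:0, 1:] ^ m)"
proof -
  have "(\<lambda>N. c ^ m * (L 1 * (real m * (real m / real (N - m))))) \<longlonglongrightarrow> c ^ m * (L 1 * (real m * 0))"
    by (intro tendsto_intros real_tendsto_divide_at_top[OF tendsto_const]
        filterlim_compose[OF filterlim_real_sequentially] filterlim_minus_const_nat_at_top)
  then have lim: "(\<lambda>N. c ^ m * (L 1 * (real m * (real m / real (N - m))))) \<longlonglongrightarrow> 0" by simp
  have ev: "\<forall>\<^sub>F N in sequentially. norm ((\<Sum>k\<le>N. w N k * (c * (real k / real N)) ^ m) - L ([:0, 1:] ^ m))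
      \<le> c ^ m * (L 1 * (real m * (real m / real (N - m))))"
    using eventually_ge_at_top[of "Suc (2 * m)"]
  proof eventually_elim
    case (elim N)
    let ?d = "\<lambda>k. (real k / real N) ^ m - real (k choose m) / real (N choose m)"
    have "m \<le> N" using elim by simp
    have "\<bar>\<Sum>k\<le>N. w N k * ?d k\<bar> \<le> (\<Sum>k\<le>N. \<bar>w N k * ?d k\<bar>)" by (rule sum_abs)
    also have "\<dots> \<le> (\<Sum>k\<le>N. w N k * (real m * (real m / real (N - m))))"
    proof (rule sum_mono)
      fix k assume "k \<in> {..N}"
      then have "\<bar>?d k\<bar> \<le> real m * (real m / real (N - m))"
        using binomial_ratio_approx[of k N m] elim by (simp add: abs_minus_commute)
      then show "\<bar>w N k * ?d k\<bar> \<le> w N k * (real m * (real m / real (N - m)))"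
        unfolding abs_mult using w_nonneg[of N k] by (intro mult_mono) auto
    qed
    also have "\<dots> = L 1 * (real m * (real m / real (N - m)))"
      by (simp only: sum_distrib_right[symmetric] sum_w)
    finally have bound: "\<bar>\<Sum>k\<le>N. w N k * ?d k\<bar> \<le> L 1 * (real m * (real m / real (N - m)))" .
    have diff: "(\<Sum>k\<le>N. w N k * (c * (real k / real N)) ^ m) - L ([:0, 1:] ^ m) = c ^ m * (\<Sum>k\<le>N. w N k * ?d k)"
      unfolding L_X_power[OF \<open>m \<le> N\<close>] power_mult_distrib
      by (simp add: sum_distrib_left sum_subtractf algebra_simps)
    have "\<bar>c ^ m\<bar> * \<bar>\<Sum>k\<le>N. w N k * ?d k\<bar> \<le> c ^ m * (L 1 * (real m * (real m / real (N - m))))"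
      using c_pos mult_left_mono[OF bound, of "c ^ m"] by simp
    then show ?case unfolding diff real_norm_def abs_mult .
  qed
  show ?thesis by (rule LIM_zero_cancel) (rule Lim_null_comparison[OF ev lim])
qed

lemma L_eq_sum: "L p = (\<Sum>i\<le>degree p. coeff p i * L ([:0, 1:] ^ i))"
proof -
  have "p = (\<Sum>i\<le>degree p. smult (coeff p i) ([:0, 1:] ^ i))"
    by (subst poly_as_sum_of_monoms[of p, symmetric]) (simp add: monom_altdef)
  then have "L p = L (\<Sum>i\<le>degree p. smult (coeff p i) ([:0, 1:] ^ i))" by simp
  then show ?thesis by (simp add: L_sum smult)
qed

lemma tendsto_L: "(\<lambda>N. \<Sum>k\<le>N. w N k * poly p (c * (real k / real N))) \<longlonglongrightarrow> L p"
proof -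
  have "(\<lambda>N. \<Sum>i\<le>degree p. coeff p i * (\<Sum>k\<le>N. w N k * (c * (real k / real N)) ^ i)) \<longlonglongrightarrow> L p"
    unfolding L_eq_sum[of p] by (intro tendsto_intros tendsto_L_X_power)
  moreover have "(\<Sum>i\<le>degree p. coeff p i * (\<Sum>k\<le>N. w N k * (c * (real k / real N)) ^ i))
      = (\<Sum>k\<le>N. w N k * poly p (c * (real k / real N)))" for N
    by (simp add: poly_altdef sum_distrib_left sum.swap[of _ "{..degree p}"] mult_ac)
  ultimately show ?thesis by simp
qed

text \<open>Every discrete approximation has total mass \<open>L 1\<close>, so a pointwise bound on
  \<open>[0, c]\<close> survives the limit. For operators this provides the norm bound on
  polynomials of \<open>A\<close> that the spectral theorem would give.\<close>

lemma L_le: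
  assumes "\<And>t. 0 \<le> t \<Longrightarrow> t \<le> c \<Longrightarrow> poly p t \<le> b"
  shows "L p \<le> b * L 1"
proof (rule LIMSEQ_le_const2[OF tendsto_L], intro exI[of _ 1] allI impI)
  fix N :: nat assume "1 \<le> N"
  have "(\<Sum>k\<le>N. w N k * poly p (c * (real k / real N))) \<le> (\<Sum>k\<le>N. w N k * b)"
    using c_pos \<open>1 \<le> N\<close>
    by (intro sum_mono mult_left_mono assms w_nonneg) (auto simp: divide_simps)
  also have "\<dots> = b * L 1"
    by (simp only: sum_distrib_right[symmetric] sum_w) (simp only: mult.commute)
  finally show "(\<Sum>k\<le>N. w N k * poly p (c * (real k / real N))) \<le> b * L 1" .
qed

end

section \<open>The secular equation\<close>

lemma monic_eq_if_card_roots: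
  fixes p q :: "real poly"
  assumes "degree p = n" "degree q = n" "lead_coeff p = lead_coeff q"
    and "finite R" "card R = n" "\<And>x. x \<in> R \<Longrightarrow> poly p x = poly q x" "n > 0"
  shows "p = q"
proof (rule ccontr)
  assume "p \<noteq> q"
  then have "p - q \<noteq> 0" by simp
  have "degree (p - q) < n"
  proof (rule ccontr)
    assume "\<not> degree (p - q) < n"
    then have "degree (p - q) = n" using degree_diff_le_max[of p q] assms by simp
    then have "lead_coeff (p - q) = 0" using assms by simp
    then have "p - q = 0" by (rule leading_coeff_0_iff[THEN iffD1])
    then show False using \<open>p - q \<noteq> 0\<close> by simp
  qed
  moreover have "card R \<le> card {x. poly (p - q) x = 0}"
    using assms(6) \<open>p - q \<noteq> 0\<close> by (intro card_mono poly_roots_finite) auto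
  moreover have "card {x. poly (p - q) x = 0} \<le> degree (p - q)"
    using card_poly_roots_bound[of "p - q"] \<open>p - q \<noteq> 0\<close> by simp
  ultimately show False using assms by simp
qed

lemma degree_prod_linear:
  fixes t :: "nat \<Rightarrow> real"
  assumes "finite I"
  shows "degree (\<Prod>i\<in>I. [:- t i, 1:]) = card I" and "coeff (\<Prod>i\<in>I. [:- t i, 1:]) (card I) = 1"
proof -
  show deg: "degree (\<Prod>i\<in>I. [:- t i, 1:]) = card I"
    using assms by (simp add: degree_prod_eq_sum_degree)
  have "lead_coeff (\<Prod>i\<in>I. [:- t i, 1:]) = 1" by (simp add: lead_coeff_prod)
  then show "coeff (\<Prod>i\<in>I. [:- t i, 1:]) (card I) = 1" unfolding deg .
qed

text \<open>Nodes and masses of a discrete measure. The zeros of \<open>secular_poly\<close> are the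
  eigenvalues of the diagonal matrix with entries \<open>t k\<close> after adding the rank one
  matrix of the vector with entries \<open>sqrt (m k)\<close>.\<close>

locale secular =
  fixes N :: nat and t m :: "nat \<Rightarrow> real"
  assumes t_less: "i < j \<Longrightarrow> j \<le> N \<Longrightarrow> t i < t j"
    and m_pos: "k \<le> N \<Longrightarrow> m k > 0"
begin

definition minor :: "nat \<Rightarrow> real poly" where
  "minor k = (\<Prod>j\<in>{..N} - {k}. [:- t j, 1:])"

definition secular_poly :: "real poly" where
  "secular_poly = (\<Prod>j\<le>N. [:- t j, 1:]) - (\<Sum>k\<le>N. smult (m k) (minor k))"

lemma poly_secular_node:
  assumes "k \<le> N"
  shows "poly secular_poly (t k) = - m k * poly (minor k) (t k)"
proof -
  have "poly (\<Prod>j\<le>N. [:- t j, 1:]) (t k) = 0"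
    using assms by (auto simp: poly_prod prod_zero_iff)
  moreover have "(\<Sum>i\<le>N. m i * poly (minor i) (t k)) = (\<Sum>i\<in>{k}. m i * poly (minor i) (t k))"
  proof (rule sum.mono_neutral_right)
    show "\<forall>i\<in>{..N} - {k}. m i * poly (minor i) (t k) = 0"
      using assms by (auto simp: minor_def poly_prod prod_zero_iff)
  qed (use assms in auto)
  ultimately show ?thesis by (simp add: secular_poly_def poly_sum)
qed

text \<open>Seen from two neighbouring nodes, the differences to any other node have equal signs;
  only the difference between the two nodes themselves changes sign.\<close>

lemma minor_sign_change:
  assumes "Suc k \<le> N"
  shows "poly (minor k) (t k) * poly (minor (Suc k)) (t (Suc k)) < 0"
proof -
  let ?J = "{..N} - {k, Suc k}"
  have e1: "poly (minor k) (t k) = (t k - t (Suc k)) * (\<Prod>j\<in>?J. t k - t j)"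
  proof -
    have *: "{..N} - {k} = insert (Suc k) ?J" using assms by auto
    show ?thesis unfolding minor_def poly_prod * by (subst prod.insert) auto
  qed
  have e2: "poly (minor (Suc k)) (t (Suc k)) = (t (Suc k) - t k) * (\<Prod>j\<in>?J. t (Suc k) - t j)"
  proof -
    have *: "{..N} - {Suc k} = insert k ?J" using assms by auto
    show ?thesis unfolding minor_def poly_prod * by (subst prod.insert) auto
  qed
  have "(\<Prod>j\<in>?J. (t k - t j) * (t (Suc k) - t j)) > 0"
  proof (rule prod_pos)
    fix j assume "j \<in> ?J"
    then have "j < k \<or> Suc k < j \<and> j \<le> N" by auto
    then consider "j < k" | "Suc k < j" "j \<le> N" by blast
    then show "(t k - t j) * (t (Suc k) - t j) > 0"
    proof cases
      case 1
      then show ?thesis using t_less[of j k] t_less[of j "Suc k"] assms by simp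
    next
      case 2
      then show ?thesis using t_less[of k j] t_less[of "Suc k" j] by (intro mult_neg_neg) auto
    qed
  qed
  moreover have "(t k - t (Suc k)) * (t (Suc k) - t k) < 0"
    using t_less[of k "Suc k"] assms by (intro mult_neg_pos) auto
  ultimately have "((t k - t (Suc k)) * (t (Suc k) - t k)) * (\<Prod>j\<in>?J. (t k - t j) * (t (Suc k) - t j)) < 0"
    by (rule mult_neg_pos[rotated])
  then show ?thesis by (simp add: e1 e2 prod.distrib mult_ac)
qed

lemma poly_secular_off_nodes:
  assumes "\<And>j. j \<le> N \<Longrightarrow> x \<noteq> t j"
  shows "poly secular_poly x = (\<Prod>j\<le>N. x - t j) * (1 - (\<Sum>k\<le>N. m k / (x - t k)))"
proof -
  have "poly (minor k) x = (\<Prod>j\<le>N. x - t j) / (x - t k)" if "k \<le> N" for k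
    using that assms[of k] by (simp add: minor_def poly_prod prod.remove[of "{..N}" k])
  then have "(\<Sum>k\<le>N. m k * poly (minor k) x) = (\<Sum>k\<le>N. (\<Prod>j\<le>N. x - t j) * (m k / (x - t k)))"
    by (intro sum.cong) auto
  then show ?thesis
    by (simp add: secular_poly_def poly_sum poly_prod algebra_simps sum_distrib_left)
qed

lemma ex_root_between:
  assumes "k < N"
  shows "\<exists>x. t k < x \<and> x < t (Suc k) \<and> poly secular_poly x = 0"
proof -
  have "poly secular_poly (t k) * poly secular_poly (t (Suc k))
    = (m k * m (Suc k)) * (poly (minor k) (t k) * poly (minor (Suc k)) (t (Suc k)))"
    using assms by (simp add: poly_secular_node mult_ac)
  also have "\<dots> < 0"
    using minor_sign_change[of k] m_pos[of k] m_pos[of "Suc k"] assms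
    by (intro mult_pos_neg[OF mult_pos_pos]) simp_all
  finally show ?thesis
    using poly_IVT[of "t k" "t (Suc k)" secular_poly] t_less[of k "Suc k"] assms by auto
qed

text \<open>At \<open>t N\<close> only the last minor survives and the value is negative. Further
  right by the total mass, every denominator is at least that mass, so the secular sum is at most 1
  and the value is nonnegative.\<close>

lemma ex_root_above: "\<exists>x. t N < x \<and> x \<le> t N + (\<Sum>k\<le>N. m k) \<and> poly secular_poly x = 0"
proof -
  define s where "s = (\<Sum>k\<le>N. m k)"
  have s: "s > 0" unfolding s_def by (rule sum_pos) (auto intro: m_pos)
  have gap: "t N + s - t k \<ge> s" if "k \<le> N" for k
    using t_less[of k N] that by (cases "k = N") auto
  have "(\<Sum>k\<le>N. m k / (t N + s - t k)) \<le> (\<Sum>k\<le>N. m k / s)"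
    using gap s m_pos by (intro sum_mono divide_left_mono) (auto intro: less_imp_le mult_pos_pos less_le_trans)
  also have "\<dots> = 1" using s by (simp add: s_def flip: sum_divide_distrib)
  finally have le: "(\<Sum>k\<le>N. m k / (t N + s - t k)) \<le> 1" .
  have "poly secular_poly (t N + s) = (\<Prod>j\<le>N. t N + s - t j) * (1 - (\<Sum>k\<le>N. m k / (t N + s - t k)))"
    by (rule poly_secular_off_nodes) (use gap s in fastforce)
  also have "\<dots> \<ge> 0"
    using gap s le by (intro mult_nonneg_nonneg prod_nonneg) (use s in \<open>auto simp: add.commute intro: order_trans[OF _ gap] dest!: gap\<close>)
  finally have ge: "poly secular_poly (t N + s) \<ge> 0" .
  have "poly (minor N) (t N) > 0"
    unfolding minor_def poly_prod by (rule prod_pos) (use t_less in \<open>auto simp: le_less\<close>)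
  then have lt: "poly secular_poly (t N) < 0"
    using poly_secular_node[of N] m_pos[of N] by (simp add: mult_pos_neg)
  have "\<exists>x\<ge>t N. x \<le> t N + s \<and> poly secular_poly x = 0"
    using lt ge s by (intro IVT') (auto intro!: continuous_intros)
  then show ?thesis using lt unfolding s_def by (metis less_irrefl order_le_less)
qed

text \<open>One zero in each of the \<open>N\<close> gaps and one beyond the last node exhaust the
  degree \<open>N + 1\<close>, so the interlacing zeros give the full factorization.\<close>

lemma ex_roots:
  obtains b where "\<And>k. k \<le> N \<Longrightarrow> t k < b k" "\<And>k. k < N \<Longrightarrow> b k < t (Suc k)"
    "b N \<le> t N + (\<Sum>k\<le>N. m k)" "secular_poly = (\<Prod>k\<le>N. [:- b k, 1:])"
proof -
  obtain b where b: "\<And>k. k < N \<Longrightarrow> t k < b k \<and> b k < t (Suc k) \<and> poly secular_poly (b k) = 0"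
      "t N < b N \<and> b N \<le> t N + (\<Sum>k\<le>N. m k) \<and> poly secular_poly (b N) = 0"
  proof -
    obtain f x where f: "\<And>k. k < N \<Longrightarrow> t k < f k \<and> f k < t (Suc k) \<and> poly secular_poly (f k) = 0"
      and x: "t N < x \<and> x \<le> t N + (\<Sum>k\<le>N. m k) \<and> poly secular_poly x = 0"
      using ex_root_between ex_root_above by metis
    show ?thesis by (rule that[of "f(N := x)"]) (use f x in auto)
  qed
  have b_gt: "t k < b k" if "k \<le> N" for k using b that by (cases "k = N") auto
  have b_less: "b i < b j" if "i < j" "j \<le> N" for i j
  proof -
    have "b i < t (Suc i)" using b(1)[of i] that by simp
    also have "t (Suc i) \<le> t j" using t_less[of "Suc i" j] that by (cases "Suc i = j") auto
    also have "t j < b j" using b_gt that by simp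
    finally show ?thesis .
  qed
  have inj: "inj_on b {..N}"
    by (rule inj_onI) (metis atMost_iff less_irrefl linorder_neqE_nat b_less)
  let ?P = "\<Prod>j\<le>N. [:- t j, 1:]" and ?S = "\<Sum>k\<le>N. smult (m k) (minor k)"
  have "degree ?S \<le> N"
    by (intro degree_sum_le) (auto simp: minor_def degree_prod_linear intro!: order_trans[OF degree_smult_le])
  moreover have P: "degree ?P = Suc N" "lead_coeff ?P = 1"
    using degree_prod_linear[of "{..N}" t] by auto
  ultimately have deg: "degree secular_poly = Suc N" "lead_coeff secular_poly = 1"
  proof -
    have "degree (?P + - ?S) = degree ?P"
      using P \<open>degree ?S \<le> N\<close> by (intro degree_add_eq_left) auto
    then show "degree secular_poly = Suc N" using P by (simp add: secular_poly_def)
    moreover have "coeff ?S (Suc N) = 0" using \<open>degree ?S \<le> N\<close> by (intro coeff_eq_0) simp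
    ultimately show "lead_coeff secular_poly = 1" using P by (simp add: secular_poly_def)
  qed
  have "secular_poly = (\<Prod>k\<le>N. [:- b k, 1:])"
  proof (rule monic_eq_if_card_roots[where R = "b ` {..N}" and n = "Suc N"])
    show "card (b ` {..N}) = Suc N" using card_image[OF inj] by simp
    show "poly secular_poly x = poly (\<Prod>k\<le>N. [:- b k, 1:]) x" if "x \<in> b ` {..N}" for x
    proof -
      obtain k where k: "k \<le> N" "x = b k" using \<open>x \<in> b ` {..N}\<close> by auto
      then have "poly secular_poly x = 0" using b by (cases "k = N") auto
      moreover have "poly (\<Prod>k\<le>N. [:- b k, 1:]) x = 0" using k by (auto simp: poly_prod prod_zero_iff)
      ultimately show ?thesis by simp
    qed
  qed (use deg degree_prod_linear[of "{..N}" b] in auto)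
  with b b_gt show ?thesis by (intro that) auto
qed

lemma prod_roots_eq:
  assumes "secular_poly = (\<Prod>k\<le>N. [:- b k, 1:])" "\<And>j. j \<le> N \<Longrightarrow> x \<noteq> t j"
  shows "(\<Prod>k\<le>N. x - b k) = (\<Prod>k\<le>N. x - t k) * (1 - (\<Sum>k\<le>N. m k / (x - t k)))"
  using poly_secular_off_nodes[OF assms(2)] assms(1) by (simp add: poly_prod)

text \<open>Substituting \<open>1 / w\<close> and clearing denominators reverses the coefficients.
  The resulting factors \<open>1 - t k * w\<close> are invertible as power series, which prepares
  the logarithmic derivative at 0.\<close>

lemma reflected_secular_poly:
  assumes "secular_poly = (\<Prod>k\<le>N. [:- b k, 1:])"
  shows "(\<Prod>k\<le>N. [:1, - b k:]) = (\<Prod>k\<le>N. [:1, - t k:])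
    - (\<Sum>k\<le>N. smult (m k) (pCons 0 (\<Prod>j\<in>{..N} - {k}. [:1, - t j:])))"
proof (rule poly_eq_poly_eq_iff[THEN iffD1], rule ext)
  fix w :: real
  show "poly (\<Prod>k\<le>N. [:1, - b k:]) w = poly ((\<Prod>k\<le>N. [:1, - t k:])
    - (\<Sum>k\<le>N. smult (m k) (pCons 0 (\<Prod>j\<in>{..N} - {k}. [:1, - t j:])))) w"
  proof (cases "w = 0")
    case True
    then show ?thesis by (simp add: poly_prod poly_sum)
  next
    case False
    have scale: "w ^ card I * (\<Prod>i\<in>I. 1 / w - a i) = (\<Prod>i\<in>I. 1 - w * a i)" for I and a :: "nat \<Rightarrow> real"
      using False by (simp add: right_diff_distrib flip: prod.distrib prod_constant)
    have "(\<Prod>k\<le>N. 1 - w * b k) = w ^ Suc N * poly secular_poly (1 / w)"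
      unfolding assms using scale[of "{..N}" b] by (simp add: poly_prod)
    also have "\<dots> = w ^ Suc N * (\<Prod>k\<le>N. 1 / w - t k)
        - (\<Sum>k\<le>N. m k * (w * (w ^ N * (\<Prod>j\<in>{..N} - {k}. 1 / w - t j))))"
      by (simp add: secular_poly_def minor_def poly_prod poly_sum right_diff_distrib sum_distrib_left mult_ac)
    also have "w ^ Suc N * (\<Prod>k\<le>N. 1 / w - t k) = (\<Prod>k\<le>N. 1 - w * t k)"
      using scale[of "{..N}" t] by simp
    also have "(\<Sum>k\<le>N. m k * (w * (w ^ N * (\<Prod>j\<in>{..N} - {k}. 1 / w - t j))))
        = (\<Sum>k\<le>N. m k * (w * (\<Prod>j\<in>{..N} - {k}. 1 - w * t j)))"
    proof (rule sum.cong[OF refl])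
      fix k assume "k \<in> {..N}"
      then show "m k * (w * (w ^ N * (\<Prod>j\<in>{..N} - {k}. 1 / w - t j)))
          = m k * (w * (\<Prod>j\<in>{..N} - {k}. 1 - w * t j))"
        using scale[of "{..N} - {k}" t] by simp
    qed
    finally show ?thesis by (simp add: poly_prod poly_sum mult_ac)
  qed
qed

end

section \<open>Power sums of zeros and poles as formal power series\<close>

definition geom_fps :: "real \<Rightarrow> real fps" where
  "geom_fps a = Abs_fps (\<lambda>n. a ^ n)"

lemma one_minus_mult_geom_fps: "(1 - fps_const a * fps_X) * geom_fps a = 1"
proof (rule fps_ext)
  fix n
  show "fps_nth ((1 - fps_const a * fps_X) * geom_fps a) n = fps_nth 1 n"
    by (cases n) (auto simp: geom_fps_def left_diff_distrib mult.assoc)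
qed

text \<open>Logarithmic differentiation without division: a factor \<open>l = 1 - a X\<close>
  contributes \<open>X l' / l = 1 - 1 / l\<close>, and \<open>1 / l\<close> is the geometric
  series.\<close>

lemma fps_X_deriv_prod_linear:
  assumes "finite I"
  shows "fps_X * fps_deriv (\<Prod>i\<in>I. 1 - fps_const (a i) * fps_X)
    = (\<Prod>i\<in>I. 1 - fps_const (a i) * fps_X) * (\<Sum>i\<in>I. 1 - geom_fps (a i))"
  using assms
proof induction
  case empty
  then show ?case by simp
next
  case (insert i I)
  let ?l = "1 - fps_const (a i) * fps_X" and ?P = "\<Prod>i\<in>I. 1 - fps_const (a i) * fps_X"
  let ?S = "\<Sum>i\<in>I. 1 - geom_fps (a i)"
  have product_rule: "fps_X * fps_deriv (l * P) = fps_X * fps_deriv l * P + l * (fps_X * fps_deriv P)" for l P :: "real fps"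
    by (simp add: algebra_simps)
  have "fps_X * fps_deriv ?l = - (fps_const (a i) * fps_X)" by (simp add: mult.commute)
  also have "\<dots> = ?l * (1 - geom_fps (a i))"
    using one_minus_mult_geom_fps[of "a i"] by (simp add: right_diff_distrib)
  finally have l: "fps_X * fps_deriv ?l = ?l * (1 - geom_fps (a i))" .
  have "fps_X * fps_deriv (?l * ?P) = ?l * (1 - geom_fps (a i)) * ?P + ?l * (?P * ?S)"
    unfolding product_rule l insert.IH ..
  also have "\<dots> = ?l * ?P * (1 - geom_fps (a i) + ?S)"
    by (simp only: distrib_left mult_ac)
  finally show ?case using insert.hyps by simp
qed

text \<open>The reflected factorization says \<open>?E b = ?E t * (1 - X S)\<close>, and logarithmic
  derivatives give \<open>T = X (X S)' / (1 - X S)\<close>. In this form the measure enters only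
  through its moments, so that the relation can be compared with the traces of operators.\<close>

lemma (in secular) root_moments_fps:
  assumes "secular_poly = (\<Prod>k\<le>N. [:- b k, 1:])"
  defines "S \<equiv> Abs_fps (\<lambda>n. \<Sum>k\<le>N. m k * t k ^ n)"
    and "T \<equiv> Abs_fps (\<lambda>n. \<Sum>k\<le>N. b k ^ n - t k ^ n)"
  shows "T * (1 - fps_X * S) = fps_X * fps_deriv (fps_X * S)"
proof -
  let ?E = "\<lambda>a :: nat \<Rightarrow> real. \<Prod>k\<le>N. 1 - fps_const (a k) * fps_X"
  have lin: "fps_of_poly [:1, - a:] = 1 - fps_const a * fps_X" for a :: real
    by (simp add: fps_of_poly_pCons fps_const_neg[symmetric] del: fps_const_neg)
  have shift: "fps_of_poly (pCons 0 p) = fps_X * fps_of_poly p" for p :: "real poly"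
    by (simp add: fps_of_poly_pCons mult.commute)
  have S: "S = (\<Sum>k\<le>N. fps_const (m k) * geom_fps (t k))"
    by (rule fps_ext) (simp add: S_def geom_fps_def fps_sum_nth)
  have T: "T = (\<Sum>k\<le>N. 1 - geom_fps (t k)) - (\<Sum>k\<le>N. 1 - geom_fps (b k))"
    by (rule fps_ext) (simp add: T_def geom_fps_def fps_sum_nth sum_subtractf)
  have "?E b = ?E t - (\<Sum>k\<le>N. fps_const (m k) * (fps_X * (\<Prod>j\<in>{..N} - {k}. 1 - fps_const (t j) * fps_X)))"
    using arg_cong[OF reflected_secular_poly[OF assms(1)], of fps_of_poly]
    by (simp only: fps_of_poly_diff fps_of_poly_sum fps_of_poly_smult fps_of_poly_prod lin shift)
  also have "(\<Sum>k\<le>N. fps_const (m k) * (fps_X * (\<Prod>j\<in>{..N} - {k}. 1 - fps_const (t j) * fps_X)))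
      = (\<Sum>k\<le>N. ?E t * (fps_X * (fps_const (m k) * geom_fps (t k))))"
  proof (rule sum.cong[OF refl])
    fix k assume "k \<in> {..N}"
    then have "?E t = (1 - fps_const (t k) * fps_X) * (\<Prod>j\<in>{..N} - {k}. 1 - fps_const (t j) * fps_X)"
      by (intro prod.remove) auto
    then have "?E t * geom_fps (t k)
        = ((1 - fps_const (t k) * fps_X) * geom_fps (t k)) * (\<Prod>j\<in>{..N} - {k}. 1 - fps_const (t j) * fps_X)"
      by (simp only: mult_ac)
    also have "\<dots> = (\<Prod>j\<in>{..N} - {k}. 1 - fps_const (t j) * fps_X)"
      by (simp only: one_minus_mult_geom_fps mult_1)
    finally have g: "?E t * geom_fps (t k) = (\<Prod>j\<in>{..N} - {k}. 1 - fps_const (t j) * fps_X)" .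
    show "fps_const (m k) * (fps_X * (\<Prod>j\<in>{..N} - {k}. 1 - fps_const (t j) * fps_X))
        = ?E t * (fps_X * (fps_const (m k) * geom_fps (t k)))"
      unfolding g[symmetric] by (simp only: mult_ac)
  qed
  also have "\<dots> = ?E t * (fps_X * S)" by (simp add: S sum_distrib_left)
  finally have E: "?E b = ?E t * (1 - fps_X * S)" by (simp add: right_diff_distrib)
  \<comment> \<open>The extra factor \<open>Et\<close> avoids inverses of power series; being
    nonzero, \<open>?E t\<close> is cancelled at the end.\<close>
  have log_deriv: "Et * (T * (1 - fps_X * S)) = Et * (fps_X * fps_deriv (fps_X * S))"
    if "Eb = Et * (1 - fps_X * S)" "fps_X * fps_deriv Eb = Eb * B" "fps_X * fps_deriv Et = Et * A" "T = A - B"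
    for Et Eb A B S T :: "real fps"
  proof -
    let ?U = "1 - fps_X * S" and ?D = "fps_deriv (fps_X * S)"
    have "Et * ?U * B = fps_X * fps_deriv (Et * ?U)" using that(1,2) by simp
    also have "\<dots> = fps_X * (Et * (- ?D) + fps_deriv Et * ?U)"
      by (simp only: fps_deriv_mult[of Et] fps_deriv_sub fps_deriv_1 diff_0)
    also have "\<dots> = (fps_X * fps_deriv Et) * ?U - Et * (fps_X * ?D)"
      by (simp only: distrib_left mult_ac mult_minus_right) simp
    finally have "Et * A * ?U - Et * ?U * B = Et * (fps_X * ?D)" unfolding that(3) by simp
    moreover have "Et * A * ?U - Et * ?U * B = Et * ((A - B) * ?U)"
      by (simp only: right_diff_distrib[of Et] left_diff_distrib[of A] mult_ac)
    ultimately show ?thesis unfolding that(4) by simp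
  qed
  have "?E t * (T * (1 - fps_X * S)) = ?E t * (fps_X * fps_deriv (fps_X * S))"
    by (rule log_deriv[OF E _ _ T]) (rule fps_X_deriv_prod_linear, simp)+
  moreover have "?E t \<noteq> 0"
  proof -
    have "1 - fps_const a * fps_X \<noteq> 0" for a :: real
      using one_minus_mult_geom_fps[of a] by auto
    then show ?thesis by (simp add: prod_zero_iff)
  qed
  ultimately show ?thesis by simp
qed

text \<open>Comparing coefficients gives a triangular recursion: coefficient \<open>n\<close> of
  \<open>T\<close> is determined by the coefficients of \<open>S\<close> and \<open>T\<close> below
  \<open>n\<close>. Coefficientwise convergence therefore passes from \<open>S\<close> to
  \<open>T\<close>.\<close>

lemma log_deriv_fps_tendsto:
  fixes S T :: "nat \<Rightarrow> real fps"
  assumes "\<And>N. T N * (1 - fps_X * S N) = fps_X * fps_deriv (fps_X * S N)"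
    and "T' * (1 - fps_X * S') = fps_X * fps_deriv (fps_X * S')"
    and "\<And>k. (\<lambda>N. fps_nth (S N) k) \<longlonglongrightarrow> fps_nth S' k"
  shows "(\<lambda>N. fps_nth (T N) n) \<longlonglongrightarrow> fps_nth T' n"
proof (induction n rule: less_induct)
  case (less n)
  have rec: "fps_nth T n = (if n = 0 then 0 else real n * fps_nth S (n - 1) + (\<Sum>i=0..n - 1. fps_nth T i * fps_nth S (n - 1 - i)))"
    if "T * (1 - fps_X * S) = fps_X * fps_deriv (fps_X * S)" for T S :: "real fps"
  proof -
    have "T = fps_X * fps_deriv (fps_X * S) + fps_X * (T * S)"
      using that by (simp add: algebra_simps)
    then have "fps_nth T n = fps_nth (fps_X * fps_deriv (fps_X * S) + fps_X * (T * S)) n" by simp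
    moreover have "fps_nth (fps_X * fps_deriv (fps_X * S)) n = (if n = 0 then 0 else real n * fps_nth S (n - 1))"
      by (cases n) (simp_all add: distrib_right add.commute)
    moreover have "fps_nth (fps_X * (T * S)) n = (if n = 0 then 0 else (\<Sum>i=0..n - 1. fps_nth T i * fps_nth S (n - 1 - i)))"
      by (simp add: fps_mult_nth[of T S])
    ultimately show ?thesis by (simp only: fps_add_nth) simp
  qed
  show ?case
  proof (cases "n = 0")
    case True
    then show ?thesis using rec[OF assms(1)] rec[OF assms(2)] by simp
  next
    case False
    have "(\<lambda>N. real n * fps_nth (S N) (n - 1) + (\<Sum>i=0..n - 1. fps_nth (T N) i * fps_nth (S N) (n - 1 - i)))
        \<longlonglongrightarrow> real n * fps_nth S' (n - 1) + (\<Sum>i=0..n - 1. fps_nth T' i * fps_nth S' (n - 1 - i))"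
      using False by (intro tendsto_intros assms(3) less.IH) auto
    then show ?thesis using False rec[OF assms(1)] rec[OF assms(2)] by simp
  qed
qed

section \<open>Spectral shift functions of discrete measures\<close>

lemma integral_lborel_indicator_Icc_FTC:
  fixes f F :: "real \<Rightarrow> real"
  assumes "a \<le> b" "\<And>x. a \<le> x \<Longrightarrow> x \<le> b \<Longrightarrow> (F has_real_derivative f x) (at x)" "continuous_on {a..b} f"
  shows "integrable lborel (\<lambda>x. indicator {a..b} x * f x)"
    and "(LINT x|lborel. indicator {a..b} x * f x) = F b - F a"
proof -
  have "has_bochner_integral lborel (\<lambda>x. indicator {a..b} x *\<^sub>R f x) (F b - F a)"
    using assms by (intro has_bochner_integral_FTC_Icc)
      (auto simp: has_real_derivative_iff_has_vector_derivative[symmetric] intro: has_field_derivative_at_within)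
  then show "integrable lborel (\<lambda>x. indicator {a..b} x * f x)"
    and "(LINT x|lborel. indicator {a..b} x * f x) = F b - F a"
    by (auto simp: has_bochner_integral_iff)
qed

context secular
begin

text \<open>Against the indicator of the intervals from \<open>t k\<close> to \<open>b k\<close>,
  disjoint by interlacing, a derivative \<open>F'\<close> integrates to
  \<open>\<Sum>k\<le>N. F (b k) - F (t k)\<close>. The choice \<open>F x = x^n\<close> gives the
  moments and \<open>F x = ln (x + \<epsilon>)\<close> the logarithm of the determinant.\<close>

lemma ex_spectral_shift:
  assumes t0: "t 0 \<ge> 0"
  obtains \<xi> :: "real \<Rightarrow> real" where
    "\<xi> \<in> borel_measurable borel"
    "\<And>x. 0 \<le> \<xi> x" "\<And>x. \<xi> x \<le> indicator {0..t N + (\<Sum>k\<le>N. m k)} x"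
    "Abs_fps (\<lambda>n. LINT x|lborel. \<xi> x * (real n * x ^ (n - 1)))
        * (1 - fps_X * Abs_fps (\<lambda>n. \<Sum>k\<le>N. m k * t k ^ n))
      = fps_X * fps_deriv (fps_X * Abs_fps (\<lambda>n. \<Sum>k\<le>N. m k * t k ^ n))"
    "\<And>\<epsilon>. \<epsilon> > 0 \<Longrightarrow> (LINT x|lborel. \<xi> x * (1 / (x + \<epsilon>))) = ln (1 + (\<Sum>k\<le>N. m k / (t k + \<epsilon>)))"
proof -
  obtain b where b: "\<And>k. k \<le> N \<Longrightarrow> t k < b k" "\<And>k. k < N \<Longrightarrow> b k < t (Suc k)"
    "b N \<le> t N + (\<Sum>k\<le>N. m k)" "secular_poly = (\<Prod>k\<le>N. [:- b k, 1:])"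
    using ex_roots by blast
  define \<xi> where "\<xi> x = (\<Sum>k\<le>N. indicat_real {t k..b k} x)" for x
  have t_nonneg: "t k \<ge> 0" if "k \<le> N" for k
    using t0 t_less[of 0 k] that by (cases "k = 0") auto
  have b_less: "b i < t j" if "i < j" "j \<le> N" for i j
    using b(2)[of i] t_less[of "Suc i" j] that by (cases "Suc i = j") auto
  have b_le: "b k \<le> t N + (\<Sum>k\<le>N. m k)" if "k \<le> N" for k
    using b_less[of k N] b(3) b(1)[of N] that by (cases "k = N") auto
  have integral: "(LINT x|lborel. \<xi> x * f x) = (\<Sum>k\<le>N. F (b k) - F (t k))"
    if F: "\<And>x. x \<ge> 0 \<Longrightarrow> (F has_real_derivative f x) (at x)" and f: "continuous_on {0..} f" for f F :: "real \<Rightarrow> real"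
  proof -
    have *: "integrable lborel (\<lambda>x. indicator {t k..b k} x * f x)"
      "(LINT x|lborel. indicator {t k..b k} x * f x) = F (b k) - F (t k)" if k: "k \<le> N" for k
      using integral_lborel_indicator_Icc_FTC[of "t k" "b k" F f] b(1)[OF k] t_nonneg[OF k]
        F continuous_on_subset[OF f, of "{t k..b k}"]
      by auto
    have "(LINT x|lborel. \<xi> x * f x) = (LINT x|lborel. (\<Sum>k\<le>N. indicator {t k..b k} x * f x))"
      by (simp add: \<xi>_def sum_distrib_right)
    also have "\<dots> = (\<Sum>k\<le>N. LINT x|lborel. indicator {t k..b k} x * f x)"
      by (rule Bochner_Integration.integral_sum) (use * in auto)
    finally show ?thesis using * by simp
  qed
  show ?thesis
  proof (rule that[of \<xi>])
    show "\<xi> \<in> borel_measurable borel" unfolding \<xi>_def by measurable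
    show "0 \<le> \<xi> x" for x unfolding \<xi>_def by (intro sum_nonneg) auto
    show "\<xi> x \<le> indicator {0..t N + (\<Sum>k\<le>N. m k)} x" for x
    proof (cases "\<exists>k\<le>N. x \<in> {t k..b k}")
      case True
      then obtain k where k: "k \<le> N" "x \<in> {t k..b k}" by blast
      have "x \<notin> {t j..b j}" if "j \<le> N" "j \<noteq> k" for j
        using b_less[of j k] b_less[of k j] k that by (cases "j < k") auto
      then have "\<xi> x = (\<Sum>j\<in>{k}. indicat_real {t j..b j} x)"
        unfolding \<xi>_def using k by (intro sum.mono_neutral_right) auto
      then have "\<xi> x = 1" using k by simp
      moreover have "x \<in> {0..t N + (\<Sum>k\<le>N. m k)}"
        using k t_nonneg[OF k(1)] b_le[OF k(1)] by auto
      ultimately show ?thesis by simp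
    next
      case False
      then have "\<xi> x = 0" unfolding \<xi>_def by (intro sum.neutral) auto
      then show ?thesis by (simp add: indicator_def)
    qed
    have "(LINT x|lborel. \<xi> x * (real n * x ^ (n - 1))) = (\<Sum>k\<le>N. b k ^ n - t k ^ n)" for n
      by (rule integral) (auto intro!: derivative_eq_intros continuous_intros)
    then show "Abs_fps (\<lambda>n. LINT x|lborel. \<xi> x * (real n * x ^ (n - 1)))
        * (1 - fps_X * Abs_fps (\<lambda>n. \<Sum>k\<le>N. m k * t k ^ n))
      = fps_X * fps_deriv (fps_X * Abs_fps (\<lambda>n. \<Sum>k\<le>N. m k * t k ^ n))"
      using root_moments_fps[OF b(4)] by simp
    fix \<epsilon> :: real assume \<epsilon>: "\<epsilon> > 0"
    have "(LINT x|lborel. \<xi> x * (1 / (x + \<epsilon>))) = (\<Sum>k\<le>N. ln (b k + \<epsilon>) - ln (t k + \<epsilon>))"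
      by (rule integral) (use \<epsilon> in \<open>auto intro!: derivative_eq_intros continuous_intros simp: divide_simps\<close>)
    also have "\<dots> = (\<Sum>k\<le>N. ln (b k + \<epsilon>)) - (\<Sum>k\<le>N. ln (t k + \<epsilon>))" by (rule sum_subtractf)
    also have "\<dots> = ln (\<Prod>k\<le>N. b k + \<epsilon>) - ln (\<Prod>k\<le>N. t k + \<epsilon>)"
      using \<epsilon> t_nonneg b(1) by (subst (1 2) ln_prod) (fastforce intro: add_nonneg_pos less_imp_le)+
    \<comment> \<open>This is the factorized secular polynomial evaluated at
      \<open>- \<epsilon>\<close>, a point to the left of all nodes.\<close>
    also have "(\<Prod>k\<le>N. b k + \<epsilon>) = (\<Prod>k\<le>N. t k + \<epsilon>) * (1 + (\<Sum>k\<le>N. m k / (t k + \<epsilon>)))"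
    proof -
      have neg: "(\<Prod>k\<le>N. - \<epsilon> - a k) = (-1) ^ Suc N * (\<Prod>k\<le>N. a k + \<epsilon>)" for a :: "nat \<Rightarrow> real"
      proof -
        have "(\<Prod>k\<le>N. - \<epsilon> - a k) = (\<Prod>k\<le>N. (-1) * (a k + \<epsilon>))" by (intro prod.cong) auto
        then show ?thesis by (simp only: prod.distrib prod_constant card_atMost)
      qed
      have "m k / (- \<epsilon> - t k) = - (m k / (t k + \<epsilon>))" for k
        by (metis add.commute minus_add_distrib minus_divide_right uminus_add_conv_diff diff_conv_add_uminus)
      then have "(\<Prod>k\<le>N. - \<epsilon> - b k) = (\<Prod>k\<le>N. - \<epsilon> - t k) * (1 + (\<Sum>k\<le>N. m k / (t k + \<epsilon>)))"
        using prod_roots_eq[OF b(4), of "- \<epsilon>"] \<epsilon> t_nonneg by (fastforce simp: sum_negf)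
      then show ?thesis unfolding neg by simp
    qed
    also have "ln ((\<Prod>k\<le>N. t k + \<epsilon>) * (1 + (\<Sum>k\<le>N. m k / (t k + \<epsilon>))))
        = ln (\<Prod>k\<le>N. t k + \<epsilon>) + ln (1 + (\<Sum>k\<le>N. m k / (t k + \<epsilon>)))"
    proof (rule ln_mult_pos)
      show "0 < (\<Prod>k\<le>N. t k + \<epsilon>)" using \<epsilon> t_nonneg by (intro prod_pos) (auto intro: add_nonneg_pos)
      have "0 \<le> (\<Sum>k\<le>N. m k / (t k + \<epsilon>))"
        using \<epsilon> t_nonneg m_pos by (intro sum_nonneg divide_nonneg_nonneg) (auto intro: less_imp_le)
      then show "0 < 1 + (\<Sum>k\<le>N. m k / (t k + \<epsilon>))" by simp
    qed
    finally show "(LINT x|lborel. \<xi> x * (1 / (x + \<epsilon>))) = ln (1 + (\<Sum>k\<le>N. m k / (t k + \<epsilon>)))" by simp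
  qed
qed

end

section \<open>Weak convergence of spectral shift functions\<close>

lemma bounded_times_vanishing:
  fixes \<xi> g :: "real \<Rightarrow> real"
  assumes \<xi>: "integrable lborel \<xi>" "\<And>x. x \<notin> {-b..b} \<Longrightarrow> \<xi> x = 0"
    and g: "g \<in> borel_measurable borel" "\<And>x. x \<in> {-b..b} \<Longrightarrow> \<bar>g x\<bar> \<le> d"
  shows "integrable lborel (\<lambda>x. \<xi> x * g x)"
    and "\<bar>LINT x|lborel. \<xi> x * g x\<bar> \<le> d * (LINT x|lborel. \<bar>\<xi> x\<bar>)"
proof -
  have bound: "\<bar>\<xi> x * g x\<bar> \<le> d * \<bar>\<xi> x\<bar>" for x
    using \<xi>(2)[of x] mult_right_mono[OF g(2)[of x], of "\<bar>\<xi> x\<bar>"]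
    by (cases "x \<in> {-b..b}") (auto simp: abs_mult mult.commute)
  show int: "integrable lborel (\<lambda>x. \<xi> x * g x)"
  proof (rule Bochner_Integration.integrable_bound)
    show "integrable lborel (\<lambda>x. d * \<bar>\<xi> x\<bar>)" using \<xi>(1) by auto
    show "AE x in lborel. norm (\<xi> x * g x) \<le> norm (d * \<bar>\<xi> x\<bar>)"
      using bound by (auto intro!: AE_I2 order_trans[OF _ abs_ge_self])
  qed (use \<xi>(1) g(1) in measurable)
  have "\<bar>LINT x|lborel. \<xi> x * g x\<bar> \<le> (LINT x|lborel. \<bar>\<xi> x * g x\<bar>)"
    by (rule integral_abs_bound)
  also have "\<dots> \<le> (LINT x|lborel. d * \<bar>\<xi> x\<bar>)"
    by (rule integral_mono) (use int \<xi>(1) bound in auto)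
  finally show "\<bar>LINT x|lborel. \<xi> x * g x\<bar> \<le> d * (LINT x|lborel. \<bar>\<xi> x\<bar>)" by simp
qed

lemma continuous_times_vanishing_integrable:
  fixes \<xi> g :: "real \<Rightarrow> real"
  assumes \<xi>: "integrable lborel \<xi>" "\<And>x. x \<notin> {-b..b} \<Longrightarrow> \<xi> x = 0" and g: "continuous_on UNIV g"
  shows "integrable lborel (\<lambda>x. \<xi> x * g x)"
proof -
  have "compact (g ` {-b..b})"
    using g continuous_on_subset by (intro compact_continuous_image) auto
  then obtain d where "\<forall>x\<in>{-b..b}. \<bar>g x\<bar> \<le> d"
    by (auto dest!: compact_imp_bounded simp: bounded_iff)
  then show ?thesis
    using g by (intro bounded_times_vanishing(1)[OF \<xi>, where g = g and d = d]) (auto intro: borel_measurable_continuous_onI)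
qed

text \<open>On the common interval \<open>f\<close> is uniformly close to a polynomial, whose
  integrals converge by hypothesis. The bound \<open>B\<close> on the integrals of the absolute
  values makes the approximation error uniform in \<open>N\<close>.\<close>

lemma moments_imp_weak_convergence:
  fixes \<xi> f :: "real \<Rightarrow> real" and \<xi>s :: "nat \<Rightarrow> real \<Rightarrow> real"
  assumes \<xi>: "integrable lborel \<xi>" "\<And>x. x \<notin> {-b..b} \<Longrightarrow> \<xi> x = 0"
    and \<xi>s: "\<And>N. integrable lborel (\<xi>s N)" "\<And>N x. x \<notin> {-b..b} \<Longrightarrow> \<xi>s N x = 0"
    and bound: "\<And>N. (LINT x|lborel. \<bar>\<xi>s N x\<bar>) \<le> B"
    and moments: "\<And>k. (\<lambda>N. LINT x|lborel. \<xi>s N x * x ^ k) \<longlonglongrightarrow> (LINT x|lborel. \<xi> x * x ^ k)"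
    and f: "continuous_on UNIV f"
  shows "(\<lambda>N. LINT x|lborel. \<xi>s N x * f x) \<longlonglongrightarrow> (LINT x|lborel. \<xi> x * f x)"
proof (rule LIMSEQ_I)
  fix e :: real assume e: "e > 0"
  define C where "C = \<bar>B\<bar> + (LINT x|lborel. \<bar>\<xi> x\<bar>) + 1"
  have "(LINT x|lborel. \<bar>\<xi> x\<bar>) \<ge> 0" by simp
  then have C: "C > 0" "B \<le> C" "(LINT x|lborel. \<bar>\<xi> x\<bar>) \<le> C" unfolding C_def by linarith+
  define d where "d = e / (3 * C)"
  have d: "d > 0" using e C by (simp add: d_def)
  have "continuous_on {-b..b} f" using f by (rule continuous_on_subset) simp
  then obtain p where "real_polynomial_function p" "\<And>x. x \<in> {-b..b} \<Longrightarrow> \<bar>f x - p x\<bar> < d"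
    using Stone_Weierstrass_real_polynomial_function[of "{-b..b}" f d] d by blast
  then obtain a n where p: "\<And>x. x \<in> {-b..b} \<Longrightarrow> \<bar>f x - p x\<bar> \<le> d" "p = (\<lambda>x. \<Sum>i\<le>n. a i * x ^ i)"
    unfolding real_polynomial_function_iff_sum by (metis less_imp_le)
  have pc: "continuous_on UNIV p" unfolding p(2) by (intro continuous_intros)
  have p_int: "(LINT x|lborel. h x * p x) = (\<Sum>i\<le>n. a i * (LINT x|lborel. h x * x ^ i))"
    if h: "integrable lborel h" "\<And>x. x \<notin> {-b..b} \<Longrightarrow> h x = 0" for h :: "real \<Rightarrow> real"
  proof -
    have i: "integrable lborel (\<lambda>x. h x * x ^ i)" for i
      by (rule continuous_times_vanishing_integrable[OF h]) (auto intro!: continuous_intros)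
    have "(LINT x|lborel. h x * p x) = (LINT x|lborel. (\<Sum>i\<le>n. a i * (h x * x ^ i)))"
      by (simp add: p(2) sum_distrib_left mult_ac)
    also have "\<dots> = (\<Sum>i\<le>n. LINT x|lborel. a i * (h x * x ^ i))"
      by (rule Bochner_Integration.integral_sum) (use i in auto)
    finally show ?thesis by simp
  qed
  have close: "\<bar>(LINT x|lborel. h x * f x) - (LINT x|lborel. h x * p x)\<bar> \<le> d * C"
    if h: "integrable lborel h" "\<And>x. x \<notin> {-b..b} \<Longrightarrow> h x = 0" "(LINT x|lborel. \<bar>h x\<bar>) \<le> C" for h :: "real \<Rightarrow> real"
  proof -
    have "(LINT x|lborel. h x * f x) - (LINT x|lborel. h x * p x) = (LINT x|lborel. h x * f x - h x * p x)"
      using continuous_times_vanishing_integrable[OF h(1,2)] f pc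
      by (intro Bochner_Integration.integral_diff[symmetric]) auto
    also have "\<dots> = (LINT x|lborel. h x * (f x - p x))" by (simp add: right_diff_distrib)
    also have "\<bar>\<dots>\<bar> \<le> d * (LINT x|lborel. \<bar>h x\<bar>)"
      using f pc p(1) by (intro bounded_times_vanishing(2)[OF h(1,2)])
        (auto intro!: borel_measurable_continuous_onI continuous_on_diff)
    also have "\<dots> \<le> d * C" using h(3) d by simp
    finally show ?thesis .
  qed
  have "(\<lambda>N. LINT x|lborel. \<xi>s N x * p x) \<longlonglongrightarrow> (LINT x|lborel. \<xi> x * p x)"
  proof -
    have "(\<lambda>N. \<Sum>i\<le>n. a i * (LINT x|lborel. \<xi>s N x * x ^ i)) \<longlonglongrightarrow> (\<Sum>i\<le>n. a i * (LINT x|lborel. \<xi> x * x ^ i))"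
      by (intro tendsto_intros moments)
    moreover have "(LINT x|lborel. \<xi>s N x * p x) = (\<Sum>i\<le>n. a i * (LINT x|lborel. \<xi>s N x * x ^ i))" for N
      by (rule p_int) (use \<xi>s in auto)
    moreover have "(LINT x|lborel. \<xi> x * p x) = (\<Sum>i\<le>n. a i * (LINT x|lborel. \<xi> x * x ^ i))"
      by (rule p_int) (use \<xi> in auto)
    ultimately show ?thesis by simp
  qed
  from LIMSEQ_D[OF this, of "e / 3"] e
  obtain n0 where n0: "\<And>N. N \<ge> n0 \<Longrightarrow> \<bar>(LINT x|lborel. \<xi>s N x * p x) - (LINT x|lborel. \<xi> x * p x)\<bar> < e / 3"
    by auto
  have "d * C = e / 3" using C by (simp add: d_def)
  show "\<exists>n0. \<forall>N\<ge>n0. norm ((LINT x|lborel. \<xi>s N x * f x) - (LINT x|lborel. \<xi> x * f x)) < e"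
  proof (intro exI allI impI)
    fix N assume N: "n0 \<le> N"
    have 1: "\<bar>(LINT x|lborel. \<xi>s N x * f x) - (LINT x|lborel. \<xi>s N x * p x)\<bar> \<le> e / 3"
      using close[OF \<xi>s] bound[of N] C \<open>d * C = e / 3\<close> by (metis order_trans)
    have 2: "\<bar>(LINT x|lborel. \<xi> x * f x) - (LINT x|lborel. \<xi> x * p x)\<bar> \<le> e / 3"
      using close[OF \<xi>] C \<open>d * C = e / 3\<close> by metis
    show "norm ((LINT x|lborel. \<xi>s N x * f x) - (LINT x|lborel. \<xi> x * f x)) < e"
      using 1 2 n0[OF N] unfolding real_norm_def by linarith
  qed
qed

definition clamp01 :: "real \<Rightarrow> real" where
  "clamp01 u = max 0 (min 1 u)"

text \<open>The ramps \<open>clamp01 (n * (t - x))\<close> rise from 0 to 1 just to the right of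
  \<open>x\<close>. A difference of two of them is an admissible \<open>f\<close>, and these
  differences converge pointwise to the indicator of \<open>{x<..y}\<close>.\<close>

lemma AE_nonneg_if_continuous_integral_nonneg:
  fixes h :: "real \<Rightarrow> real"
  assumes h: "integrable lborel h"
    and nonneg: "\<And>f. continuous_on UNIV f \<Longrightarrow> (\<And>x. 0 \<le> f x) \<Longrightarrow> (\<And>x. f x \<le> 1) \<Longrightarrow> 0 \<le> (LINT x|lborel. h x * f x)"
  shows "AE x in lborel. 0 \<le> h x"
proof (rule AE_nonneg_if_set_integral_Ioc_nonneg[OF h])
  fix x y :: real assume xy: "x < y"
  define f where "f n t = clamp01 (real n * (t - x)) - clamp01 (real n * (t - y))" for n t
  have f_cont: "continuous_on UNIV (f n)" for n
    unfolding f_def clamp01_def by (intro continuous_intros)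
  have f_bounds: "0 \<le> f n t" "f n t \<le> 1" for n t
  proof -
    have "real n * (t - y) \<le> real n * (t - x)" using xy by (intro mult_left_mono) auto
    then show "0 \<le> f n t" "f n t \<le> 1" by (auto simp: f_def clamp01_def)
  qed
  have clamp_lim: "(\<lambda>n. clamp01 (real n * (t - z))) \<longlonglongrightarrow> indicator {z<..} t" for t z
  proof (cases "t \<le> z")
    case True
    then have "clamp01 (real n * (t - z)) = 0" for n
      using mult_nonneg_nonpos[of "real n" "t - z"] by (auto simp: clamp01_def)
    then show ?thesis using True by simp
  next
    case False
    have "\<forall>\<^sub>F n in sequentially. clamp01 (real n * (t - z)) = 1"
      using eventually_ge_at_top[of "nat \<lceil>1 / (t - z)\<rceil>"]
    proof eventually_elim
      case (elim n)
      then have "1 / (t - z) \<le> real n" by linarith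
      then show ?case using False by (simp add: clamp01_def field_simps)
    qed
    then show ?thesis using False by (intro tendsto_eventually) simp
  qed
  have "(\<lambda>n. LINT t|lborel. h t * f n t) \<longlonglongrightarrow> (LINT t|lborel. indicator {x<..y} t *\<^sub>R h t)"
  proof (rule integral_dominated_convergence[where w = "\<lambda>t. \<bar>h t\<bar>"])
    show "AE t in lborel. (\<lambda>n. h t * f n t) \<longlonglongrightarrow> indicator {x<..y} t *\<^sub>R h t"
    proof (rule AE_I2)
      fix t
      have "(\<lambda>n. h t * f n t) \<longlonglongrightarrow> h t * (indicator {x<..} t - indicator {y<..} t)"
        unfolding f_def by (intro tendsto_intros clamp_lim)
      also have "h t * (indicator {x<..} t - indicator {y<..} t) = indicator {x<..y} t *\<^sub>R h t"
        using xy by (auto simp: indicator_def)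
      finally show "(\<lambda>n. h t * f n t) \<longlonglongrightarrow> indicator {x<..y} t *\<^sub>R h t" .
    qed
    show "AE t in lborel. norm (h t * f n t) \<le> \<bar>h t\<bar>" for n
      using f_bounds by (auto simp: abs_mult intro!: AE_I2 mult_left_le)
    show "(\<lambda>t. h t * f n t) \<in> borel_measurable lborel" for n
      using h f_cont[of n] by (auto intro!: borel_measurable_times intro: borel_measurable_continuous_onI)
    show "(\<lambda>t. indicator {x<..y} t *\<^sub>R h t) \<in> borel_measurable lborel" using h by measurable
    show "integrable lborel (\<lambda>t. \<bar>h t\<bar>)" using h by simp
  qed
  then show "0 \<le> (LINT t:{x<..y}|lborel. h t)"
    unfolding set_lebesgue_integral_def
    by (rule LIMSEQ_le_const) (use nonneg[OF f_cont f_bounds] in auto)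
qed

text \<open>For \<open>u\<close> above \<open>1 / n\<close> the sum behaves like
  \<open>1 / u\<close>, below it like \<open>n\<close>. Multiplied by \<open>u + 1 / n\<close>, the
  sum \<open>P\<close> becomes \<open>1 - q^n + P / n\<close> with \<open>q = 1 - u\<close>, and
  \<open>q^n \<le> P / n \<le> 1\<close> yields the constants 1 and 2.\<close>

lemma geometric_sum_resolvent_bounds:
  fixes u :: real
  assumes "0 \<le> u" "u \<le> 1" "n \<ge> 1"
  shows "1 / (u + 1 / real n) \<le> (\<Sum>j<n. (1 - u) ^ j)" "(\<Sum>j<n. (1 - u) ^ j) \<le> 2 / (u + 1 / real n)"
proof -
  let ?P = "\<Sum>j<n. (1 - u) ^ j"
  have "u * ?P = 1 - (1 - u) ^ n"
    using sum_gp_basic[of "1 - u" "n - 1"] assms(3) by (simp add: lessThan_Suc_atMost[symmetric])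
  moreover have "?P \<le> (\<Sum>j<n. 1)" using assms by (intro sum_mono power_le_one) auto
  moreover have "(\<Sum>j<n. (1 - u) ^ n) \<le> ?P" using assms by (intro sum_mono power_decreasing) auto
  moreover have "(1 - u) ^ n \<ge> 0" using assms by simp
  moreover have "?P * (u + 1 / real n) = u * ?P + ?P / real n" by (simp add: algebra_simps)
  ultimately have "?P * (u + 1 / real n) = 1 - (1 - u) ^ n + ?P / real n" "(1 - u) ^ n \<le> ?P / real n"
    "?P / real n \<le> 1" "(1 - u) ^ n \<ge> 0"
    using assms(3) by (auto simp: pos_le_divide_eq pos_divide_le_eq mult.commute)
  then have "1 \<le> ?P * (u + 1 / real n)" "?P * (u + 1 / real n) \<le> 2" by linarith+
  moreover have "u + 1 / real n > 0" using assms by (intro add_nonneg_pos) auto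
  ultimately show "1 / (u + 1 / real n) \<le> ?P" "?P \<le> 2 / (u + 1 / real n)"
    by (simp_all add: divide_le_eq le_divide_eq)
qed

section \<open>Passage from discrete measures to a positive functional\<close>

context interval_positive_functional
begin

definition node :: "nat \<Rightarrow> nat \<Rightarrow> real" where
  "node N k = c * (real k / real (Suc N))"

definition weight :: "nat \<Rightarrow> nat \<Rightarrow> real" where
  "weight N k = w (Suc N) k + 1 / (real (Suc N) * real (Suc (Suc N)))"

text \<open>The second summand makes all weights positive and has total mass \<open>1 / (N + 1)\<close>.\<close>

lemma sum_weight: "(\<Sum>k\<le>Suc N. weight N k) = L 1 + 1 / real (Suc N)"
proof -
  have "(\<Sum>k\<le>Suc N. 1 / (real (Suc N) * real (Suc (Suc N)))) = 1 / real (Suc N)"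
    by (simp add: divide_simps del: of_nat_Suc)
  then show ?thesis unfolding weight_def sum.distrib sum_w by simp
qed

lemma node_bounds: "k \<le> Suc N \<Longrightarrow> 0 \<le> node N k \<and> node N k \<le> c"
  using c_pos by (auto simp: node_def divide_simps)

lemma secular_weight: "secular (Suc N) (node N) (weight N)"
proof
  show "node N i < node N j" if "i < j" for i j
    using that c_pos by (simp add: node_def divide_strict_right_mono)
  show "weight N k > 0" for k
    unfolding weight_def by (intro add_nonneg_pos w_nonneg) simp
qed

lemma tendsto_weight: "(\<lambda>N. \<Sum>k\<le>Suc N. weight N k * poly p (node N k)) \<longlonglongrightarrow> L p"
proof -
  have "compact (poly p ` {0..c})" by (intro compact_continuous_image continuous_intros) auto
  then obtain B where B: "\<forall>t\<in>{0..c}. \<bar>poly p t\<bar> \<le> B"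
    by (auto dest!: compact_imp_bounded simp: bounded_iff)
  have "(\<lambda>N. \<Sum>k\<le>Suc N. 1 / (real (Suc N) * real (Suc (Suc N))) * poly p (node N k)) \<longlonglongrightarrow> 0"
  proof (rule Lim_null_comparison)
    show "(\<lambda>N. B * (1 / real (Suc N))) \<longlonglongrightarrow> 0"
      using tendsto_mult[OF tendsto_const lim_1_over_n[THEN LIMSEQ_Suc], of B] by simp
    show "\<forall>\<^sub>F N in sequentially. norm (\<Sum>k\<le>Suc N. 1 / (real (Suc N) * real (Suc (Suc N))) * poly p (node N k))
        \<le> B * (1 / real (Suc N))"
    proof (rule always_eventually, rule allI)
      fix N
      have "norm (\<Sum>k\<le>Suc N. 1 / (real (Suc N) * real (Suc (Suc N))) * poly p (node N k))
        \<le> (\<Sum>k\<le>Suc N. 1 / (real (Suc N) * real (Suc (Suc N))) * B)"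
      proof (rule sum_norm_le)
        fix k assume "k \<in> {..Suc N}"
        then have "\<bar>poly p (node N k)\<bar> \<le> B" using B node_bounds[of k N] by simp
        then show "norm (1 / (real (Suc N) * real (Suc (Suc N))) * poly p (node N k))
            \<le> 1 / (real (Suc N) * real (Suc (Suc N))) * B"
          unfolding real_norm_def abs_mult by (intro mult_mono) auto
      qed
      also have "\<dots> = B * (1 / real (Suc N))"
        by (simp add: divide_simps del: of_nat_Suc)
      finally show "norm (\<Sum>k\<le>Suc N. 1 / (real (Suc N) * real (Suc (Suc N))) * poly p (node N k)) \<le> B * (1 / real (Suc N))" .
    qed
  qed
  from tendsto_add[OF LIMSEQ_Suc[OF tendsto_L[of p]] this] show ?thesis
    unfolding weight_def node_def by (simp add: distrib_right sum.distrib)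
qed

definition moment_fps :: "real fps" where
  "moment_fps = Abs_fps (\<lambda>n. L ([:0, 1:] ^ n))"

text \<open>
  The hypothesis on \<open>T\<close> says that \<open>T\<close> is the generating function of the moments
  \<open>\<integral> \<xi> d(x\<^sup>n)\<close> belonging to the perturbation determinant \<open>1 + \<integral> d\<mu>(t) / (t - z)\<close>, where
  \<open>\<mu>\<close> is the measure represented by \<open>L\<close>.
\<close>

lemma spectral_shift_of_moments:
  fixes \<xi> :: "real \<Rightarrow> real" and T :: "real fps"
  assumes \<xi>: "integrable lborel \<xi>" "AE x in lborel. x \<notin> {-a..a} \<longrightarrow> \<xi> x = 0"
    and T: "T * (1 - fps_X * moment_fps) = fps_X * fps_deriv (fps_X * moment_fps)"
    and moments: "\<And>n. n \<ge> 1 \<Longrightarrow> fps_nth T n = (LINT x|lborel. \<xi> x * indicator {-a..a} x * (real n * x ^ (n - 1)))"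
  shows "AE x in lborel. 0 \<le> \<xi> x" "AE x in lborel. \<xi> x \<le> indicator {0..c + L 1 + 1} x"
    and "n \<ge> 1 \<Longrightarrow> c * (exp (LINT x|lborel. \<xi> x * (1 / (x + c / real n))) - 1) \<le> (\<Sum>j<n. L ([:1, -1 / c:] ^ j))"
    and "n \<ge> 1 \<Longrightarrow> (\<Sum>j<n. L ([:1, -1 / c:] ^ j)) \<le> 2 * c * (exp (LINT x|lborel. \<xi> x * (1 / (x + c / real n))) - 1)"
proof -
  \<comment> \<open>The largest node is \<open>c\<close> and the weights have total mass at most
    \<open>L 1 + 1\<close>, so \<open>[0, a']\<close> contains the zeros of all the discrete
    problems.\<close>
  define a' where "a' = c + L 1 + 1"
  define b where "b = max a a'"
  \<comment> \<open>A version of \<open>\<xi>\<close> that vanishes at every point outside the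
    interval, as the weak convergence lemma requires.\<close>
  define \<zeta> where "\<zeta> x = \<xi> x * indicator {-a..a} x" for x
  have L1: "L 1 \<ge> 0" using nonneg[of 0 0] by simp
  have a': "a' > 0" using c_pos L1 by (simp add: a'_def)
  have b: "a \<le> b" "a' \<le> b" "0 < b" using a' by (auto simp: b_def)
  have \<zeta>_int: "integrable lborel \<zeta>"
    unfolding \<zeta>_def using integrable_mult_indicator[OF _ \<xi>(1), of "{-a..a}"] by (simp add: mult.commute)
  have \<zeta>_zero: "\<zeta> x = 0" if "x \<notin> {-b..b}" for x
    using that b by (auto simp: \<zeta>_def indicator_def)
  have AE_eq: "AE x in lborel. \<xi> x = \<zeta> x"
    using \<xi>(2) by eventually_elim (auto simp: \<zeta>_def indicator_def)
  let ?S = "\<lambda>N. Abs_fps (\<lambda>n. \<Sum>k\<le>Suc N. weight N k * node N k ^ n)"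
  define shift_fun where "shift_fun N \<xi> \<longleftrightarrow> \<xi> \<in> borel_measurable borel \<and> (\<forall>x. 0 \<le> \<xi> x) \<and>
     (\<forall>x. \<xi> x \<le> indicator {0..a'} x) \<and>
     (Abs_fps (\<lambda>n. LINT x|lborel. \<xi> x * (real n * x ^ (n - 1))) * (1 - fps_X * ?S N) = fps_X * fps_deriv (fps_X * ?S N)) \<and>
     (\<forall>\<epsilon>>0. (LINT x|lborel. \<xi> x * (1 / (x + \<epsilon>))) = ln (1 + (\<Sum>k\<le>Suc N. weight N k / (node N k + \<epsilon>))))"
    for N and \<xi> :: "real \<Rightarrow> real"
  have "\<exists>\<xi>. shift_fun N \<xi>" for N
  proof -
    interpret secular "Suc N" "node N" "weight N" by (rule secular_weight)
    have "node N 0 \<ge> 0" by (simp add: node_def)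
    then obtain \<xi> where \<xi>: "\<xi> \<in> borel_measurable borel" "\<And>x. 0 \<le> \<xi> x"
      "\<And>x. \<xi> x \<le> indicator {0..node N (Suc N) + (\<Sum>k\<le>Suc N. weight N k)} x"
      "Abs_fps (\<lambda>n. LINT x|lborel. \<xi> x * (real n * x ^ (n - 1))) * (1 - fps_X * ?S N) = fps_X * fps_deriv (fps_X * ?S N)"
      "\<And>\<epsilon>. \<epsilon> > 0 \<Longrightarrow> (LINT x|lborel. \<xi> x * (1 / (x + \<epsilon>))) = ln (1 + (\<Sum>k\<le>Suc N. weight N k / (node N k + \<epsilon>)))"
      by (rule ex_spectral_shift) blast
    have "node N (Suc N) + (\<Sum>k\<le>Suc N. weight N k) \<le> a'"
      unfolding sum_weight a'_def by (simp add: node_def del: of_nat_Suc)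
    then have "indicat_real {0..node N (Suc N) + (\<Sum>k\<le>Suc N. weight N k)} x \<le> indicat_real {0..a'} x" for x
      by (auto simp: indicator_def simp del: sum.atMost_Suc)
    then have "\<xi> x \<le> indicator {0..a'} x" for x
      using \<xi>(3)[of x] order_trans by blast
    with \<xi> show ?thesis unfolding shift_fun_def by blast
  qed
  then obtain \<xi>s where "\<And>N. shift_fun N (\<xi>s N)" by metis
  then have \<xi>s: "\<And>N. \<xi>s N \<in> borel_measurable borel" "\<And>N x. 0 \<le> \<xi>s N x"
     "\<And>N x. \<xi>s N x \<le> indicator {0..a'} x"
     "\<And>N. Abs_fps (\<lambda>n. LINT x|lborel. \<xi>s N x * (real n * x ^ (n - 1))) * (1 - fps_X * ?S N) = fps_X * fps_deriv (fps_X * ?S N)"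
     "\<And>N \<epsilon>. \<epsilon> > 0 \<Longrightarrow> (LINT x|lborel. \<xi>s N x * (1 / (x + \<epsilon>))) = ln (1 + (\<Sum>k\<le>Suc N. weight N k / (node N k + \<epsilon>)))"
    unfolding shift_fun_def by blast+
  have ind_int: "integrable lborel (indicat_real {0..a'})"
    by (rule integrable_real_indicator) (use a' in auto)
  have \<xi>s_zero: "\<xi>s N x = 0" if "x \<notin> {-b..b}" for N x
    using \<xi>s(2)[of N x] \<xi>s(3)[of N x] that b by (auto simp: indicator_def split: if_splits)
  have \<xi>s_int: "integrable lborel (\<xi>s N)" for N
    by (rule Bochner_Integration.integrable_bound[OF ind_int]) (use \<xi>s(1,2,3) in \<open>auto simp: abs_of_nonneg\<close>)
  have \<xi>s_bound: "(LINT x|lborel. \<bar>\<xi>s N x\<bar>) \<le> a'" for N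
  proof -
    have "(LINT x|lborel. \<bar>\<xi>s N x\<bar>) \<le> (LINT x|lborel. indicat_real {0..a'} x)"
      by (rule integral_mono) (use \<xi>s_int \<xi>s(2,3) ind_int in \<open>auto simp: abs_of_nonneg\<close>)
    then show ?thesis using a' by simp
  qed
  have T_lim: "(\<lambda>N. LINT x|lborel. \<xi>s N x * (real n * x ^ (n - 1))) \<longlonglongrightarrow> fps_nth T n" for n
  proof -
    have "(\<lambda>N. fps_nth (Abs_fps (\<lambda>n. LINT x|lborel. \<xi>s N x * (real n * x ^ (n - 1)))) n) \<longlonglongrightarrow> fps_nth T n"
    proof (rule log_deriv_fps_tendsto[OF \<xi>s(4) T])
      show "(\<lambda>N. fps_nth (?S N) k) \<longlonglongrightarrow> fps_nth moment_fps k" for k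
        using tendsto_weight[of "[:0, 1:] ^ k"] by (simp add: moment_fps_def)
    qed
    then show ?thesis by simp
  qed
  have moments_lim: "(\<lambda>N. LINT x|lborel. \<xi>s N x * x ^ k) \<longlonglongrightarrow> (LINT x|lborel. \<zeta> x * x ^ k)" for k
  proof -
    have *: "(LINT x|lborel. h x * (real (Suc k) * x ^ (Suc k - 1))) = real (Suc k) * (LINT x|lborel. h x * x ^ k)" for h :: "real \<Rightarrow> real"
    proof -
      have "(LINT x|lborel. h x * (real (Suc k) * x ^ (Suc k - 1))) = (LINT x|lborel. real (Suc k) * (h x * x ^ k))"
        by (simp only: diff_Suc_1 mult.left_commute)
      then show ?thesis by (simp only: integral_mult_right_zero)
    qed
    have "(\<lambda>N. real (Suc k) * (LINT x|lborel. \<xi>s N x * x ^ k)) \<longlonglongrightarrow> real (Suc k) * (LINT x|lborel. \<zeta> x * x ^ k)"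
      using T_lim[of "Suc k"] moments[of "Suc k"] unfolding * \<zeta>_def[symmetric] by simp
    then show ?thesis
      using tendsto_mult[OF tendsto_const[of "inverse (real (Suc k))"], of _ "real (Suc k) * (LINT x|lborel. \<zeta> x * x ^ k)"]
      by (fastforce simp: mult.assoc[symmetric] simp del: of_nat_Suc)
  qed
  have weak: "(\<lambda>N. LINT x|lborel. \<xi>s N x * f x) \<longlonglongrightarrow> (LINT x|lborel. \<zeta> x * f x)" if "continuous_on UNIV f" for f
    by (rule moments_imp_weak_convergence[OF \<zeta>_int \<zeta>_zero \<xi>s_int \<xi>s_zero \<xi>s_bound moments_lim that])
  \<comment> \<open>Sign and upper bound hold for each discrete shift function; tested against
    nonnegative continuous functions they pass to the weak limit.\<close>
  have ge0: "AE x in lborel. 0 \<le> \<zeta> x"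
  proof (rule AE_nonneg_if_continuous_integral_nonneg[OF \<zeta>_int])
    fix f :: "real \<Rightarrow> real" assume f: "continuous_on UNIV f" "\<And>x. 0 \<le> f x"
    show "0 \<le> (LINT x|lborel. \<zeta> x * f x)"
      by (rule LIMSEQ_le_const[OF weak[OF f(1)]]) (use f \<xi>s(2) in auto)
  qed
  have le1: "AE x in lborel. 0 \<le> indicator {0..a'} x - \<zeta> x"
  proof (rule AE_nonneg_if_continuous_integral_nonneg)
    show "integrable lborel (\<lambda>x. indicator {0..a'} x - \<zeta> x)" using \<zeta>_int ind_int by auto
    fix f :: "real \<Rightarrow> real" assume f: "continuous_on UNIV f" "\<And>x. 0 \<le> f x"
    have i1: "integrable lborel (\<lambda>x. indicat_real {0..a'} x * f x)"
      using b by (intro continuous_times_vanishing_integrable[OF ind_int _ f(1), of b]) (auto simp: indicator_def)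
    have i2: "integrable lborel (\<lambda>x. \<zeta> x * f x)"
      by (rule continuous_times_vanishing_integrable[OF \<zeta>_int \<zeta>_zero f(1)])
    have "(LINT x|lborel. \<zeta> x * f x) \<le> (LINT x|lborel. indicat_real {0..a'} x * f x)"
    proof (rule LIMSEQ_le_const2[OF weak[OF f(1)]], intro exI allI impI)
      fix N :: nat
      show "(LINT x|lborel. \<xi>s N x * f x) \<le> (LINT x|lborel. indicat_real {0..a'} x * f x)"
        using i1 f \<xi>s(3) continuous_times_vanishing_integrable[OF \<xi>s_int \<xi>s_zero f(1)]
        by (intro integral_mono mult_right_mono) auto
    qed
    then show "0 \<le> (LINT x|lborel. (indicator {0..a'} x - \<zeta> x) * f x)"
      using i1 i2 by (simp add: left_diff_distrib)
  qed
  show "AE x in lborel. 0 \<le> \<xi> x" using ge0 AE_eq by eventually_elim simp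
  show "AE x in lborel. \<xi> x \<le> indicator {0..c + L 1 + 1} x"
    using le1 AE_eq unfolding a'_def by eventually_elim simp
  show "c * (exp (LINT x|lborel. \<xi> x * (1 / (x + c / real n))) - 1) \<le> (\<Sum>j<n. L ([:1, -1 / c:] ^ j))"
    and "(\<Sum>j<n. L ([:1, -1 / c:] ^ j)) \<le> 2 * c * (exp (LINT x|lborel. \<xi> x * (1 / (x + c / real n))) - 1)"
    if n: "n \<ge> 1"
  proof -
    \<comment> \<open>With \<open>u = t / c\<close> one has \<open>u + 1 / n = (t + e) / c\<close>,
      so this shift matches the geometric sums in \<open>1 - t / c\<close> with the resolvent at
      \<open>- e\<close>.\<close>
    define e where "e = c / real n"
    have e: "e > 0" using c_pos n by (simp add: e_def)
    define I where "I = (LINT x|lborel. \<xi> x * (1 / (x + e)))"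
    define q where "q = (\<Sum>j<n. [:1, -1 / c:] ^ j)"
    let ?f = "\<lambda>N. \<Sum>k\<le>Suc N. weight N k / (node N k + e)"
    have f_nonneg: "?f N \<ge> 0" for N
      using node_bounds[of _ N] e secular.m_pos[OF secular_weight[of N]]
      by (intro sum_nonneg divide_nonneg_nonneg) (auto intro: less_imp_le)
    \<comment> \<open>Replacing \<open>x\<close> by \<open>max x 0\<close> makes the kernel
      continuous on the whole line without changing it on \<open>[0, a']\<close>, where the shift
      functions live.\<close>
    have "continuous_on UNIV (\<lambda>x :: real. 1 / (max x 0 + e))"
      using e by (intro continuous_intros) (auto simp: max_def)
    note weak[OF this]
    moreover have "(LINT x|lborel. \<zeta> x * (1 / (max x 0 + e))) = I"
      unfolding I_def
    proof (rule integral_cong_AE)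
      show "AE x in lborel. \<zeta> x * (1 / (max x 0 + e)) = \<xi> x * (1 / (x + e))"
        using ge0 le1 AE_eq by eventually_elim (auto simp: indicator_def max_def split: if_splits)
    qed (use \<zeta>_int \<xi>(1) in measurable)
    moreover have "(LINT x|lborel. \<xi>s N x * (1 / (max x 0 + e))) = ln (1 + ?f N)" for N
    proof -
      have "\<xi>s N x * (1 / (max x 0 + e)) = \<xi>s N x * (1 / (x + e))" for x
        using \<xi>s(2,3)[of N x] by (auto simp: indicator_def max_def split: if_splits)
      then show ?thesis unfolding \<xi>s(5)[OF e, of N, symmetric] by (intro Bochner_Integration.integral_cong) simp_all
    qed
    ultimately have "(\<lambda>N. ln (1 + ?f N)) \<longlonglongrightarrow> I" by simp
    then have "(\<lambda>N. exp (ln (1 + ?f N)) - 1) \<longlonglongrightarrow> exp I - 1" by (intro tendsto_intros)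
    then have f_lim: "?f \<longlonglongrightarrow> exp I - 1" using f_nonneg by (simp add: add_pos_nonneg)
    have L_lim: "(\<lambda>N. \<Sum>k\<le>Suc N. weight N k * poly q (node N k)) \<longlonglongrightarrow> (\<Sum>j<n. L ([:1, -1 / c:] ^ j))"
      using tendsto_weight[of q] by (simp add: q_def L_sum)
    have bounds: "c * (weight N k / (node N k + e)) \<le> weight N k * poly q (node N k)"
        "weight N k * poly q (node N k) \<le> 2 * c * (weight N k / (node N k + e))" if "k \<le> Suc N" for N k
    proof -
      let ?u = "node N k / c"
      have u: "0 \<le> ?u" "?u \<le> 1" using node_bounds[OF that] c_pos by auto
      have "poly q (node N k) = (\<Sum>j<n. (1 - ?u) ^ j)"
        by (simp add: q_def poly_sum)
      moreover have "?u + 1 / real n = (node N k + e) / c" using c_pos by (simp add: e_def field_simps)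
      ultimately have 1: "c / (node N k + e) \<le> poly q (node N k)" "poly q (node N k) \<le> 2 * c / (node N k + e)"
        using geometric_sum_resolvent_bounds[OF u n] by simp_all
      have "weight N k \<ge> 0" using secular.m_pos[OF secular_weight[of N] that] by simp
      from mult_left_mono[OF 1(1) this] mult_left_mono[OF 1(2) this]
      show "c * (weight N k / (node N k + e)) \<le> weight N k * poly q (node N k)"
        "weight N k * poly q (node N k) \<le> 2 * c * (weight N k / (node N k + e))"
        by (simp_all add: mult_ac)
    qed
    have "c * (exp I - 1) \<le> (\<Sum>j<n. L ([:1, -1 / c:] ^ j))"
      by (rule LIMSEQ_le[OF tendsto_mult[OF tendsto_const f_lim] L_lim])
        (use bounds in \<open>auto simp: sum_distrib_left simp del: sum.atMost_Suc intro!: sum_mono\<close>)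
    then show "c * (exp (LINT x|lborel. \<xi> x * (1 / (x + c / real n))) - 1) \<le> (\<Sum>j<n. L ([:1, -1 / c:] ^ j))"
      by (simp add: I_def e_def)
    have "(\<Sum>j<n. L ([:1, -1 / c:] ^ j)) \<le> 2 * c * (exp I - 1)"
      by (rule LIMSEQ_le[OF L_lim tendsto_mult[OF tendsto_const f_lim]])
        (use bounds in \<open>auto simp: sum_distrib_left simp del: sum.atMost_Suc intro!: sum_mono\<close>)
    then show "(\<Sum>j<n. L ([:1, -1 / c:] ^ j)) \<le> 2 * c * (exp (LINT x|lborel. \<xi> x * (1 / (x + c / real n))) - 1)"
      by (simp add: I_def e_def)
  qed
qed

end

section \<open>Divergence of the integrals\<close>

lemma integral_inverse_shift:
  fixes e :: real
  assumes "e > 0"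
  shows "integrable lborel (\<lambda>x. indicator {0..1} x * (1 / (x + e)))"
    and "(LINT x|lborel. indicator {0..1} x * (1 / (x + e))) = ln (1 + e) - ln e"
proof -
  have D: "((\<lambda>x. ln (x + e)) has_real_derivative 1 / (x + e)) (at x)" if "0 \<le> x" "x \<le> 1" for x
    using assms that by (auto intro!: derivative_eq_intros)
  have C: "continuous_on {0..1} (\<lambda>x. 1 / (x + e))"
    using assms by (intro continuous_intros) auto
  show "integrable lborel (\<lambda>x. indicator {0..1} x * (1 / (x + e)))"
    and "(LINT x|lborel. indicator {0..1} x * (1 / (x + e))) = ln (1 + e) - ln e"
    using integral_lborel_indicator_Icc_FTC[OF zero_le_one D C] by simp_all
qed

lemma integrable_inverse_shift:
  fixes \<eta> :: "real \<Rightarrow> real"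
  assumes [measurable]: "\<eta> \<in> borel_measurable borel" and bounds: "AE x in lborel. x \<in> {0..1} \<longrightarrow> 0 \<le> \<eta> x \<and> \<eta> x \<le> 1"
    and e: "e > 0"
  shows "integrable lborel (\<lambda>x. indicator {0..1} x * (\<eta> x * (1 / (x + e))))"
proof (rule Bochner_Integration.integrable_bound[OF integral_inverse_shift(1)[OF e]])
  show "AE x in lborel. norm (indicator {0..1} x * (\<eta> x * (1 / (x + e)))) \<le> norm (indicator {0..1} x * (1 / (x + e)))"
    using bounds
  proof eventually_elim
    case (elim x)
    show ?case
    proof (cases "x \<in> {0..1}")
      case True
      then have "\<bar>\<eta> x\<bar> * \<bar>1 / (x + e)\<bar> \<le> 1 * \<bar>1 / (x + e)\<bar>"
        using elim by (intro mult_right_mono) auto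
      then show ?thesis using True unfolding real_norm_def abs_mult by simp
    qed simp
  qed
qed measurable

text \<open>One direction is domination: off the null set \<open>{0}\<close> the shifted integrand
  lies below \<open>\<eta> x / x\<close>. The other is Fatou's lemma along \<open>n\<close>.\<close>

lemma nn_integral_inverse_finite_iff:
  fixes \<eta> :: "real \<Rightarrow> real"
  assumes \<eta>[measurable]: "\<eta> \<in> borel_measurable borel" and bounds: "AE x in lborel. x \<in> {0..1} \<longrightarrow> 0 \<le> \<eta> x \<and> \<eta> x \<le> 1"
    and c: "c > 0"
  shows "(\<integral>\<^sup>+t\<in>{0..1}. ennreal (\<eta> t / t) \<partial>lborel) \<noteq> \<infinity> \<longleftrightarrow>
    (\<exists>K. \<forall>n\<ge>1. (LINT x|lborel. indicator {0..1} x * (\<eta> x * (1 / (x + c / real n)))) \<le> K)"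
proof -
  let ?f = "\<lambda>n x. indicator {0..1} x * (\<eta> x * (1 / (x + c / real n)))"
  have nonneg: "AE x in lborel. 0 \<le> ?f n x" for n
    using bounds by eventually_elim (use c in \<open>auto simp: indicator_def intro!: divide_nonneg_nonneg add_nonneg_nonneg\<close>)
  have int: "integrable lborel (?f n)" if "n \<ge> 1" for n
    using c that by (intro integrable_inverse_shift \<eta> bounds) simp
  have nn: "(\<integral>\<^sup>+x. ennreal (?f n x) \<partial>lborel) = ennreal (LINT x|lborel. ?f n x)" if "n \<ge> 1" for n
    by (rule nn_integral_eq_integral[OF int[OF that] nonneg])
  have pos: "AE x in lborel. x \<noteq> (0 :: real)" by (rule AE_lborel_singleton)
  show ?thesis
  proof
    assume fin: "(\<integral>\<^sup>+t\<in>{0..1}. ennreal (\<eta> t / t) \<partial>lborel) \<noteq> \<infinity>"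
    define J where "J = enn2real (\<integral>\<^sup>+t\<in>{0..1}. ennreal (\<eta> t / t) \<partial>lborel)"
    have J: "(\<integral>\<^sup>+t\<in>{0..1}. ennreal (\<eta> t / t) \<partial>lborel) = ennreal J" "J \<ge> 0"
      using fin by (simp_all add: J_def less_top)
    have "(LINT x|lborel. ?f n x) \<le> J" if n: "n \<ge> 1" for n
    proof -
      have "ennreal (LINT x|lborel. ?f n x) \<le> (\<integral>\<^sup>+t\<in>{0..1}. ennreal (\<eta> t / t) \<partial>lborel)"
        unfolding nn[OF n, symmetric]
      proof (rule nn_integral_mono_AE)
        show "AE x in lborel. ennreal (?f n x) \<le> ennreal (\<eta> x / x) * indicator {0..1} x"
          using pos bounds
        proof eventually_elim
          case (elim x)
          show ?case
          proof (cases "x \<in> {0..1}")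
            case True
            then have "\<eta> x / (x + c / real n) \<le> \<eta> x / x"
              using elim c n by (intro divide_left_mono mult_pos_pos add_pos_nonneg) auto
            then show ?thesis using True by (simp add: ennreal_leI)
          qed simp
        qed
      qed
      then show ?thesis unfolding J(1) using J(2) by (simp add: ennreal_le_iff)
    qed
    then show "\<exists>K. \<forall>n\<ge>1. (LINT x|lborel. ?f n x) \<le> K" by blast
  next
    assume "\<exists>K. \<forall>n\<ge>1. (LINT x|lborel. ?f n x) \<le> K"
    then obtain K where K: "\<And>n. n \<ge> 1 \<Longrightarrow> (LINT x|lborel. ?f n x) \<le> K" by blast
    have "(\<integral>\<^sup>+t\<in>{0..1}. ennreal (\<eta> t / t) \<partial>lborel) = (\<integral>\<^sup>+x. liminf (\<lambda>n. ennreal (?f (Suc n) x)) \<partial>lborel)"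
    proof (rule nn_integral_cong_AE)
      show "AE x in lborel. ennreal (\<eta> x / x) * indicator {0..1} x = liminf (\<lambda>n. ennreal (?f (Suc n) x))"
        using pos
      proof eventually_elim
        case (elim x)
        have "(\<lambda>n. c / real (Suc n)) \<longlonglongrightarrow> 0"
          using tendsto_mult[OF tendsto_const[of c] LIMSEQ_inverse_real_of_nat] by (simp add: divide_inverse)
        then have "(\<lambda>n. ?f (Suc n) x) \<longlonglongrightarrow> indicator {0..1} x * (\<eta> x * (1 / (x + 0)))"
          using elim by (intro tendsto_intros) auto
        then have "(\<lambda>n. ennreal (?f (Suc n) x)) \<longlonglongrightarrow> ennreal (indicator {0..1} x * (\<eta> x * (1 / (x + 0))))"
          by (rule tendsto_ennrealI)
        then have "liminf (\<lambda>n. ennreal (?f (Suc n) x)) = ennreal (indicator {0..1} x * (\<eta> x * (1 / (x + 0))))"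
          by (rule lim_imp_Liminf[rotated]) simp
        then show ?case by (simp add: indicator_def)
      qed
    qed
    also have "\<dots> \<le> liminf (\<lambda>n. \<integral>\<^sup>+x. ennreal (?f (Suc n) x) \<partial>lborel)"
      by (rule nn_integral_liminf) measurable
    also have "\<dots> \<le> ennreal K"
    proof (rule Liminf_le)
      show "\<forall>\<^sub>F n in sequentially. (\<integral>\<^sup>+x. ennreal (?f (Suc n) x) \<partial>lborel) \<le> ennreal K"
      proof (rule always_eventually, rule allI)
        fix n
        have "(\<integral>\<^sup>+x. ennreal (?f (Suc n) x) \<partial>lborel) = ennreal (LINT x|lborel. ?f (Suc n) x)"
          by (rule nn) simp
        also have "\<dots> \<le> ennreal K" by (rule ennreal_leI, rule K) simp
        finally show "(\<integral>\<^sup>+x. ennreal (?f (Suc n) x) \<partial>lborel) \<le> ennreal K" .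
      qed
    qed simp
    finally show "(\<integral>\<^sup>+t\<in>{0..1}. ennreal (\<eta> t / t) \<partial>lborel) \<noteq> \<infinity>"
      by (auto simp: top_unique)
  qed
qed

lemma divergence_criteria:
  fixes \<xi> :: "real \<Rightarrow> real" and d :: "nat \<Rightarrow> real"
  assumes \<xi>: "integrable lborel \<xi>" "AE x in lborel. 0 \<le> \<xi> x" "AE x in lborel. \<xi> x \<le> indicator {0..b} x"
    and c: "c > 0" and b: "b \<ge> 0"
    and lower: "\<And>n. n \<ge> 1 \<Longrightarrow> c * (exp (LINT x|lborel. \<xi> x * (1 / (x + c / real n))) - 1) \<le> (\<Sum>j<n. d j)"
    and upper: "\<And>n. n \<ge> 1 \<Longrightarrow> (\<Sum>j<n. d j) \<le> 2 * c * (exp (LINT x|lborel. \<xi> x * (1 / (x + c / real n))) - 1)"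
    and d: "\<And>j. d j \<ge> 0" "decseq d"
  shows "(\<exists>K. \<forall>n. (\<Sum>j<n. d j) \<le> K) \<longleftrightarrow> (\<integral>\<^sup>+t\<in>{0..1}. ennreal (\<xi> t / t) \<partial>lborel) \<noteq> \<infinity>"
    and "d \<longlonglongrightarrow> 0 \<longleftrightarrow> (\<integral>\<^sup>+t\<in>{0..1}. ennreal ((1 - \<xi> t) / t) \<partial>lborel) = \<infinity>"
proof -
  define I where "I n = (LINT x|lborel. \<xi> x * (1 / (x + c / real n)))" for n
  define P where "P n = (LINT x|lborel. indicator {0..1} x * (\<xi> x * (1 / (x + c / real n))))" for n
  define Q where "Q n = (LINT x|lborel. indicator {0..1} x * ((1 - \<xi> x) * (1 / (x + c / real n))))" for n
  have [measurable]: "\<xi> \<in> borel_measurable borel" using \<xi>(1) by auto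
  have bounds: "AE x in lborel. x \<in> {0..1} \<longrightarrow> 0 \<le> \<xi> x \<and> \<xi> x \<le> 1"
    using \<xi>(2,3)
  proof eventually_elim
    case (elim x)
    have "indicat_real {0..b} x \<le> 1" by (rule indicator_le_1)
    with elim have "\<xi> x \<le> 1" by linarith
    with elim(1) show ?case by simp
  qed
  have int_P: "integrable lborel (\<lambda>x. indicator {0..1} x * (\<xi> x * (1 / (x + c / real n))))" if "n \<ge> 1" for n
    by (rule integrable_inverse_shift[OF _ bounds]) (use c that in simp_all)
  \<comment> \<open>The integral of \<open>1 / (x + c / n)\<close> over \<open>[0, 1]\<close> is
    \<open>ln n\<close> up to a bounded term, and \<open>P n\<close> and \<open>Q n\<close> share
    this growth between them.\<close>
  have Q_eq: "Q n = ln (1 + c / real n) - ln (c / real n) - P n" if n: "n \<ge> 1" for n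
  proof -
    have e: "c / real n > 0" using c n by simp
    have "Q n = (LINT x|lborel. indicator {0..1} x * (1 / (x + c / real n)) - indicator {0..1} x * (\<xi> x * (1 / (x + c / real n))))"
      unfolding Q_def by (rule Bochner_Integration.integral_cong) (simp_all add: algebra_simps diff_divide_distrib)
    also have "\<dots> = (LINT x|lborel. indicator {0..1} x * (1 / (x + c / real n))) - P n"
      unfolding P_def by (rule Bochner_Integration.integral_diff[OF integral_inverse_shift(1)[OF e] int_P[OF n]])
    finally show ?thesis by (simp only: integral_inverse_shift(2)[OF e])
  qed
  \<comment> \<open>Outside \<open>[0, 1]\<close> only points of \<open>{0..b}\<close> above 1
    contribute, and there the kernel is at most 1.\<close>
  have PI: "P n \<le> I n" "I n \<le> P n + b" if n: "n \<ge> 1" for n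
  proof -
    let ?r = "\<lambda>x. indicator (- {0..1}) x * (\<xi> x * (1 / (x + c / real n)))"
    have r_bounds: "AE x in lborel. 0 \<le> ?r x \<and> ?r x \<le> indicator {0..b} x"
      using \<xi>(2,3)
    proof eventually_elim
      case (elim x)
      show ?case
      proof (cases "x \<in> {0..b} \<and> x > 1")
        case True
        have "x + c / real n \<ge> 1" using True c by (simp add: add_increasing2)
        then have "\<xi> x * (1 / (x + c / real n)) \<le> 1 * 1"
          using elim True by (intro mult_mono) auto
        moreover have "\<xi> x * (1 / (x + c / real n)) \<ge> 0" using elim True c by (intro mult_nonneg_nonneg) auto
        ultimately show ?thesis using True by auto
      next
        case False
        have r0: "?r x = 0"
        proof (cases "x \<in> {0..b}")
          case True
          then show ?thesis using False by simp
        next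
          case False
          then show ?thesis using elim by simp
        qed
        show ?thesis unfolding r0 by simp
      qed
    qed
    have ind: "integrable lborel (indicat_real {0..b})" by (rule integrable_real_indicator) (use b in auto)
    have int_r: "integrable lborel ?r"
    proof (rule Bochner_Integration.integrable_bound[OF ind])
      show "?r \<in> borel_measurable lborel" by measurable
      show "AE x in lborel. norm (?r x) \<le> norm (indicat_real {0..b} x)"
        using r_bounds by eventually_elim (simp only: real_norm_def abs_of_nonneg indicator_pos_le)
    qed
    have "I n = (LINT x|lborel. indicator {0..1} x * (\<xi> x * (1 / (x + c / real n))) + ?r x)"
      unfolding I_def by (rule Bochner_Integration.integral_cong) (auto simp: indicator_def)
    also have "\<dots> = P n + (LINT x|lborel. ?r x)"
      unfolding P_def by (rule Bochner_Integration.integral_add[OF int_P[OF n] int_r])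
    finally have "I n = P n + (LINT x|lborel. ?r x)" .
    moreover have "(LINT x|lborel. ?r x) \<ge> 0"
      by (rule integral_nonneg_AE) (rule eventually_mono[OF r_bounds], simp only:)
    moreover have "(LINT x|lborel. ?r x) \<le> (LINT x|lborel. indicat_real {0..b} x)"
      by (rule integral_mono_AE[OF int_r ind]) (rule eventually_mono[OF r_bounds], simp only:)
    ultimately show "P n \<le> I n" "I n \<le> P n + b" using b by auto
  qed
  have P_iff: "(\<integral>\<^sup>+t\<in>{0..1}. ennreal (\<xi> t / t) \<partial>lborel) \<noteq> \<infinity> \<longleftrightarrow> (\<exists>K. \<forall>n\<ge>1. P n \<le> K)"
    unfolding P_def by (rule nn_integral_inverse_finite_iff[OF _ bounds c]) measurable
  have Q_iff: "(\<integral>\<^sup>+t\<in>{0..1}. ennreal ((1 - \<xi> t) / t) \<partial>lborel) \<noteq> \<infinity> \<longleftrightarrow> (\<exists>K. \<forall>n\<ge>1. Q n \<le> K)"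
    unfolding Q_def by (rule nn_integral_inverse_finite_iff[OF _ _ c]) (use bounds in \<open>auto elim: eventually_mono\<close>)
  show "(\<exists>K. \<forall>n. (\<Sum>j<n. d j) \<le> K) \<longleftrightarrow> (\<integral>\<^sup>+t\<in>{0..1}. ennreal (\<xi> t / t) \<partial>lborel) \<noteq> \<infinity>"
    unfolding P_iff
  proof
    assume "\<exists>K. \<forall>n. (\<Sum>j<n. d j) \<le> K"
    then obtain K where K: "\<And>n. (\<Sum>j<n. d j) \<le> K" by blast
    have K0: "K \<ge> 0" using K[of 0] by simp
    have "P n \<le> ln (K / c + 1)" if n: "n \<ge> 1" for n
    proof -
      have "c * (exp (I n) - 1) \<le> K" using lower[OF n] K[of n] unfolding I_def by linarith
      then have "exp (I n) \<le> K / c + 1" using c by (simp add: field_simps)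
      then have "I n \<le> ln (K / c + 1)" using K0 c by (simp add: ln_ge_iff add_nonneg_pos)
      then show ?thesis using PI(1)[OF n] by simp
    qed
    then show "\<exists>K. \<forall>n\<ge>1. P n \<le> K" by blast
  next
    assume "\<exists>K. \<forall>n\<ge>1. P n \<le> K"
    then obtain K where K: "\<And>n. n \<ge> 1 \<Longrightarrow> P n \<le> K" by blast
    have "(\<Sum>j<n. d j) \<le> 2 * c * exp (K + b)" for n
    proof (cases "n \<ge> 1")
      case True
      have "(\<Sum>j<n. d j) \<le> 2 * c * (exp (I n) - 1)" using upper[OF True] by (simp add: I_def)
      also have "\<dots> \<le> 2 * c * exp (K + b)"
      proof (rule mult_left_mono)
        have "exp (I n) \<le> exp (K + b)" using PI(2)[OF True] K[OF True] by simp
        then show "exp (I n) - 1 \<le> exp (K + b)" by linarith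
      qed (use c in simp)
      finally show ?thesis .
    next
      case False
      then have "n = 0" by simp
      then show ?thesis using c by simp
    qed
    then show "\<exists>K. \<forall>n. (\<Sum>j<n. d j) \<le> K" by blast
  qed
  have "d \<longlonglongrightarrow> 0 \<longleftrightarrow> \<not> (\<exists>K. \<forall>n\<ge>1. Q n \<le> K)"
  proof
    assume lim: "d \<longlonglongrightarrow> 0"
    show "\<not> (\<exists>K. \<forall>n\<ge>1. Q n \<le> K)"
    proof
      assume "\<exists>K. \<forall>n\<ge>1. Q n \<le> K"
      then obtain K where K: "\<And>n. n \<ge> 1 \<Longrightarrow> Q n \<le> K" by blast
      \<comment> \<open>A bound \<open>K\<close> on \<open>Q\<close> forces
        \<open>exp (I n) \<ge> \<kappa> * n\<close>, hence partial sums of asymptotic slope at least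
        \<open>c * \<kappa>\<close>. If \<open>d\<close> tends to 0, they can eventually have no
        more than half that slope.\<close>
      define \<kappa> where "\<kappa> = exp (- ln c - K)"
      have \<kappa>: "c * \<kappa> / 2 > 0" using c by (simp add: \<kappa>_def)
      obtain j0 where j0: "\<And>j. j \<ge> j0 \<Longrightarrow> d j < c * \<kappa> / 2"
        using order_tendstoD(2)[OF lim \<kappa>] unfolding eventually_sequentially by blast
      have ge: "c * (\<kappa> * real n - 1) \<le> (\<Sum>j<n. d j)" if n: "n \<ge> 1" for n
      proof -
        have "ln (1 + c / real n) \<ge> 0" using c by (intro ln_ge_zero) simp
        moreover have "ln (c / real n) = ln c - ln (real n)" using c n by (simp add: ln_div)
        ultimately have "P n \<ge> ln (real n) + (- ln c - K)"
          using Q_eq[OF n] K[OF n] by linarith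
        then have "ln (real n) + (- ln c - K) \<le> I n" using PI(1)[OF n] by simp
        then have "exp (ln (real n) + (- ln c - K)) \<le> exp (I n)" by simp
        then have "real n * \<kappa> \<le> exp (I n)" using n by (simp add: exp_add \<kappa>_def del: exp_diff)
        then have "c * (\<kappa> * real n - 1) \<le> c * (exp (I n) - 1)" using c by (simp add: mult.commute)
        then show ?thesis using lower[OF n] unfolding I_def by linarith
      qed
      have le: "(\<Sum>j<n. d j) \<le> (\<Sum>j<j0. d j) + real n * (c * \<kappa> / 2)" for n
      proof -
        have "(\<Sum>j<n. d j) \<le> (\<Sum>j<n. (if j < j0 then d j else 0) + c * \<kappa> / 2)"
          using j0 \<kappa> by (intro sum_mono) (auto simp: not_less intro: less_imp_le)
        also have "\<dots> = (\<Sum>j\<in>{..<n} \<inter> {..<j0}. d j) + real n * (c * \<kappa> / 2)"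
          by (simp add: sum.distrib sum.inter_restrict lessThan_def)
        also have "(\<Sum>j\<in>{..<n} \<inter> {..<j0}. d j) \<le> (\<Sum>j<j0. d j)"
          using d(1) by (intro sum_mono2) auto
        finally show ?thesis by simp
      qed
      obtain n :: nat where n: "real n > ((\<Sum>j<j0. d j) + c) / (c * \<kappa> / 2)"
        using reals_Archimedean2 by blast
      then have "(\<Sum>j<j0. d j) + c < real n * (c * \<kappa> / 2)" using \<kappa> by (simp only: pos_divide_less_eq)
      moreover have "(\<Sum>j<j0. d j) + c > 0" using c d(1) by (intro add_nonneg_pos sum_nonneg) auto
      ultimately have "n \<ge> 1" using \<kappa> by (cases n) auto
      have "c * (\<kappa> * real n - 1) = 2 * (real n * (c * \<kappa> / 2)) - c" by (simp add: algebra_simps)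
      then show False
        using ge[OF \<open>n \<ge> 1\<close>] le[of n] \<open>(\<Sum>j<j0. d j) + c < real n * (c * \<kappa> / 2)\<close> by linarith
    qed
  next
    assume unbounded: "\<not> (\<exists>K. \<forall>n\<ge>1. Q n \<le> K)"
    obtain \<delta> where \<delta>: "d \<longlonglongrightarrow> \<delta>" "\<And>j. \<delta> \<le> d j"
      using decseq_convergent[OF d(2), of 0] d(1) by metis
    have "\<delta> \<ge> 0" using \<delta>(1) d(1) by (intro LIMSEQ_le_const) auto
    have "\<not> \<delta> > 0"
    proof
      assume pos: "\<delta> > 0"
      \<comment> \<open>A positive limit makes the partial sums grow linearly, so \<open>I n\<close>
        is at least \<open>ln n\<close> up to a constant, which leaves only a bounded remainder for
        \<open>Q n\<close>.\<close>
      have "Q n \<le> ln (1 + c) - ln c + b - ln (\<delta> / (2 * c))" if n: "n \<ge> 1" for n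
      proof -
        have "(\<Sum>j<n. \<delta>) \<le> (\<Sum>j<n. d j)" by (intro sum_mono \<delta>(2))
        also have "\<dots> \<le> 2 * c * (exp (I n) - 1)" using upper[OF n] by (simp add: I_def)
        also have "\<dots> \<le> 2 * c * exp (I n)" using c by simp
        finally have "real n * \<delta> \<le> 2 * c * exp (I n)" by simp
        then have "real n * (\<delta> / (2 * c)) \<le> exp (I n)" using c by (simp add: field_simps)
        then have "ln (real n * (\<delta> / (2 * c))) \<le> ln (exp (I n))"
          using n pos c by (subst ln_le_cancel_iff) auto
        then have "ln (real n * (\<delta> / (2 * c))) \<le> I n" by simp
        then have "ln (real n) + ln (\<delta> / (2 * c)) \<le> I n" using n pos c by (subst (asm) ln_mult_pos) auto
        moreover have "ln (1 + c / real n) \<le> ln (1 + c)"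
        proof -
          have "c / real n \<le> c / 1" using c n by (intro divide_left_mono) auto
          then show ?thesis using c n by (intro ln_mono) (auto intro: add_pos_nonneg)
        qed
        moreover have "ln (c / real n) = ln c - ln (real n)" using c n by (simp add: ln_div)
        ultimately show ?thesis using Q_eq[OF n] PI(2)[OF n] by linarith
      qed
      then show False using unbounded by blast
    qed
    then show "d \<longlonglongrightarrow> 0" using \<delta>(1) \<open>\<delta> \<ge> 0\<close> by (simp add: not_less)
  qed
  then show "d \<longlonglongrightarrow> 0 \<longleftrightarrow> (\<integral>\<^sup>+t\<in>{0..1}. ennreal ((1 - \<xi> t) / t) \<partial>lborel) = \<infinity>"
    using Q_iff by blast
qed

section \<open>Symmetric operators\<close>

definition poly_op :: "real poly \<Rightarrow> ('a \<Rightarrow> 'a) \<Rightarrow> 'a \<Rightarrow> 'a :: real_vector" where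
  "poly_op p T x = (\<Sum>i\<le>degree p. coeff p i *\<^sub>R (T ^^ i) x)"

lemma poly_op_altdef:
  assumes "degree p \<le> n"
  shows "poly_op p T x = (\<Sum>i\<le>n. coeff p i *\<^sub>R (T ^^ i) x)"
  unfolding poly_op_def using assms by (intro sum.mono_neutral_left) (auto simp: coeff_eq_0)

lemma poly_op_add: "poly_op (p + q) T x = poly_op p T x + poly_op q T x"
proof -
  let ?n = "max (degree p) (degree q)"
  have "degree (p + q) \<le> ?n" "degree p \<le> ?n" "degree q \<le> ?n"
    by (auto simp: degree_add_le)
  from this[THEN poly_op_altdef[of _ _ T x]] show ?thesis
    by (simp only: coeff_add scaleR_add_left sum.distrib)
qed

lemma poly_op_smult: "poly_op (smult a p) T x = a *\<^sub>R poly_op p T x"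
  using poly_op_altdef[of "smult a p" "degree p"] by (simp add: degree_smult_le poly_op_def scaleR_sum_right)

lemma poly_op_0 [simp]: "poly_op 0 T x = 0"
  by (simp add: poly_op_def)

lemma poly_op_1 [simp]: "poly_op 1 T x = x"
  by (simp add: poly_op_def)

lemma poly_op_pCons:
  assumes "linear T"
  shows "poly_op (pCons a p) T x = a *\<^sub>R x + T (poly_op p T x)"
proof -
  have "poly_op (pCons a p) T x = (\<Sum>i\<le>Suc (degree p). coeff (pCons a p) i *\<^sub>R (T ^^ i) x)"
    by (rule poly_op_altdef) (rule degree_pCons_le)
  also have "\<dots> = a *\<^sub>R x + (\<Sum>i\<le>degree p. coeff p i *\<^sub>R T ((T ^^ i) x))"
    by (subst sum.atMost_Suc_shift) simp
  also have "(\<Sum>i\<le>degree p. coeff p i *\<^sub>R T ((T ^^ i) x)) = T (poly_op p T x)"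
    using assms by (simp add: poly_op_def linear_sum linear_scale)
  finally show ?thesis .
qed

lemma poly_op_mult:
  assumes "linear T"
  shows "poly_op (p * q) T x = poly_op p T (poly_op q T x)"
  by (induction p)
    (auto simp: poly_op_pCons[OF assms] poly_op_add poly_op_smult mult_pCons_left)

lemma poly_op_swap:
  assumes "linear T"
  shows "poly_op p T (T x) = T (poly_op p T x)"
  by (induction p) (simp_all add: poly_op_pCons[OF assms] linear_add[OF assms] linear_scale[OF assms] linear_0[OF assms])

lemma poly_op_X_power:
  assumes "linear T"
  shows "poly_op ([:0, 1:] ^ n) T x = (T ^^ n) x"
  by (induction n) (auto simp: poly_op_mult[OF assms] poly_op_pCons[OF assms])

locale symmetric_operator =
  fixes G :: "'a \<Rightarrow> 'a :: {real_inner, banach}"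
  assumes bounded_linear: "bounded_linear G"
    and symmetric: "inner (G x) y = inner x (G y)"
begin

definition A :: "'a \<Rightarrow> 'a" where
  "A x = G (G x)"

lemma linear_G: "linear G"
  using bounded_linear by (rule bounded_linear.linear)

lemma bounded_linear_A: "bounded_linear A"
  unfolding A_def by (rule bounded_linear_compose[OF bounded_linear bounded_linear])

lemma linear_A: "linear A"
  using bounded_linear_A by (rule bounded_linear.linear)

lemma A_symmetric: "inner (A x) y = inner x (A y)"
  by (simp add: A_def symmetric)

lemma inner_A: "inner (A x) x = (norm (G x))\<^sup>2"
  by (simp add: A_def symmetric power2_norm_eq_inner)

lemma poly_op_symmetric: "inner (poly_op p A x) y = inner x (poly_op p A y)"
  by (induction p arbitrary: x y)
    (simp_all add: poly_op_pCons[OF linear_A] inner_add_left inner_add_right A_symmetric poly_op_swap[OF linear_A])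

lemma G_A: "G (A x) = A (G x)"
  by (simp add: A_def)

lemma G_poly_op: "G (poly_op p A x) = poly_op p A (G x)"
  by (induction p)
    (simp_all add: poly_op_pCons[OF linear_A] linear_add[OF linear_G] linear_scale[OF linear_G] linear_0[OF linear_G] G_A)

lemma poly_op_commute: "poly_op p A (poly_op q A x) = poly_op q A (poly_op p A x)"
  by (metis mult.commute poly_op_mult[OF linear_A])

text \<open>Halving both exponents writes the polynomial as \<open>q * r * q\<close> with
  \<open>r\<close> one of \<open>1\<close>, \<open>X\<close>, \<open>c - X\<close> and
  \<open>X (c - X)\<close>. By symmetry one \<open>q\<close> moves to the other side, leaving
  \<open>r\<close> at the vector \<open>y\<close>. In the last case a factor \<open>G\<close> moves
  across as well, which reduces it to \<open>c - X\<close> at \<open>G y\<close>.\<close>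

lemma inner_poly_op_bernstein_nonneg:
  assumes c: "\<And>x. (norm (G x))\<^sup>2 \<le> c * (norm x)\<^sup>2"
  shows "inner (poly_op ([:0, 1:] ^ k * [:c, -1:] ^ l) A v) v \<ge> 0"
proof -
  define q where "q = [:0, 1:] ^ (k div 2) * [:c, -1:] ^ (l div 2)"
  define r where "r = [:0, 1:] ^ (k mod 2) * [:c, -1:] ^ (l mod 2)"
  define y where "y = poly_op q A v"
  have "[:0, 1:] ^ k * [:c, -1:] ^ l = q * (r * q)"
  proof -
    have half: "z ^ n = z ^ (n div 2) * (z ^ (n mod 2) * z ^ (n div 2))" for z :: "real poly" and n
    proof -
      have "n div 2 + (n mod 2 + n div 2) = n" by presburger
      then show ?thesis by (simp only: power_add[symmetric])
    qed
    show ?thesis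
      unfolding q_def r_def
      by (subst half[of "[:0, 1:]" k], subst half[of "[:c, -1:]" l]) (simp only: mult_ac)
  qed
  then have eq: "inner (poly_op ([:0, 1:] ^ k * [:c, -1:] ^ l) A v) v = inner (poly_op r A y) y"
    by (simp add: y_def poly_op_mult[OF linear_A] poly_op_symmetric[of q])
  have X: "poly_op [:0, 1:] A z = A z" and Y: "poly_op [:c, -1:] A z = c *\<^sub>R z - A z" for z
    by (simp_all add: poly_op_pCons[OF linear_A] linear_0[OF linear_A] linear_neg[OF linear_A])
  have c': "inner (c *\<^sub>R z - A z) z \<ge> 0" for z
    using c[of z] by (simp add: inner_diff_left inner_A power2_norm_eq_inner)
  have "k mod 2 = 0 \<or> k mod 2 = 1" "l mod 2 = 0 \<or> l mod 2 = 1" by auto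
  then consider "r = 1" | "r = [:0, 1:]" | "r = [:c, -1:]" | "r = [:0, 1:] * [:c, -1:]"
    unfolding r_def by force
  then have "inner (poly_op r A y) y \<ge> 0"
  proof cases
    case 4
    have "inner (A (c *\<^sub>R y - A y)) y = inner (G (c *\<^sub>R y - A y)) (G y)"
      by (simp only: A_def[of "c *\<^sub>R y - A y"] symmetric)
    also have "G (c *\<^sub>R y - A y) = c *\<^sub>R G y - A (G y)"
      by (simp add: linear_diff[OF linear_G] linear_scale[OF linear_G] G_A)
    finally have "inner (A (c *\<^sub>R y - A y)) y = inner (c *\<^sub>R G y - A (G y)) (G y)" .
    then show ?thesis
      unfolding 4 poly_op_mult[OF linear_A] X Y using c'[of "G y"] by simp
  qed (use c' in \<open>simp_all add: X Y inner_A\<close>)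
  then show ?thesis by (simp add: eq)
qed

lemma interval_positive_functional:
  assumes "\<And>x. (norm (G x))\<^sup>2 \<le> c * (norm x)\<^sup>2" "c > 0"
  shows "interval_positive_functional (\<lambda>p. inner (poly_op p A v) v) c"
  by unfold_locales
    (use assms in \<open>auto simp: poly_op_add poly_op_smult inner_add_left inner_poly_op_bernstein_nonneg\<close>)

text \<open>The squared norm is the positive functional applied to \<open>p * p\<close>, so
  \<open>L_le\<close> turns a bound on \<open>[0, c]\<close> into an operator bound. The functional
  asks for \<open>c > 0\<close>; for \<open>c = 0\<close> the operator \<open>A\<close> vanishes and
  \<open>poly_op p A\<close> is multiplication by \<open>poly p 0\<close>.\<close>

lemma norm_poly_op_le:
  assumes c: "\<And>x. (norm (G x))\<^sup>2 \<le> c * (norm x)\<^sup>2" "c \<ge> 0"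
    and p: "\<And>t. 0 \<le> t \<Longrightarrow> t \<le> c \<Longrightarrow> \<bar>poly p t\<bar> \<le> d" and d: "d \<ge> 0"
  shows "norm (poly_op p A v) \<le> d * norm v"
proof (cases "c = 0")
  case True
  have "A x = 0" for x using c(1)[of x] c(1)[of "G x"] True by (simp add: A_def)
  then have "poly_op p A v = poly p 0 *\<^sub>R v"
    by (cases p) (simp add: poly_op_pCons[OF linear_A])
  then show ?thesis using p[of 0] c(2) by (simp add: mult_right_mono)
next
  case False
  then interpret interval_positive_functional "\<lambda>p. inner (poly_op p A v) v" c
    using c by (intro interval_positive_functional) auto
  have "(norm (poly_op p A v))\<^sup>2 = inner (poly_op (p * p) A v) v"
    by (simp add: poly_op_mult[OF linear_A] poly_op_symmetric power2_norm_eq_inner)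
  also have "\<dots> \<le> d\<^sup>2 * inner (poly_op 1 A v) v"
  proof (rule L_le)
    fix t assume "0 \<le> t" "t \<le> c"
    then have "\<bar>poly p t\<bar>\<^sup>2 \<le> d\<^sup>2" by (intro power_mono p) auto
    then show "poly (p * p) t \<le> d\<^sup>2" by (simp add: power2_eq_square abs_mult_self_eq)
  qed
  finally have "(norm (poly_op p A v))\<^sup>2 \<le> (d * norm v)\<^sup>2"
    by (simp add: power2_norm_eq_inner power_mult_distrib)
  then show ?thesis using d by (meson mult_nonneg_nonneg norm_ge_zero power2_le_imp_le)
qed

end

section \<open>Range and kernel through the iterates of \<open>I - A / c\<close>\<close>

locale bounded_symmetric_operator = symmetric_operator G
  for G :: "'a \<Rightarrow> 'a :: {real_inner, banach}" +
  fixes c :: real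
  assumes c_pos: "c > 0" and norm_G: "(norm (G x))\<^sup>2 \<le> c * (norm x)\<^sup>2"
begin

text \<open>\<open>(I - A / c)\<^sup>j v\<close>, whose scalar products with \<open>v\<close> decide whether \<open>v\<close> lies in the range of \<open>G\<close>
  and whether it is orthogonal to the kernel of \<open>G\<close>.\<close>

definition E :: "'a \<Rightarrow> nat \<Rightarrow> 'a" where
  "E v j = poly_op ([:1, - 1 / c:] ^ j) A v"

definition d :: "'a \<Rightarrow> nat \<Rightarrow> real" where
  "d v j = inner (E v j) v"

lemma E_0 [simp]: "E v 0 = v"
  by (simp add: E_def)

lemma A_E: "A (E v j) = c *\<^sub>R (E v j - E v (Suc j))"
proof -
  have "E v (Suc j) = poly_op [:1, - 1 / c:] A (E v j)"
    unfolding E_def power_Suc by (rule poly_op_mult[OF linear_A])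
  also have "\<dots> = E v j - (1 / c) *\<^sub>R A (E v j)"
    by (simp add: poly_op_pCons[OF linear_A] linear_scale[OF linear_A] linear_0[OF linear_A] linear_neg[OF linear_A])
  finally show ?thesis using c_pos by simp
qed

lemma inner_E: "inner (E v i) (E v j) = d v (i + j)"
  by (simp add: d_def E_def power_add poly_op_mult[OF linear_A] poly_op_symmetric[symmetric] poly_op_commute)

lemma norm_E: "(norm (E v j))\<^sup>2 = d v (2 * j)"
  by (simp add: power2_norm_eq_inner inner_E mult_2)

lemma inner_E_A: "inner (A (E v j)) v = c * (d v j - d v (Suc j))"
  by (simp add: A_E d_def inner_diff_left)

lemma d_nonneg: "d v j \<ge> 0"
proof -
  have "[:1, - 1 / c:] = smult (1 / c) [:c, -1:]" using c_pos by simp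
  then have "[:1, - 1 / c:] ^ j = smult ((1 / c) ^ j) ([:0, 1:] ^ 0 * [:c, -1:] ^ j)"
    by (simp only: smult_power power_0 mult_1)
  then have "d v j = (1 / c) ^ j * inner (poly_op ([:0, 1:] ^ 0 * [:c, -1:] ^ j) A v) v"
    unfolding d_def E_def by (simp only: poly_op_smult inner_scaleR_left)
  then show ?thesis
    using inner_poly_op_bernstein_nonneg[OF norm_G, of 0 j v] c_pos by simp
qed

text \<open>Differences of \<open>d v\<close> are again of the form \<open>d\<close>, at the vector
  \<open>G v\<close>. This yields monotonicity, and it makes the sums telescope for vectors in the
  range of \<open>G\<close>.\<close>

lemma d_G: "d (G v) j = c * (d v j - d v (Suc j))"
proof -
  have "d (G v) j = inner (G (E v j)) (G v)"
    by (simp only: d_def E_def G_poly_op)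
  also have "\<dots> = inner (A (E v j)) v" by (simp only: A_def symmetric)
  finally show ?thesis by (simp only: inner_E_A)
qed

lemma d_Suc_le: "d v (Suc j) \<le> d v j"
  using d_nonneg[of "G v" j] c_pos by (simp add: d_G zero_le_mult_iff)

lemma d_antimono: "i \<le> j \<Longrightarrow> d v j \<le> d v i"
  by (rule lift_Suc_antimono_le) (use d_Suc_le in auto)

lemma inner_kernel_E: "G x = 0 \<Longrightarrow> inner x (E v j) = inner x v"
proof (induction j)
  case (Suc j)
  have "c * (inner x (E v j) - inner x (E v (Suc j))) = inner x (A (E v j))"
    by (simp add: A_E inner_diff_right)
  also have "\<dots> = inner (G x) (G (E v j))" by (simp only: A_def symmetric)
  also have "\<dots> = 0" using Suc by simp
  finally show ?case using Suc c_pos by simp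
qed simp

text \<open>The vectors \<open>E v j\<close> approach the projection of \<open>v\<close> to the
  kernel of \<open>G\<close>. They have constant scalar product with each kernel vector, and their
  squared norms are \<open>d v (2 * j)\<close>. Conversely \<open>d v\<close> converges by
  monotonicity, \<open>inner_E\<close> makes \<open>E v\<close> a Cauchy sequence, and its limit is
  annihilated by \<open>A\<close>, hence by \<open>G\<close>.\<close>

lemma d_tendsto_0_iff: "d v \<longlonglongrightarrow> 0 \<longleftrightarrow> (\<forall>x. G x = 0 \<longrightarrow> inner x v = 0)"
proof
  assume lim: "d v \<longlonglongrightarrow> 0"
  show "\<forall>x. G x = 0 \<longrightarrow> inner x v = 0"
  proof (intro allI impI)
    fix x assume x: "G x = 0"
    have "(\<lambda>j. d v (2 * j)) \<longlonglongrightarrow> 0"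
      using LIMSEQ_subseq_LIMSEQ[OF lim, of "\<lambda>j. 2 * j"] by (simp add: strict_mono_def o_def)
    then have "(\<lambda>j. norm x * sqrt (d v (2 * j))) \<longlonglongrightarrow> norm x * sqrt 0" by (intro tendsto_intros)
    moreover have "\<bar>inner x v\<bar> \<le> norm x * sqrt (d v (2 * j))" for j
      using Cauchy_Schwarz_ineq2[of x "E v j"] inner_kernel_E[OF x, of v j] norm_E[of v j, symmetric] by simp
    ultimately have "\<bar>inner x v\<bar> \<le> norm x * sqrt 0"
      by (intro LIMSEQ_le_const) auto
    then show "inner x v = 0" by simp
  qed
next
  assume orth: "\<forall>x. G x = 0 \<longrightarrow> inner x v = 0"
  have "decseq (d v)" using d_antimono by (auto simp: decseq_def)
  then obtain \<delta> where lim: "d v \<longlonglongrightarrow> \<delta>"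
    by (rule decseq_convergent[where B = 0]) (use d_nonneg in auto)
  have "Cauchy (E v)"
  proof (rule CauchyI)
    fix e :: real assume e: "e > 0"
    obtain n0 where n0: "\<And>n. n \<ge> n0 \<Longrightarrow> \<bar>d v n - \<delta>\<bar> < e\<^sup>2 / 4"
      using LIMSEQ_D[OF lim, of "e\<^sup>2 / 4"] e by auto
    show "\<exists>M. \<forall>m\<ge>M. \<forall>n\<ge>M. norm (E v m - E v n) < e"
    proof (intro exI allI impI)
      fix m n assume "n0 \<le> m" "n0 \<le> n"
      have "(norm (E v m - E v n))\<^sup>2 = d v (2 * m) + d v (2 * n) - 2 * d v (m + n)"
        unfolding power2_norm_eq_inner mult_2
        by (simp add: inner_diff_left inner_diff_right inner_E add.commute[of n m])
      also have "\<dots> < e\<^sup>2"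
      proof -
        have "\<bar>d v (2 * m) - \<delta>\<bar> < e\<^sup>2 / 4" "\<bar>d v (2 * n) - \<delta>\<bar> < e\<^sup>2 / 4" "\<bar>d v (m + n) - \<delta>\<bar> < e\<^sup>2 / 4"
          using n0[of "2 * m"] n0[of "2 * n"] n0[of "m + n"] \<open>n0 \<le> m\<close> \<open>n0 \<le> n\<close> by simp_all
        then show ?thesis by linarith
      qed
      finally show "norm (E v m - E v n) < e" by (rule power_less_imp_less_base) (use e in simp)
    qed
  qed
  then obtain y where y: "E v \<longlonglongrightarrow> y"
    using Cauchy_convergent convergent_def by blast
  have "(\<lambda>j. A (E v j)) \<longlonglongrightarrow> A y"
    by (rule bounded_linear.tendsto[OF bounded_linear_A y])
  moreover have "(\<lambda>j. A (E v j)) \<longlonglongrightarrow> c *\<^sub>R (y - y)"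
    unfolding A_E by (intro tendsto_intros y LIMSEQ_Suc[OF y])
  ultimately have "A y = 0" using LIMSEQ_unique by fastforce
  then have "G y = 0" using inner_A[of y] by simp
  then have "inner y v = 0" using orth by blast
  moreover have "d v \<longlonglongrightarrow> inner y v" unfolding d_def by (intro tendsto_intros y)
  ultimately show "d v \<longlonglongrightarrow> 0" by simp
qed

text \<open>For \<open>v = G u\<close> the sum telescopes. Conversely, summability of
  \<open>d v\<close> makes approximate solutions of \<open>G u = v\<close> a Cauchy sequence, with
  errors \<open>E v n\<close> that tend to 0.\<close>

lemma bounded_sum_d_iff: "(\<exists>K. \<forall>n. (\<Sum>j<n. d v j) \<le> K) \<longleftrightarrow> v \<in> range G"
proof
  assume "v \<in> range G"
  then obtain u where u: "v = G u" by blast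
  have "(\<Sum>j<n. d v j) = c * (d u 0 - d u n)" for n
    unfolding u by (induction n) (auto simp: d_G algebra_simps)
  then have "(\<Sum>j<n. d v j) \<le> c * d u 0" for n
    using d_nonneg[of u n] c_pos by simp
  then show "\<exists>K. \<forall>n. (\<Sum>j<n. d v j) \<le> K" by blast
next
  assume "\<exists>K. \<forall>n. (\<Sum>j<n. d v j) \<le> K"
  then have summable: "summable (d v)"
    using d_nonneg by (metis summableI_nonneg_bounded)
  \<comment> \<open>Partial sums of the Neumann series of the inverse of \<open>A\<close>, with a
    factor \<open>G\<close> in front: formally \<open>G\<close> times the inverse of
    \<open>A\<close>, applied to \<open>v\<close>.\<close>
  define u where "u n = (1 / c) *\<^sub>R G (\<Sum>j<n. E v j)" for n
  have A_sum: "A (\<Sum>j\<in>{m..<n}. E v j) = c *\<^sub>R (E v m - E v n)" if "m \<le> n" for m n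
    using that
    by (induction n rule: dec_induct)
      (auto simp: linear_0[OF linear_A] linear_add[OF linear_A] A_E scaleR_diff_right)
  \<comment> \<open>On a block of the series \<open>A\<close> telescopes, so the quadratic form
    reduces to the terms \<open>d v (m + j) - d v (n + j)\<close>, each at most
    \<open>d v j\<close>.\<close>
  have diff: "(norm (u n - u m))\<^sup>2 \<le> (\<Sum>j\<in>{m..<n}. d v j) / c" if "m \<le> n" for m n
  proof -
    let ?S = "\<Sum>j\<in>{m..<n}. E v j"
    have "(\<Sum>j<n. E v j) - (\<Sum>j<m. E v j) = ?S"
      using sum_diff_nat_ivl[of 0 m n "E v"] that by (simp add: lessThan_atLeast0)
    then have "u n - u m = (1 / c) *\<^sub>R G ?S"
      unfolding u_def by (simp flip: scaleR_diff_right linear_diff[OF linear_G])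
    then have "(norm (u n - u m))\<^sup>2 = (1 / c)\<^sup>2 * inner (A ?S) ?S"
      by (simp add: inner_A power_mult_distrib power_divide)
    also have "\<dots> = (1 / c) * (\<Sum>j\<in>{m..<n}. d v (m + j) - d v (n + j))"
      using c_pos by (simp add: A_sum[OF that] inner_diff_left inner_sum_right inner_E power2_eq_square flip: sum_distrib_left)
    also have "\<dots> \<le> (1 / c) * (\<Sum>j\<in>{m..<n}. d v j)"
    proof (intro mult_left_mono sum_mono)
      fix j
      show "d v (m + j) - d v (n + j) \<le> d v j"
        using d_nonneg[of v "n + j"] d_antimono[of j "m + j" v] by simp
    qed (use c_pos in simp)
    finally show ?thesis by simp
  qed
  have "Cauchy u"
  proof (rule CauchyI')
    fix e :: real assume e: "e > 0"
    have "c * e\<^sup>2 > 0" using c_pos e by simp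
    then obtain M where M: "\<And>m n. m \<ge> M \<Longrightarrow> \<bar>\<Sum>j\<in>{m..<n}. d v j\<bar> < c * e\<^sup>2"
      using summable unfolding summable_Cauchy real_norm_def by blast
    show "\<exists>M. \<forall>m\<ge>M. \<forall>n>m. dist (u m) (u n) < e"
    proof (intro exI allI impI)
      fix m n assume mn: "M \<le> m" "m < n"
      have "(norm (u m - u n))\<^sup>2 \<le> (\<Sum>j\<in>{m..<n}. d v j) / c"
        using diff[of m n] mn by (simp add: norm_minus_commute)
      also have "\<dots> < e\<^sup>2" using M[of m n] mn c_pos by (simp add: divide_less_eq abs_less_iff mult.commute)
      finally show "dist (u m) (u n) < e"
        unfolding dist_norm by (rule power_less_imp_less_base) (use e in simp)
    qed
  qed
  then obtain y where y: "u \<longlonglongrightarrow> y"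
    using Cauchy_convergent convergent_def by blast
  have "(\<lambda>n. G (u n)) \<longlonglongrightarrow> G y"
    by (rule bounded_linear.tendsto[OF bounded_linear y])
  moreover have "G (u n) = v - E v n" for n
  proof -
    have "G (u n) = (1 / c) *\<^sub>R A (\<Sum>j\<in>{0..<n}. E v j)"
      by (simp add: u_def linear_scale[OF linear_G] A_def lessThan_atLeast0)
    then show ?thesis using A_sum[of 0 n] c_pos by simp
  qed
  moreover have "E v \<longlonglongrightarrow> 0"
  proof -
    have "(\<lambda>j. d v (2 * j)) \<longlonglongrightarrow> 0"
      using LIMSEQ_subseq_LIMSEQ[OF summable_LIMSEQ_zero[OF summable], of "\<lambda>j. 2 * j"]
      by (simp add: strict_mono_def o_def)
    then have "(\<lambda>j. sqrt (d v (2 * j))) \<longlonglongrightarrow> sqrt 0" by (intro tendsto_intros)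
    then have "(\<lambda>j. norm (E v j)) \<longlonglongrightarrow> 0" by (simp flip: norm_E)
    then show ?thesis by (rule tendsto_norm_zero_cancel)
  qed
  then have "(\<lambda>n. v - E v n) \<longlonglongrightarrow> v - 0" by (intro tendsto_intros)
  ultimately have "G y = v" using LIMSEQ_unique by fastforce
  then show "v \<in> range G" by blast
qed

end

section \<open>Traces of powers under a rank one perturbation\<close>

context symmetric_operator
begin

definition rank_one_perturbation :: "'a \<Rightarrow> 'a \<Rightarrow> 'a" where
  "rank_one_perturbation v x = A x + inner x v *\<^sub>R v"

lemma linear_rank_one_perturbation: "linear (rank_one_perturbation v)"
  by (rule linearI)
    (simp_all add: rank_one_perturbation_def linear_add[OF linear_A] linear_scale[OF linear_A]
      inner_add_left scaleR_add_left scaleR_add_right)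

lemma funpow_A_symmetric: "inner ((A ^^ n) x) y = inner x ((A ^^ n) y)"
  using poly_op_symmetric[of "[:0, 1:] ^ n"] by (simp add: poly_op_X_power[OF linear_A])

text \<open>The telescoping sum of \<open>B^j (B - A) A^(n - 1 - j)\<close>: since
  \<open>B - A\<close> has rank one, so has every term, and its trace can be read off as a scalar
  product.\<close>

lemma rank_one_power_diff:
  "(rank_one_perturbation v ^^ n) x - (A ^^ n) x
    = (\<Sum>j<n. inner x ((A ^^ (n - 1 - j)) v) *\<^sub>R (rank_one_perturbation v ^^ j) v)"
proof (induction n)
  case (Suc n)
  let ?B = "rank_one_perturbation v"
  have "(?B ^^ Suc n) x - (A ^^ Suc n) x = ?B ((?B ^^ n) x - (A ^^ n) x) + inner ((A ^^ n) x) v *\<^sub>R v"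
    by (simp add: linear_diff[OF linear_rank_one_perturbation]) (simp add: rank_one_perturbation_def)
  also have "?B ((?B ^^ n) x - (A ^^ n) x) = (\<Sum>j<n. inner x ((A ^^ (n - Suc j)) v) *\<^sub>R (?B ^^ Suc j) v)"
    by (simp add: Suc linear_sum[OF linear_rank_one_perturbation] linear_scale[OF linear_rank_one_perturbation])
  finally show ?case
    by (simp add: sum.lessThan_Suc_shift funpow_A_symmetric del: sum.lessThan_Suc)
qed simp

text \<open>With \<open>\<beta>\<^sub>n = (B\<^sup>n v, v)\<close> one has \<open>1 + X \<beta> = 1 / (1 - X s)\<close>, and the trace generating
  function is \<open>(1 + X \<beta>) X (X s)'\<close>.\<close>

lemma trace_moments_fps:
  fixes v :: 'a
  defines "B \<equiv> rank_one_perturbation v"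
  defines "S \<equiv> Abs_fps (\<lambda>n. inner ((A ^^ n) v) v)"
  defines "T \<equiv> Abs_fps (\<lambda>n. \<Sum>j<n. inner ((B ^^ j) v) ((A ^^ (n - 1 - j)) v))"
  shows "T * (1 - fps_X * S) = fps_X * fps_deriv (fps_X * S)"
proof -
  define s where "s n = inner ((A ^^ n) v) v" for n
  define \<beta> where "\<beta> n = inner ((B ^^ n) v) v" for n
  have S: "S = Abs_fps s" unfolding S_def s_def ..
  let ?\<beta> = "Abs_fps \<beta>"
  \<comment> \<open>Expanding the outermost \<open>B\<close> moves one factor \<open>A\<close> to
    the right argument and leaves a product of \<open>\<beta>\<close> and \<open>s\<close>;
    repeating this expresses the mixed moments by \<open>\<beta>\<close> and \<open>s\<close>
    alone.\<close>
  have h: "inner ((B ^^ j) v) ((A ^^ i) v) = s (i + j) + (\<Sum>l<j. \<beta> l * s (j - 1 - l + i))" for i j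
  proof (induction j arbitrary: i)
    case 0
    then show ?case by (simp add: s_def funpow_A_symmetric)
  next
    case (Suc j)
    have "inner ((B ^^ Suc j) v) ((A ^^ i) v) = inner ((B ^^ j) v) ((A ^^ Suc i) v) + \<beta> j * s i"
    proof -
      have "inner v ((A ^^ i) v) = s i" by (simp add: s_def inner_commute)
      then show ?thesis
        by (simp only: funpow.simps o_apply B_def rank_one_perturbation_def inner_add_left inner_scaleR_left
            A_symmetric \<beta>_def)
    qed
    also have "\<dots> = s (i + Suc j) + ((\<Sum>l<j. \<beta> l * s (j - 1 - l + Suc i)) + \<beta> j * s i)"
      unfolding Suc by simp
    also have "(\<Sum>l<j. \<beta> l * s (j - 1 - l + Suc i)) = (\<Sum>l<j. \<beta> l * s (Suc j - 1 - l + i))"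
      by (rule sum.cong) (auto simp: Suc_diff_Suc)
    finally show ?case by simp
  qed
  have \<beta>: "?\<beta> = S + fps_X * ?\<beta> * S"
  proof (rule fps_ext)
    fix n
    have "\<beta> n = s n + (\<Sum>l<n. \<beta> l * s (n - 1 - l))"
      using h[of n 0] by (simp add: \<beta>_def)
    then show "fps_nth ?\<beta> n = fps_nth (S + fps_X * ?\<beta> * S) n"
      by (cases n) (auto simp: S mult.assoc fps_mult_nth[of ?\<beta>] atLeast0AtMost lessThan_Suc_atMost)
  qed
  have T: "T = (1 + fps_X * ?\<beta>) * (fps_X * fps_deriv (fps_X * S))"
  proof (rule fps_ext)
    fix n
    let ?D = "fps_X * fps_deriv (fps_X * S)"
    have D: "fps_nth ?D m = real m * s (m - 1)" for m
      by (cases m) (simp_all add: S distrib_right add.commute)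
    have "fps_nth T n = (\<Sum>j<n. s (n - 1)) + (\<Sum>j<n. \<Sum>l<j. \<beta> l * s (n - 2 - l))"
    proof -
      have "inner ((B ^^ j) v) ((A ^^ (n - 1 - j)) v) = s (n - 1) + (\<Sum>l<j. \<beta> l * s (n - 2 - l))" if "j < n" for j
      proof -
        have "(\<Sum>l<j. \<beta> l * s (j - 1 - l + (n - 1 - j))) = (\<Sum>l<j. \<beta> l * s (n - 2 - l))"
          by (rule sum.cong) (use that in \<open>auto intro!: arg_cong[of _ _ s]\<close>)
        then show ?thesis using h[of j "n - 1 - j"] that by simp
      qed
      then show ?thesis by (simp add: T_def sum.distrib)
    qed
    also have "(\<Sum>j<n. \<Sum>l<j. \<beta> l * s (n - 2 - l)) = (\<Sum>l<n. \<Sum>j\<in>{l<..<n}. \<beta> l * s (n - 2 - l))"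
    proof -
      have "(\<Sum>j<n. \<Sum>l<j. \<beta> l * s (n - 2 - l)) = (\<Sum>(j, l)\<in>(SIGMA j:{..<n}. {..<j}). \<beta> l * s (n - 2 - l))"
        by (rule sum.Sigma) auto
      also have "\<dots> = (\<Sum>(l, j)\<in>(SIGMA l:{..<n}. {l<..<n}). \<beta> l * s (n - 2 - l))"
        by (rule sum.reindex_bij_witness[of _ "\<lambda>(l, j). (j, l)" "\<lambda>(j, l). (l, j)"]) auto
      also have "\<dots> = (\<Sum>l<n. \<Sum>j\<in>{l<..<n}. \<beta> l * s (n - 2 - l))"
        by (rule sum.Sigma[symmetric]) auto
      finally show ?thesis .
    qed
    \<comment> \<open>The summand is independent of \<open>j\<close>, so the inner sum only counts;
      the count \<open>n - 1 - l\<close> is the factor that differentiation produces. For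
      \<open>l = n - 1\<close> it is 0, so the truncated \<open>n - 2 - l\<close> does no
      harm.\<close>
    also have "(\<Sum>l<n. \<Sum>j\<in>{l<..<n}. \<beta> l * s (n - 2 - l)) = (\<Sum>l<n. \<beta> l * (real (n - 1 - l) * s (n - 2 - l)))"
      by (simp add: mult.left_commute)
    also have "\<dots> = fps_nth (fps_X * (?\<beta> * ?D)) n"
    proof (cases n)
      case (Suc k)
      have "fps_nth (?\<beta> * ?D) k = (\<Sum>l\<le>k. \<beta> l * (real (k - l) * s (k - l - 1)))"
        by (simp only: fps_mult_nth[of ?\<beta>] D fps_nth_Abs_fps atLeast0AtMost)
      then show ?thesis
        unfolding Suc fps_X_mult_nth
        by (simp del: fps_deriv_mult add: lessThan_Suc_atMost diff_diff_eq)
    qed simp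
    finally show "fps_nth T n = fps_nth ((1 + fps_X * ?\<beta>) * ?D) n"
      using D[of n] by (simp add: distrib_right mult.assoc)
  qed
  have "(1 + fps_X * ?\<beta>) * (1 - fps_X * S) = 1 + fps_X * (?\<beta> - (S + fps_X * ?\<beta> * S))"
    by (simp add: algebra_simps)
  also have "\<dots> = 1" using \<beta> by simp
  finally have inv: "(1 + fps_X * ?\<beta>) * (1 - fps_X * S) = 1" .
  have "T * (1 - fps_X * S) = ((1 + fps_X * ?\<beta>) * (1 - fps_X * S)) * (fps_X * fps_deriv (fps_X * S))"
    unfolding T by (simp only: mult_ac)
  then show ?thesis unfolding inv by simp
qed

end

section \<open>The real sequence space\<close>

text \<open>A real Hankel matrix acts separately on real and imaginary parts, so the analysis takes
  place on a real Hilbert space; a type makes the classes \<open>real_inner\<close> and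
  \<open>banach\<close> available.\<close>

typedef l2 = "{x :: nat \<Rightarrow> real. summable (\<lambda>n. (x n)\<^sup>2)}"
  morphisms coord l2_of_seq
  by (rule exI[of _ "\<lambda>_. 0"]) simp

setup_lifting type_definition_l2

lemma summable_coord_square: "summable (\<lambda>n. (coord x n)\<^sup>2)"
  using coord[of x] by simp

lemma summable_mult_square:
  fixes x y :: "nat \<Rightarrow> real"
  assumes "summable (\<lambda>n. (x n)\<^sup>2)" "summable (\<lambda>n. (y n)\<^sup>2)"
  shows "summable (\<lambda>n. \<bar>x n * y n\<bar>)"
proof (rule summable_comparison_test'[of "\<lambda>n. (x n)\<^sup>2 + (y n)\<^sup>2"])
  show "summable (\<lambda>n. (x n)\<^sup>2 + (y n)\<^sup>2)" using assms by (rule summable_add)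
  fix n
  have "2 * \<bar>x n * y n\<bar> \<le> (x n)\<^sup>2 + (y n)\<^sup>2"
    using sum_squares_bound[of "\<bar>x n\<bar>" "\<bar>y n\<bar>"] by (simp add: abs_mult)
  then show "norm \<bar>x n * y n\<bar> \<le> (x n)\<^sup>2 + (y n)\<^sup>2"
    using abs_ge_zero[of "x n * y n"] unfolding real_norm_def abs_idempotent by linarith
qed

lemma summable_square_add:
  fixes x y :: "nat \<Rightarrow> real"
  assumes "summable (\<lambda>n. (x n)\<^sup>2)" "summable (\<lambda>n. (y n)\<^sup>2)"
  shows "summable (\<lambda>n. (x n + y n)\<^sup>2)"
proof -
  have "summable (\<lambda>n. 2 * (x n * y n))"
    using summable_rabs_cancel[OF summable_mult_square[OF assms]] by (rule summable_mult)
  then have "summable (\<lambda>n. ((x n)\<^sup>2 + (y n)\<^sup>2) + 2 * (x n * y n))"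
    by (intro summable_add assms)
  then show ?thesis by (simp add: power2_sum mult.assoc)
qed

lemma summable_square_scale:
  fixes x :: "nat \<Rightarrow> real"
  assumes "summable (\<lambda>n. (x n)\<^sup>2)"
  shows "summable (\<lambda>n. (a * x n)\<^sup>2)"
  unfolding power_mult_distrib by (intro summable_mult assms)

instantiation l2 :: real_vector
begin
lift_definition zero_l2 :: l2 is "\<lambda>_. 0" by simp
lift_definition plus_l2 :: "l2 \<Rightarrow> l2 \<Rightarrow> l2" is "\<lambda>x y n. x n + y n"
  by (auto intro: summable_square_add)
lift_definition uminus_l2 :: "l2 \<Rightarrow> l2" is "\<lambda>x n. - x n" by simp
lift_definition minus_l2 :: "l2 \<Rightarrow> l2 \<Rightarrow> l2" is "\<lambda>x y n. x n - y n"
  using summable_square_add[of _ "\<lambda>n. - _ n"] by auto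
lift_definition scaleR_l2 :: "real \<Rightarrow> l2 \<Rightarrow> l2" is "\<lambda>a x n. a * x n"
  by (auto intro: summable_square_scale)
instance
  by standard (transfer; simp add: algebra_simps fun_eq_iff)+
end

lemma summable_coord_mult: "summable (\<lambda>n. coord x n * coord y n)"
  by (rule summable_rabs_cancel) (rule summable_mult_square[OF summable_coord_square summable_coord_square])

instantiation l2 :: real_inner
begin
definition inner_l2 :: "l2 \<Rightarrow> l2 \<Rightarrow> real" where
  "inner_l2 x y = (\<Sum>n. coord x n * coord y n)"
definition norm_l2 :: "l2 \<Rightarrow> real" where
  "norm_l2 x = sqrt (inner x x)"
definition sgn_l2 :: "l2 \<Rightarrow> l2" where
  "sgn_l2 x = x /\<^sub>R norm x"
definition dist_l2 :: "l2 \<Rightarrow> l2 \<Rightarrow> real" where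
  "dist_l2 x y = norm (x - y)"
definition uniformity_l2 :: "(l2 \<times> l2) filter" where
  "uniformity_l2 = (INF e\<in>{0 <..}. principal {(x, y). dist x y < e})"
definition open_l2 :: "l2 set \<Rightarrow> bool" where
  "open_l2 U = (\<forall>x\<in>U. eventually (\<lambda>(x', y). x' = x \<longrightarrow> y \<in> U) uniformity)"
instance
proof
  fix x y z :: l2 and r :: real
  show "inner x y = inner y x" by (simp add: inner_l2_def mult.commute)
  show "inner (x + y) z = inner x z + inner y z"
    unfolding inner_l2_def plus_l2.rep_eq
    by (simp add: distrib_right suminf_add summable_coord_mult)
  show "inner (r *\<^sub>R x) y = r * inner x y"
    unfolding inner_l2_def scaleR_l2.rep_eq
    by (simp add: mult.assoc suminf_mult summable_coord_mult)
  show "0 \<le> inner x x"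
    unfolding inner_l2_def by (intro suminf_nonneg summable_coord_mult) simp
  show "inner x x = 0 \<longleftrightarrow> x = 0"
  proof
    assume "inner x x = 0"
    then have "\<forall>n. coord x n * coord x n = 0"
      unfolding inner_l2_def using suminf_eq_zero_iff[OF summable_coord_mult[of x x]] by simp
    then show "x = 0" by (simp add: coord_inject[symmetric] zero_l2.rep_eq fun_eq_iff)
  qed (simp add: inner_l2_def zero_l2.rep_eq)
qed (simp_all add: norm_l2_def sgn_l2_def dist_l2_def uniformity_l2_def open_l2_def)
end

lemma norm_l2_square: "(norm x)\<^sup>2 = (\<Sum>n. (coord x n)\<^sup>2)" for x :: l2
  using power2_norm_eq_inner[of x] by (simp add: inner_l2_def power2_eq_square)

lemma abs_coord_le_norm: "\<bar>coord x n\<bar> \<le> norm x"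
proof -
  have "(\<Sum>k\<in>{n}. (coord x k)\<^sup>2) \<le> (\<Sum>k. (coord x k)\<^sup>2)"
    by (intro sum_le_suminf summable_coord_square) auto
  then have "\<bar>coord x n\<bar>\<^sup>2 \<le> (norm x)\<^sup>2" by (simp add: norm_l2_square)
  then show ?thesis by (rule power2_le_imp_le) simp
qed

text \<open>The limit is taken coordinatewise. Bounds on finite sections of \<open>X i - X j\<close>
  persist as \<open>j\<close> grows, which gives both square summability of the limit and
  convergence in norm.\<close>

instance l2 :: banach
proof
  fix X :: "nat \<Rightarrow> l2" assume X: "Cauchy X"
  have cauchy: "Cauchy (\<lambda>m. coord (X m) n)" for n
  proof (rule CauchyI)
    fix e :: real assume "e > 0"
    then obtain M where M: "\<And>i j. i \<ge> M \<Longrightarrow> j \<ge> M \<Longrightarrow> norm (X i - X j) < e"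
      using CauchyD[OF X] by blast
    have "\<bar>coord (X i) n - coord (X j) n\<bar> \<le> norm (X i - X j)" for i j
      using abs_coord_le_norm[of "X i - X j" n] by (simp add: minus_l2.rep_eq)
    then show "\<exists>M. \<forall>i\<ge>M. \<forall>j\<ge>M. norm (coord (X i) n - coord (X j) n) < e"
      using M unfolding real_norm_def by (meson le_less_trans)
  qed
  have "\<forall>n. \<exists>l. (\<lambda>m. coord (X m) n) \<longlonglongrightarrow> l"
    using Cauchy_convergent[OF cauchy] unfolding convergent_def by blast
  then obtain y where y: "\<And>n. (\<lambda>m. coord (X m) n) \<longlonglongrightarrow> y n"
    by metis
  have tail: "(\<Sum>n<k. (coord (X i) n - y n)\<^sup>2) \<le> e\<^sup>2"
    if "\<And>j. j \<ge> M \<Longrightarrow> norm (X i - X j) \<le> e" for M i k e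
  proof (rule LIMSEQ_le_const2)
    show "(\<lambda>j. \<Sum>n<k. (coord (X i) n - coord (X j) n)\<^sup>2) \<longlonglongrightarrow> (\<Sum>n<k. (coord (X i) n - y n)\<^sup>2)"
      by (intro tendsto_intros y)
    show "\<exists>N. \<forall>j\<ge>N. (\<Sum>n<k. (coord (X i) n - coord (X j) n)\<^sup>2) \<le> e\<^sup>2"
    proof (intro exI allI impI)
      fix j assume "M \<le> j"
      have "(\<Sum>n<k. (coord (X i) n - coord (X j) n)\<^sup>2) = (\<Sum>n<k. (coord (X i - X j) n)\<^sup>2)"
        by (simp add: minus_l2.rep_eq)
      also have "\<dots> \<le> (norm (X i - X j))\<^sup>2"
        unfolding norm_l2_square by (intro sum_le_suminf summable_coord_square) auto
      also have "\<dots> \<le> e\<^sup>2" using that[OF \<open>M \<le> j\<close>] by (intro power_mono) auto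
      finally show "(\<Sum>n<k. (coord (X i) n - coord (X j) n)\<^sup>2) \<le> e\<^sup>2" .
    qed
  qed
  have sum_diff: "summable (\<lambda>n. (coord (X i) n - y n)\<^sup>2)" if "\<And>j. j \<ge> M \<Longrightarrow> norm (X i - X j) \<le> e" for M i e
    by (rule summableI_nonneg_bounded[of _ "e\<^sup>2"]) (use tail[OF that] in auto)
  have "summable (\<lambda>n. (y n)\<^sup>2)"
  proof -
    obtain M where M: "\<And>i j. i \<ge> M \<Longrightarrow> j \<ge> M \<Longrightarrow> norm (X i - X j) < 1"
      using CauchyD[OF X, of 1] by auto
    have "summable (\<lambda>n. (coord (X M) n - y n)\<^sup>2)"
      by (rule sum_diff[of M M 1]) (use M in \<open>auto intro: less_imp_le\<close>)
    then have "summable (\<lambda>n. (-1 * (coord (X M) n - y n))\<^sup>2)" by (rule summable_square_scale)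
    from summable_square_add[OF summable_coord_square[of "X M"] this] show ?thesis by simp
  qed
  then have coord_y: "coord (l2_of_seq y) = y" by (simp add: l2_of_seq_inverse)
  have "X \<longlonglongrightarrow> l2_of_seq y"
  proof (rule LIMSEQ_I)
    fix e :: real assume e: "e > 0"
    then obtain M where M: "\<And>i j. i \<ge> M \<Longrightarrow> j \<ge> M \<Longrightarrow> norm (X i - X j) < e / 2"
      using CauchyD[OF X, of "e / 2"] by auto
    show "\<exists>M. \<forall>i\<ge>M. norm (X i - l2_of_seq y) < e"
    proof (intro exI allI impI)
      fix i assume i: "M \<le> i"
      have le: "norm (X i - X j) \<le> e / 2" if "j \<ge> M" for j using M[OF i that] by simp
      have "(norm (X i - l2_of_seq y))\<^sup>2 = (\<Sum>n. (coord (X i) n - y n)\<^sup>2)"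
        by (simp add: norm_l2_square minus_l2.rep_eq coord_y)
      also have "\<dots> \<le> (e / 2)\<^sup>2"
        by (rule suminf_le_const[OF sum_diff[OF le]]) (use tail[OF le] in auto)
      finally have "norm (X i - l2_of_seq y) \<le> e / 2" by (rule power2_le_imp_le) (use e in simp)
      then show "norm (X i - l2_of_seq y) < e" using e by simp
    qed
  qed
  then show "convergent X" by (auto simp: convergent_def)
qed

section \<open>Support of the spectral shift function\<close>

lemma smooth_continuous: "smooth f \<Longrightarrow> continuous_on UNIV f"
  by (meson DERIV_continuous_on smooth_derivE has_field_derivative_at_within)

lemma derivative_eq_0_if_locally_constant:
  fixes f :: "real \<Rightarrow> real"
  assumes "(f has_real_derivative D) (at t)" "open U" "t \<in> U" "\<And>s. s \<in> U \<Longrightarrow> f s = c"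
  shows "D = 0"
proof (rule DERIV_unique[OF assms(1)])
  have "((\<lambda>_. c) has_real_derivative 0) (at t)" by simp
  then show "(f has_real_derivative 0) (at t)"
    by (rule has_field_derivative_transform_within_open) (use assms in auto)
qed

text \<open>
  The derivatives of \<open>u smooth_step u\<close>, rescaled, approximate indicators of half lines, so
  smooth functions vanishing on \<open>(-\<infinity>, a]\<close> detect the values of \<open>\<xi>\<close> on \<open>(a, \<infinity>)\<close>.
\<close>

lemma AE_zero_right_of_support:
  fixes \<xi> :: "real \<Rightarrow> real"
  assumes \<xi>: "integrable lborel \<xi>"
    and test: "\<And>g g' R. smooth g \<Longrightarrow> (\<And>t. (g has_real_derivative g' t) (at t)) \<Longrightarrow>
      (\<And>t. \<bar>t\<bar> > R \<Longrightarrow> g t = 0) \<Longrightarrow> (\<And>t. t \<in> {-a..a} \<Longrightarrow> g t = 0) \<Longrightarrow> (LINT t|lborel. \<xi> t * g' t) = 0"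
  shows "AE t in lborel. t > a \<longrightarrow> \<xi> t = 0"
proof -
  let ?F = smooth_step
  obtain F' where F': "smooth F'" "\<And>t. (?F has_real_derivative F' t) (at t)"
    using smooth_derivE[OF smooth_smooth_step] by blast
  define k where "k u = u * ?F u" for u
  define k' where "k' u = ?F u + u * F' u" for u
  have k: "smooth k" unfolding k_def by (intro smooth_mult smooth_ident smooth_smooth_step)
  have k': "(k has_real_derivative k' u) (at u)" for u
    unfolding k_def k'_def by (auto intro!: derivative_eq_intros F'(2))
  have F'_0: "F' u = 0" if "u < 0" for u
    by (rule derivative_eq_0_if_locally_constant[OF F'(2), of "{..<0}" u 0]) (use that smooth_step_0 in auto)
  have F'_1: "F' u = 0" if "u > 1" for u
    by (rule derivative_eq_0_if_locally_constant[OF F'(2), of "{1<..}" u 1]) (use that smooth_step_1 in auto)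
  have k'_0: "k' u = 0" if "u < 0" for u using that F'_0 smooth_step_0 by (simp add: k'_def)
  have k'_1: "k' u = 1" if "u > 1" for u using that F'_1 smooth_step_1 by (simp add: k'_def)
  have cF': "continuous_on UNIV F'" by (rule smooth_continuous[OF F'(1)])
  have ck': "continuous_on UNIV k'"
    unfolding k'_def by (intro continuous_intros cF' smooth_continuous smooth_smooth_step)
  have bounded: "\<exists>M. \<forall>u. \<bar>f u\<bar> \<le> M"
    if "continuous_on UNIV f" "\<And>u. u < 0 \<Longrightarrow> \<bar>f u\<bar> \<le> 1" "\<And>u. u > 1 \<Longrightarrow> \<bar>f u\<bar> \<le> 1" for f :: "real \<Rightarrow> real"
  proof -
    have "compact (f ` {0..1})"
      by (intro compact_continuous_image continuous_on_subset[OF that(1)]) auto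
    then obtain M where "\<forall>u\<in>{0..1}. \<bar>f u\<bar> \<le> M"
      by (auto dest!: compact_imp_bounded simp: bounded_iff)
    then have "\<bar>f u\<bar> \<le> max M 1" for u
    proof -
      consider "u < 0" | "u > 1" | "u \<in> {0..1}" by fastforce
      then show ?thesis
      proof cases
        case 1
        then show ?thesis using that(2)[OF 1] by simp
      next
        case 2
        then show ?thesis using that(3)[OF 2] by simp
      next
        case 3
        then have "\<bar>f u\<bar> \<le> M" using \<open>\<forall>u\<in>{0..1}. \<bar>f u\<bar> \<le> M\<close> by blast
        then show ?thesis by simp
      qed
    qed
    then show ?thesis by blast
  qed
  obtain M1 where M1: "\<And>u. \<bar>F' u\<bar> \<le> M1" using bounded[OF cF'] F'_0 F'_1 by force
  obtain M2 where M2: "\<And>u. \<bar>k' u\<bar> \<le> M2" using bounded[OF ck'] k'_0 k'_1 by force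
  have meas: "(\<lambda>t. f (p * t + q)) \<in> borel_measurable lborel" if "continuous_on UNIV f" for f :: "real \<Rightarrow> real" and p q
  proof -
    have "continuous_on UNIV (\<lambda>t. f (p * t + q))"
      by (rule continuous_on_compose2[OF that]) (auto intro!: continuous_intros)
    then show ?thesis by (simp add: borel_measurable_continuous_onI)
  qed
  have int: "integrable lborel (\<lambda>t. \<xi> t * f (p * t + q))" if "continuous_on UNIV f" "\<And>u. \<bar>f u\<bar> \<le> M" for f :: "real \<Rightarrow> real" and p q M
  proof (rule Bochner_Integration.integrable_bound)
    show "integrable lborel (\<lambda>t. M * \<bar>\<xi> t\<bar>)" using \<xi> by auto
    show "(\<lambda>t. \<xi> t * f (p * t + q)) \<in> borel_measurable lborel"
      using \<xi> meas[OF that(1)] by auto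
    show "AE t in lborel. norm (\<xi> t * f (p * t + q)) \<le> norm (M * \<bar>\<xi> t\<bar>)"
    proof (rule AE_I2)
      fix t
      have "\<bar>f (p * t + q)\<bar> * \<bar>\<xi> t\<bar> \<le> M * \<bar>\<xi> t\<bar>" using that(2) by (rule mult_right_mono) simp
      then show "norm (\<xi> t * f (p * t + q)) \<le> norm (M * \<bar>\<xi> t\<bar>)"
        using mult_right_mono[OF abs_ge_self[of M], of "\<bar>\<xi> t\<bar>"] by (simp add: abs_mult mult.commute)
    qed
  qed
  have Ioc: "(LINT t|lborel. indicator {x<..y} t * \<xi> t) = 0" if xy: "a \<le> x" "x < y" for x y
  proof -
    let ?k = "\<lambda>n z t. k' (real (Suc n) * t + (- real (Suc n) * z))"
    have zero: "(LINT t|lborel. \<xi> t * (?k n x t - ?k n y t)) = 0" for n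
    proof -
      let ?N = "real (Suc n)"
      have eq: "(LINT t|lborel. \<xi> t * (?k n x t - ?k n y t)) = (y - x) * (LINT t|lborel. \<xi> t * F' (1 * t + (- L)))"
        if L: "L \<ge> y + 1" for L
      proof -
        \<comment> \<open>The difference of the rescaled ramps vanishes on the left but equals
          \<open>y - x\<close> far to the right. Subtracting a step at \<open>L\<close> restores
          compact support.\<close>
        define g where "g t = (1 / ?N) * (k (?N * t + (- ?N * x)) - k (?N * t + (- ?N * y))) - (y - x) * ?F (1 * t + (- L))" for t
        define g' where "g' t = (?k n x t - ?k n y t) - (y - x) * F' (1 * t + (- L))" for t
        have r: "p * t + (- p * z) = p * (t - z)" for p t z :: real by (simp add: right_diff_distrib)
        have "smooth g"
          unfolding g_def by (intro smooth_diff smooth_mult smooth_const smooth_affine k smooth_smooth_step)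
        moreover have "(g has_real_derivative g' t) (at t)" for t
          unfolding g_def g'_def
          by (rule derivative_eq_intros DERIV_chain2[OF k'] DERIV_chain2[OF F'(2)] refl)+ (simp add: field_simps)
        moreover have "g t = 0" if "t \<le> a" for t
        proof -
          have "?N * (t - x) \<le> 0" "?N * (t - y) \<le> 0" using that xy by (auto intro!: mult_nonneg_nonpos)
          then show ?thesis
            unfolding g_def r k_def using that xy L smooth_step_0[of "1 * t + (- L)"]
            by (simp only: smooth_step_0) simp
        qed
        moreover have "g t = 0" if "t \<ge> L + 1" for t
        proof -
          have "1 * 1 \<le> ?N * (t - x)" "1 * 1 \<le> ?N * (t - y)"
            using that xy L by (intro mult_mono; simp)+
          then have "g t = (1 / ?N) * (?N * (t - x) - ?N * (t - y)) - (y - x)"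
            unfolding g_def r k_def using that smooth_step_1[of "1 * t + (- L)"]
            by (simp only: smooth_step_1 mult_1) simp
          also have "\<dots> = 0" by (simp add: field_simps)
          finally show ?thesis .
        qed
        ultimately have "(LINT t|lborel. \<xi> t * g' t) = 0"
          by (intro test[of g g' "max \<bar>a\<bar> \<bar>L + 1\<bar>"]) (auto simp: abs_if split: if_splits)
        moreover have "(LINT t|lborel. \<xi> t * g' t)
          = (LINT t|lborel. \<xi> t * (?k n x t - ?k n y t)) - (LINT t|lborel. (y - x) * (\<xi> t * F' (1 * t + (- L))))"
        proof -
          have i1: "integrable lborel (\<lambda>t. \<xi> t * ?k n z t)" for z
            by (rule int[OF ck' M2])
          have i2: "integrable lborel (\<lambda>t. \<xi> t * F' (1 * t + (- L)))"
            by (rule int[OF cF' M1])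
          have "integrable lborel (\<lambda>t. \<xi> t * (?k n x t - ?k n y t))"
            unfolding right_diff_distrib[of "\<xi> _"] by (intro Bochner_Integration.integrable_diff i1)
          moreover have "integrable lborel (\<lambda>t. (y - x) * (\<xi> t * F' (1 * t + (- L))))"
            by (intro integrable_mult_right i2)
          ultimately show ?thesis
            unfolding g'_def by (subst Bochner_Integration.integral_diff[symmetric]) (auto simp: right_diff_distrib mult_ac)
        qed
        ultimately show ?thesis by simp
      qed
      \<comment> \<open>As \<open>L\<close> grows, the auxiliary step escapes to infinity and its
        contribution vanishes because \<open>\<xi>\<close> is integrable.\<close>
      have "(\<lambda>L. LINT t|lborel. \<xi> t * F' (1 * t + (- real L))) \<longlonglongrightarrow> (LINT (t :: real)|lborel. (0 :: real))"
      proof (rule integral_dominated_convergence[where w = "\<lambda>t. M1 * \<bar>\<xi> t\<bar>"])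
        show "AE t in lborel. (\<lambda>L. \<xi> t * F' (1 * t + (- real L))) \<longlonglongrightarrow> 0"
        proof (rule AE_I2)
          fix t :: real
          have "\<forall>\<^sub>F L in sequentially. \<xi> t * F' (1 * t + (- real L)) = 0"
            using eventually_gt_at_top[of "nat \<lceil>t\<rceil>"] 
          proof eventually_elim
            case (elim L)
            then have "t < real L" by linarith
            then show ?case by (simp add: F'_0)
          qed
          then show "(\<lambda>L. \<xi> t * F' (1 * t + (- real L))) \<longlonglongrightarrow> 0" by (rule tendsto_eventually)
        qed
        show "AE t in lborel. norm (\<xi> t * F' (1 * t + (- real L))) \<le> M1 * \<bar>\<xi> t\<bar>" for L
        proof (rule AE_I2)
          fix t
          show "norm (\<xi> t * F' (1 * t + (- real L))) \<le> M1 * \<bar>\<xi> t\<bar>"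
            using mult_right_mono[OF M1[of "1 * t + (- real L)"], of "\<bar>\<xi> t\<bar>"]
            unfolding real_norm_def abs_mult by (simp only: mult.commute abs_ge_zero)
        qed
        show "(\<lambda>t. \<xi> t * F' (1 * t + (- real L))) \<in> borel_measurable lborel" for L
          using int[OF cF' M1] by (rule borel_measurable_integrable)
      qed (use \<xi> in auto)
      then have lim: "(\<lambda>L. (y - x) * (LINT t|lborel. \<xi> t * F' (1 * t + (- real L)))) \<longlonglongrightarrow> (y - x) * (LINT (t :: real)|lborel. (0 :: real))"
        by (intro tendsto_intros)
      have "\<forall>\<^sub>F L in sequentially. (y - x) * (LINT t|lborel. \<xi> t * F' (1 * t + (- real L)))
          = (LINT t|lborel. \<xi> t * (?k n x t - ?k n y t))"
        using eventually_ge_at_top[of "nat \<lceil>y + 1\<rceil>"]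
      proof eventually_elim
        case (elim L)
        then have "y + 1 \<le> real L" by linarith
        from eq[OF this] show ?case by simp
      qed
      then have "(\<lambda>L. (y - x) * (LINT t|lborel. \<xi> t * F' (1 * t + (- real L))))
          \<longlonglongrightarrow> (LINT t|lborel. \<xi> t * (?k n x t - ?k n y t))"
        by (rule tendsto_eventually)
      from LIMSEQ_unique[OF this lim] show ?thesis by simp
    qed
    have k_lim: "(\<lambda>n. ?k n z t) \<longlonglongrightarrow> indicator {z<..} t" if "t \<noteq> z" for z t
    proof (cases "t < z")
      case True
      have "real (Suc n) * t + (- real (Suc n) * z) < 0" for n
        using True by (simp del: of_nat_Suc)
      then have "?k n z t = 0" for n by (rule k'_0)
      then show ?thesis using True by simp
    next
      case False
      then have t: "t > z" using that by simp
      have "\<forall>\<^sub>F n in sequentially. ?k n z t = 1"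
        using eventually_gt_at_top[of "nat \<lceil>1 / (t - z)\<rceil>"]
      proof eventually_elim
        case (elim n)
        then have "1 / (t - z) < real (Suc n)" by linarith
        then have "1 < real (Suc n) * (t - z)" using t by (simp add: divide_less_eq del: of_nat_Suc)
        then show ?case by (intro k'_1) (simp add: right_diff_distrib del: of_nat_Suc)
      qed
      then show ?thesis using t by (intro tendsto_eventually) simp
    qed
    have "(\<lambda>n. LINT t|lborel. \<xi> t * (?k n x t - ?k n y t)) \<longlonglongrightarrow> (LINT t|lborel. indicator {x<..y} t * \<xi> t)"
    proof (rule integral_dominated_convergence[where w = "\<lambda>t. 2 * M2 * \<bar>\<xi> t\<bar>"])
      show "AE t in lborel. (\<lambda>n. \<xi> t * (?k n x t - ?k n y t)) \<longlonglongrightarrow> indicator {x<..y} t * \<xi> t"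
        using AE_lborel_singleton[of x] AE_lborel_singleton[of y]
      proof eventually_elim
        case (elim t)
        have "(\<lambda>n. \<xi> t * (?k n x t - ?k n y t)) \<longlonglongrightarrow> \<xi> t * (indicator {x<..} t - indicator {y<..} t)"
          by (intro tendsto_intros k_lim elim)
        moreover have "\<xi> t * (indicator {x<..} t - indicator {y<..} t) = indicator {x<..y} t * \<xi> t"
          using xy by (auto simp: indicator_def)
        ultimately show ?case by simp
      qed
      show "AE t in lborel. norm (\<xi> t * (?k n x t - ?k n y t)) \<le> 2 * M2 * \<bar>\<xi> t\<bar>" for n
      proof (rule AE_I2)
        fix t
        have "\<bar>?k n x t - ?k n y t\<bar> \<le> 2 * M2"
          using M2[of "real (Suc n) * t + (- real (Suc n) * x)"] M2[of "real (Suc n) * t + (- real (Suc n) * y)"] by linarith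
        from mult_right_mono[OF this, of "\<bar>\<xi> t\<bar>"]
        show "norm (\<xi> t * (?k n x t - ?k n y t)) \<le> 2 * M2 * \<bar>\<xi> t\<bar>"
          unfolding real_norm_def abs_mult by (simp only: mult.commute abs_ge_zero)
      qed
      show "(\<lambda>t. \<xi> t * (?k n x t - ?k n y t)) \<in> borel_measurable lborel" for n
        using \<xi> meas[OF ck'] by auto
    qed (use \<xi> in auto)
    then show ?thesis unfolding zero by (simp add: LIMSEQ_const_iff)
  qed
  \<comment> \<open>The truncation has zero integral over every half-open interval, so the sign
    criterion applies to \<open>h\<close> and to \<open>- h\<close>.\<close>
  define h where "h t = indicator {a<..} t * \<xi> t" for t
  have h: "integrable lborel h"
    unfolding h_def using integrable_mult_indicator[OF _ \<xi>, of "{a<..}"] by simp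
  have h_Ioc: "(LINT t:{x<..y}|lborel. h t) = 0" for x y
  proof -
    have "(LINT t:{x<..y}|lborel. h t) = (LINT t|lborel. indicator {max x a<..y} t * \<xi> t)"
      unfolding set_lebesgue_integral_def h_def
      by (rule Bochner_Integration.integral_cong) (auto simp: indicator_def)
    also have "\<dots> = 0"
      using Ioc[of "max x a" y] by (cases "max x a < y") auto
    finally show ?thesis .
  qed
  have "AE t in lborel. 0 \<le> h t"
    by (rule AE_nonneg_if_set_integral_Ioc_nonneg[OF h]) (simp add: h_Ioc)
  moreover have "AE t in lborel. 0 \<le> - h t"
  proof (rule AE_nonneg_if_set_integral_Ioc_nonneg)
    show "integrable lborel (\<lambda>t. - h t)" using h by simp
    show "0 \<le> (LINT t:{x<..y}|lborel. - h t)" for x y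
      using h_Ioc[of x y] by (simp add: set_lebesgue_integral_def)
  qed
  ultimately show ?thesis
    by eventually_elim (auto simp: h_def)
qed

text \<open>The left half line follows from the right one by the reflection of \<open>t\<close> to
  \<open>- t\<close>, under which the class of test functions is stable.\<close>

lemma AE_zero_outside_support:
  fixes \<xi> :: "real \<Rightarrow> real"
  assumes \<xi>: "integrable lborel \<xi>"
    and test: "\<And>g g' R. smooth g \<Longrightarrow> (\<And>t. (g has_real_derivative g' t) (at t)) \<Longrightarrow>
      (\<And>t. \<bar>t\<bar> > R \<Longrightarrow> g t = 0) \<Longrightarrow> (\<And>t. t \<in> {-a..a} \<Longrightarrow> g t = 0) \<Longrightarrow> (LINT t|lborel. \<xi> t * g' t) = 0"
  shows "AE t in lborel. t \<notin> {-a..a} \<longrightarrow> \<xi> t = 0"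
proof -
  have right: "AE t in lborel. t > a \<longrightarrow> \<xi> t = 0"
    by (rule AE_zero_right_of_support[OF \<xi> test])
  have "AE t in lborel. t > a \<longrightarrow> \<xi> (- t) = 0"
  proof (rule AE_zero_right_of_support)
    show "integrable lborel (\<lambda>t. \<xi> (- t))"
      using lborel_integrable_real_affine[OF \<xi>, of "-1" 0] by simp
    fix g g' :: "real \<Rightarrow> real" and R
    assume g: "smooth g" "\<And>t. (g has_real_derivative g' t) (at t)" "\<And>t. \<bar>t\<bar> > R \<Longrightarrow> g t = 0"
      "\<And>t. t \<in> {-a..a} \<Longrightarrow> g t = 0"
    have "(LINT t|lborel. \<xi> t * (- g' (- t))) = 0"
    proof (rule test[of "\<lambda>t. g (- t)" _ R])
      show "smooth (\<lambda>t. g (- t))" using smooth_affine[OF g(1), of "-1" 0] by simp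
      show "((\<lambda>t. g (- t)) has_real_derivative - g' (- t)) (at t)" for t
      proof -
        have "((\<lambda>t. g (- t)) has_real_derivative g' (- t) * (- 1)) (at t)"
          by (rule DERIV_chain2[OF g(2)]) (auto intro!: derivative_eq_intros)
        then show ?thesis by simp
      qed
    qed (use g in auto)
    then show "(LINT t|lborel. \<xi> (- t) * g' t) = 0"
      using lborel_integral_real_affine[of "-1" "\<lambda>t. \<xi> t * g' (- t)" 0] by simp
  qed
  then have "AE t in distr lborel borel (\<lambda>t. - t). t < - a \<longrightarrow> \<xi> t = 0"
    using \<xi> by (subst AE_distr_iff) (auto elim: eventually_mono)
  then have "AE t in lborel. t < - a \<longrightarrow> \<xi> t = 0"
    unfolding lborel_distr_uminus .
  with right show ?thesis by eventually_elim auto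
qed

section \<open>Hankel operators\<close>

text \<open>Weighted Cauchy-Schwarz: \<open>k * \<bar>u\<bar>\<close> is split as
  \<open>sqrt (k * w) * sqrt (k * u^2 / w)\<close>. Row sums bound the first factor by a multiple of
  \<open>w n\<close>, which the column sums then absorb. Everything is done for finite sections
  before \<open>M\<close> tends to infinity.\<close>

lemma Schur_test:
  fixes k :: "nat \<Rightarrow> nat \<Rightarrow> real" and w u :: "nat \<Rightarrow> real"
  assumes k: "\<And>n m. k n m \<ge> 0" and w: "\<And>n. w n > 0" and C: "C \<ge> 0"
    and row: "\<And>n M. (\<Sum>m<M. k n m * w m) \<le> C * w n"
    and col: "\<And>m N. (\<Sum>n<N. k n m * w n) \<le> C * w m"
    and u: "summable (\<lambda>m. (u m)\<^sup>2)"
  shows "summable (\<lambda>m. k n m * \<bar>u m\<bar>)"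
    and "(\<Sum>n<N. (\<Sum>m. k n m * \<bar>u m\<bar>)\<^sup>2) \<le> C\<^sup>2 * (\<Sum>m. (u m)\<^sup>2)"
proof -
  define S where "S = (\<Sum>m. (u m)\<^sup>2)"
  have S: "S \<ge> 0" unfolding S_def by (rule suminf_nonneg[OF u]) simp
  have finite: "(\<Sum>n<N. (\<Sum>m<M. k n m * \<bar>u m\<bar>)\<^sup>2) \<le> C\<^sup>2 * S" for N M
  proof -
    have "(\<Sum>m<M. k n m * \<bar>u m\<bar>)\<^sup>2 \<le> C * w n * (\<Sum>m<M. k n m * ((u m)\<^sup>2 / w m))" for n
    proof -
      have "(\<Sum>m<M. k n m * \<bar>u m\<bar>) = (\<Sum>m<M. sqrt (k n m * w m) * sqrt (k n m * ((u m)\<^sup>2 / w m)))"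
      proof (rule sum.cong[OF refl])
        fix m
        have "(k n m * w m) * (k n m * ((u m)\<^sup>2 / w m)) = (k n m * \<bar>u m\<bar>)\<^sup>2"
          using w[of m] by (simp add: power_mult_distrib) (simp add: power2_eq_square)
        then have "sqrt (k n m * w m) * sqrt (k n m * ((u m)\<^sup>2 / w m)) = sqrt ((k n m * \<bar>u m\<bar>)\<^sup>2)"
          by (simp only: real_sqrt_mult[symmetric])
        then show "k n m * \<bar>u m\<bar> = sqrt (k n m * w m) * sqrt (k n m * ((u m)\<^sup>2 / w m))"
          using k[of n m] by (simp add: abs_mult)
      qed
      also have "(\<dots>)\<^sup>2 \<le> (\<Sum>m<M. (sqrt (k n m * w m))\<^sup>2) * (\<Sum>m<M. (sqrt (k n m * ((u m)\<^sup>2 / w m)))\<^sup>2)"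
        by (rule Cauchy_Schwarz_ineq_sum)
      also have "\<dots> = (\<Sum>m<M. k n m * w m) * (\<Sum>m<M. k n m * ((u m)\<^sup>2 / w m))"
        using k w by (simp add: less_imp_le)
      also have "\<dots> \<le> C * w n * (\<Sum>m<M. k n m * ((u m)\<^sup>2 / w m))"
        using k w by (intro mult_right_mono row sum_nonneg) (simp add: less_imp_le)
      finally show ?thesis .
    qed
    then have "(\<Sum>n<N. (\<Sum>m<M. k n m * \<bar>u m\<bar>)\<^sup>2) \<le> (\<Sum>n<N. C * w n * (\<Sum>m<M. k n m * ((u m)\<^sup>2 / w m)))"
      by (intro sum_mono)
    also have "\<dots> = C * (\<Sum>m<M. (u m)\<^sup>2 / w m * (\<Sum>n<N. k n m * w n))"
      by (simp add: sum_distrib_left sum.swap[of _ "{..<N}"] mult_ac)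
    also have "\<dots> \<le> C * (\<Sum>m<M. (u m)\<^sup>2 / w m * (C * w m))"
      using C w by (intro mult_left_mono sum_mono col) (auto simp: less_imp_le)
    also have "\<dots> = C\<^sup>2 * (\<Sum>m<M. (u m)\<^sup>2)"
      using w by (simp add: sum_distrib_left power2_eq_square less_imp_neq[symmetric] mult_ac)
    also have "\<dots> \<le> C\<^sup>2 * S"
      unfolding S_def by (intro mult_left_mono sum_le_suminf u) auto
    finally show ?thesis .
  qed
  show summable: "summable (\<lambda>m. k n m * \<bar>u m\<bar>)" for n
  proof (rule summableI_nonneg_bounded)
    fix M
    have "(\<Sum>m<M. k n m * \<bar>u m\<bar>)\<^sup>2 \<le> (\<Sum>i<Suc n. (\<Sum>m<M. k i m * \<bar>u m\<bar>)\<^sup>2)"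
      by (rule member_le_sum) auto
    also have "\<dots> \<le> C\<^sup>2 * S" by (rule finite)
    finally show "(\<Sum>m<M. k n m * \<bar>u m\<bar>) \<le> sqrt (C\<^sup>2 * S)"
      by (rule real_le_rsqrt)
  qed (use k in simp)
  show "(\<Sum>n<N. (\<Sum>m. k n m * \<bar>u m\<bar>)\<^sup>2) \<le> C\<^sup>2 * (\<Sum>m. (u m)\<^sup>2)"
    unfolding S_def[symmetric]
  proof (rule LIMSEQ_le_const2)
    show "(\<lambda>M. \<Sum>n<N. (\<Sum>m<M. k n m * \<bar>u m\<bar>)\<^sup>2) \<longlonglongrightarrow> (\<Sum>n<N. (\<Sum>m. k n m * \<bar>u m\<bar>)\<^sup>2)"
      by (intro tendsto_intros summable_LIMSEQ summable)
  qed (use finite in blast)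
qed

text \<open>For \<open>a = sqrt n\<close> and \<open>b = sqrt (n + 1)\<close> these are the integral
  comparisons for the powers -1/2 and -3/2, obtained from the conjugate identity.\<close>

lemma inverse_le_diff_if_squares_differ_by_1:
  fixes a b :: real
  assumes "0 \<le> a" "a \<le> b" "0 < b" "(b - a) * (b + a) = 1"
  shows "1 / b \<le> 2 * b - 2 * a" and "a > 0 \<Longrightarrow> 1 / (b * b * b) \<le> 2 / a - 2 / b"
proof -
  have "(b - a) * (b + a) \<le> (b - a) * (2 * b)"
    using assms by (intro mult_left_mono) auto
  then have "1 \<le> (2 * b - 2 * a) * b"
    using assms by (simp add: algebra_simps)
  then show "1 / b \<le> 2 * b - 2 * a"
    using assms(3) by (simp only: pos_divide_le_eq)
  assume a: "a > 0"
  have "b - a = 1 / (b + a)" using assms by (simp add: eq_divide_eq)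
  moreover have "2 / a - 2 / b = 2 * (b - a) / (a * b)" using a assms by (simp add: field_simps)
  ultimately have "2 / a - 2 / b = 2 / ((b + a) * (a * b))" by simp
  moreover have "(b + a) * (a * b) \<le> (2 * b) * (b * b)"
    using a assms by (intro mult_mono) auto
  then have "2 / ((2 * b) * (b * b)) \<le> 2 / ((b + a) * (a * b))"
    using a assms by (intro divide_left_mono) auto
  ultimately show "1 / (b * b * b) \<le> 2 / a - 2 / b" by simp
qed

lemma sqrt_Suc_conjugate: "(sqrt (real (Suc n)) - sqrt (real n)) * (sqrt (real (Suc n)) + sqrt (real n)) = 1"
  by (simp add: algebra_simps flip: power2_eq_square)

lemma sum_inverse_sqrt_le: "(\<Sum>m<M. 1 / sqrt (real (m + 1))) \<le> 2 * sqrt (real M)"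
proof (induction M)
  case (Suc M)
  have "1 / sqrt (real (Suc M)) \<le> 2 * sqrt (real (Suc M)) - 2 * sqrt (real M)"
    by (rule inverse_le_diff_if_squares_differ_by_1(1)[OF _ _ _ sqrt_Suc_conjugate]) auto
  then show ?case using Suc by simp
qed simp

lemma sum_inverse_power_3_2_le:
  "(\<Sum>m=n+1..<n+1+M. 1 / (real (m + 1) * sqrt (real (m + 1)))) \<le> 2 / sqrt (real (n + 1)) - 2 / sqrt (real (n + 1 + M))"
proof (induction M)
  case (Suc M)
  let ?k = "n + 1 + M"
  let ?b = "sqrt (real (Suc ?k))"
  have "1 / (?b * ?b * ?b) \<le> 2 / sqrt (real ?k) - 2 / ?b"
    by (rule inverse_le_diff_if_squares_differ_by_1(2)[OF _ _ _ sqrt_Suc_conjugate]) auto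
  moreover have "?b * ?b = real (Suc ?k)" by simp
  ultimately have "1 / (real (?k + 1) * sqrt (real (?k + 1))) \<le> 2 / sqrt (real ?k) - 2 / ?b"
    by (simp only: Suc_eq_plus1)
  then show ?case using Suc by (simp add: add.assoc)
qed simp

text \<open>The sum is split after \<open>m = n\<close>: up to there \<open>n + m + 1\<close> is
  replaced by \<open>n + 1\<close>, beyond by \<open>m + 1\<close>. Each half contributes
  \<open>2 / sqrt (n + 1)\<close>.\<close>

lemma Hilbert_matrix_row_sum:
  "(\<Sum>m<M. 1 / real (n + m + 1) * (1 / sqrt (real (m + 1)))) \<le> 4 * (1 / sqrt (real (n + 1)))"
proof -
  let ?f = "\<lambda>m. 1 / real (n + m + 1) * (1 / sqrt (real (m + 1)))"
  have "(\<Sum>m<M. ?f m) \<le> (\<Sum>m<n + 1 + M. ?f m)" by (intro sum_mono2) auto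
  also have "\<dots> = (\<Sum>m<n+1. ?f m) + (\<Sum>m=n+1..<n+1+M. ?f m)"
    by (simp only: lessThan_atLeast0 sum.atLeastLessThan_concat[of 0 "n + 1" "n + 1 + M"])
  also have "(\<Sum>m<n+1. ?f m) \<le> (\<Sum>m<n+1. 1 / real (n + 1) * (1 / sqrt (real (m + 1))))"
    by (intro sum_mono mult_right_mono divide_left_mono) auto
  also have "\<dots> = 1 / real (n + 1) * (\<Sum>m<n+1. 1 / sqrt (real (m + 1)))" by (simp only: sum_distrib_left)
  also have "\<dots> \<le> 1 / real (n + 1) * (2 * sqrt (real (n + 1)))"
    by (intro mult_left_mono sum_inverse_sqrt_le) auto
  also have "\<dots> = 2 * (sqrt (real (n + 1)) / real (n + 1))" by simp
  also have "\<dots> = 2 / sqrt (real (n + 1))"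
    by (simp only: sqrt_divide_self_eq[OF of_nat_0_le_iff]) (simp only: divide_inverse)
  also have "(\<Sum>m=n+1..<n+1+M. ?f m) \<le> (\<Sum>m=n+1..<n+1+M. 1 / (real (m + 1) * sqrt (real (m + 1))))"
    by (intro sum_mono) (auto intro!: divide_left_mono mult_right_mono)
  also have "\<dots> \<le> 2 / sqrt (real (n + 1)) - 2 / sqrt (real (n + 1 + M))"
    by (rule sum_inverse_power_3_2_le)
  also have "\<dots> \<le> 2 / sqrt (real (n + 1))" by simp
  finally show ?thesis by simp
qed

definition hankel_op :: "(nat \<Rightarrow> real) \<Rightarrow> l2 \<Rightarrow> l2" where
  "hankel_op a x = l2_of_seq (\<lambda>n. \<Sum>m. a (n + m) * coord x m)"

locale weak_l1_seq =
  fixes a :: "nat \<Rightarrow> real" and C :: real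
  assumes decay: "real (n + 1) * \<bar>a n\<bar> \<le> C"
begin

lemma C_nonneg: "C \<ge> 0"
  using decay[of 0] by simp

lemma abs_le: "\<bar>a (n + m)\<bar> \<le> C * (1 / real (n + m + 1))"
  using decay[of "n + m"] by (simp add: field_simps)

text \<open>The entries are dominated by \<open>C\<close> times the Hilbert matrix, with the weight
  \<open>1 / sqrt (n + 1)\<close>; columns equal rows by symmetry of the matrix.\<close>

lemma Schur_assms:
  defines "k \<equiv> \<lambda>n m. \<bar>a (n + m)\<bar>" and "w \<equiv> \<lambda>n. 1 / sqrt (real (n + 1))"
  shows "(\<Sum>m<M. k n m * w m) \<le> 4 * C * w n" "(\<Sum>m<M. k m n * w m) \<le> 4 * C * w n"
proof -
  have "(\<Sum>m<M. k n m * w m) \<le> (\<Sum>m<M. C * (1 / real (n + m + 1) * w m))"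
    unfolding k_def w_def mult.assoc[symmetric] by (intro sum_mono mult_right_mono abs_le) auto
  also have "\<dots> = C * (\<Sum>m<M. 1 / real (n + m + 1) * w m)" by (rule sum_distrib_left[symmetric])
  also have "\<dots> \<le> C * (4 * w n)"
    unfolding w_def by (intro mult_left_mono Hilbert_matrix_row_sum C_nonneg)
  finally show "(\<Sum>m<M. k n m * w m) \<le> 4 * C * w n" by simp
  then show "(\<Sum>m<M. k m n * w m) \<le> 4 * C * w n" by (simp add: k_def add.commute)
qed

lemma summable_row_abs: "summable (\<lambda>m. \<bar>a (n + m)\<bar> * \<bar>coord x m\<bar>)"
  and sum_rows_le: "(\<Sum>n<N. (\<Sum>m. \<bar>a (n + m)\<bar> * \<bar>coord x m\<bar>)\<^sup>2) \<le> (4 * C)\<^sup>2 * (\<Sum>m. (coord x m)\<^sup>2)"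
proof -
  note Schur = Schur_test[of "\<lambda>n m. \<bar>a (n + m)\<bar>" "\<lambda>n. 1 / sqrt (real (n + 1))" "4 * C",
      OF _ _ _ Schur_assms summable_coord_square]
  show "summable (\<lambda>m. \<bar>a (n + m)\<bar> * \<bar>coord x m\<bar>)"
    by (rule Schur(1)) (use C_nonneg in auto)
  show "(\<Sum>n<N. (\<Sum>m. \<bar>a (n + m)\<bar> * \<bar>coord x m\<bar>)\<^sup>2) \<le> (4 * C)\<^sup>2 * (\<Sum>m. (coord x m)\<^sup>2)"
    by (rule Schur(2)) (use C_nonneg in auto)
qed

lemma summable_row: "summable (\<lambda>m. a (n + m) * coord x m)"
  by (rule summable_rabs_cancel) (use summable_row_abs[of n x] in \<open>simp add: abs_mult\<close>)

lemma sum_square_rows_le: "(\<Sum>n<N. (\<Sum>m. a (n + m) * coord x m)\<^sup>2) \<le> (4 * C * norm x)\<^sup>2"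
proof -
  have "(\<Sum>n<N. (\<Sum>m. a (n + m) * coord x m)\<^sup>2) \<le> (\<Sum>n<N. (\<Sum>m. \<bar>a (n + m)\<bar> * \<bar>coord x m\<bar>)\<^sup>2)"
  proof (rule sum_mono)
    fix n
    have "\<bar>\<Sum>m. a (n + m) * coord x m\<bar> \<le> (\<Sum>m. \<bar>a (n + m) * coord x m\<bar>)"
      by (rule summable_rabs) (use summable_row_abs[of n x] in \<open>simp add: abs_mult\<close>)
    then have "\<bar>\<Sum>m. a (n + m) * coord x m\<bar> \<le> (\<Sum>m. \<bar>a (n + m)\<bar> * \<bar>coord x m\<bar>)" by (simp add: abs_mult)
    then have "\<bar>\<Sum>m. a (n + m) * coord x m\<bar>\<^sup>2 \<le> (\<Sum>m. \<bar>a (n + m)\<bar> * \<bar>coord x m\<bar>)\<^sup>2"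
      by (intro power_mono) auto
    then show "(\<Sum>m. a (n + m) * coord x m)\<^sup>2 \<le> (\<Sum>m. \<bar>a (n + m)\<bar> * \<bar>coord x m\<bar>)\<^sup>2" by simp
  qed
  also have "\<dots> \<le> (4 * C)\<^sup>2 * (\<Sum>m. (coord x m)\<^sup>2)" by (rule sum_rows_le)
  finally show ?thesis by (simp add: norm_l2_square power_mult_distrib)
qed

lemma coord_hankel_op: "coord (hankel_op a x) n = (\<Sum>m. a (n + m) * coord x m)"
proof -
  have "summable (\<lambda>n. (\<Sum>m. a (n + m) * coord x m)\<^sup>2)"
    by (rule summableI_nonneg_bounded[OF _ sum_square_rows_le]) simp
  then show ?thesis by (simp add: hankel_op_def l2_of_seq_inverse)
qed

lemma norm_hankel_op_le: "norm (hankel_op a x) \<le> 4 * C * norm x"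
proof (rule power2_le_imp_le)
  show "(norm (hankel_op a x))\<^sup>2 \<le> (4 * C * norm x)\<^sup>2"
    unfolding norm_l2_square
    by (rule suminf_le_const[OF summable_coord_square]) (simp add: coord_hankel_op sum_square_rows_le)
qed (use C_nonneg in simp)

lemma bounded_linear_hankel_op: "bounded_linear (hankel_op a)"
proof (rule bounded_linear_intro[where K = "4 * C"])
  fix x y :: l2 and r :: real
  show "hankel_op a (x + y) = hankel_op a x + hankel_op a y"
    by (simp add: coord_inject[symmetric] fun_eq_iff plus_l2.rep_eq coord_hankel_op distrib_left
        suminf_add summable_row)
  show "hankel_op a (r *\<^sub>R x) = r *\<^sub>R hankel_op a x"
    by (simp add: coord_inject[symmetric] fun_eq_iff scaleR_l2.rep_eq coord_hankel_op mult.left_commute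
        suminf_mult summable_row)
  show "norm (hankel_op a x) \<le> norm x * (4 * C)" using norm_hankel_op_le[of x] by (simp add: mult.commute)
qed

lemma weak_l1_seq_Suc: "weak_l1_seq (\<lambda>n. a (Suc n)) C"
proof
  fix n
  have "real (n + 1) * \<bar>a (Suc n)\<bar> \<le> real (Suc n + 1) * \<bar>a (Suc n)\<bar>" by (intro mult_right_mono) auto
  also have "\<dots> \<le> C" by (rule decay)
  finally show "real (n + 1) * \<bar>a (Suc n)\<bar> \<le> C" .
qed

end

section \<open>Shifts and the kernels of the two Hankel operators\<close>

definition unit_l2 :: "nat \<Rightarrow> l2" where
  "unit_l2 k = l2_of_seq (\<lambda>n. if n = k then 1 else 0)"

lemma coord_unit_l2: "coord (unit_l2 k) n = (if n = k then 1 else 0)"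
proof -
  have "summable (\<lambda>n. (if n = k then 1 else 0 :: real)\<^sup>2)"
    by (rule summable_finite[of "{k}"]) auto
  then show ?thesis by (simp add: unit_l2_def l2_of_seq_inverse)
qed

lemma inner_unit_l2: "inner (unit_l2 k) x = coord x k"
proof -
  have "inner (unit_l2 k) x = (\<Sum>n\<in>{k}. coord (unit_l2 k) n * coord x n)"
    unfolding inner_l2_def by (rule suminf_finite) (auto simp: coord_unit_l2)
  then show ?thesis by (simp add: coord_unit_l2)
qed

definition shift_right :: "l2 \<Rightarrow> l2" where
  "shift_right x = l2_of_seq (\<lambda>n. case n of 0 \<Rightarrow> 0 | Suc k \<Rightarrow> coord x k)"

definition shift_left :: "l2 \<Rightarrow> l2" where
  "shift_left x = l2_of_seq (\<lambda>n. coord x (Suc n))"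

lemma coord_shift_right: "coord (shift_right x) n = (case n of 0 \<Rightarrow> 0 | Suc k \<Rightarrow> coord x k)"
proof -
  have "summable (\<lambda>n. (case Suc n of 0 \<Rightarrow> 0 | Suc k \<Rightarrow> coord x k)\<^sup>2)"
    using summable_coord_square[of x] by simp
  then have "summable (\<lambda>n. (case n of 0 \<Rightarrow> 0 | Suc k \<Rightarrow> coord x k)\<^sup>2)"
    by (subst (asm) summable_Suc_iff)
  then show ?thesis by (simp add: shift_right_def l2_of_seq_inverse)
qed

lemma coord_shift_left: "coord (shift_left x) n = coord x (Suc n)"
proof -
  have "summable (\<lambda>n. (coord x (Suc n))\<^sup>2)"
    using summable_coord_square[of x] by (subst summable_Suc_iff)
  then show ?thesis by (simp add: shift_left_def l2_of_seq_inverse)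
qed

lemma l2_decompose: "x = coord x 0 *\<^sub>R unit_l2 0 + shift_right (shift_left x)"
  unfolding coord_inject[symmetric]
  by (auto simp: fun_eq_iff plus_l2.rep_eq scaleR_l2.rep_eq coord_unit_l2 coord_shift_right coord_shift_left
      split: nat.splits)

context weak_l1_seq
begin

text \<open>The sequence \<open>a\<close> as an element of the space. Taking it as the first column
  of the matrix derives its square summability from the boundedness of the operator.\<close>

definition v :: l2 where
  "v = hankel_op a (unit_l2 0)"

abbreviation G :: "l2 \<Rightarrow> l2" where
  "G \<equiv> hankel_op (\<lambda>n. a (Suc n))"

interpretation shifted: weak_l1_seq "\<lambda>n. a (Suc n)" C
  by (rule weak_l1_seq_Suc)

lemma coord_v: "coord v n = a n"
proof -
  have "coord v n = (\<Sum>m. a (n + m) * coord (unit_l2 0) m)" by (simp add: v_def coord_hankel_op)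
  also have "\<dots> = (\<Sum>m\<in>{0}. a (n + m) * coord (unit_l2 0) m)"
    by (rule suminf_finite) (auto simp: coord_unit_l2)
  finally show ?thesis by (simp add: coord_unit_l2)
qed

lemma coord_G: "coord (G x) n = coord (hankel_op a x) (Suc n)"
  by (simp add: coord_hankel_op shifted.coord_hankel_op)

lemma hankel_op_shift_right: "hankel_op a (shift_right x) = G x"
proof -
  have "coord (hankel_op a (shift_right x)) n = coord (G x) n" for n
  proof -
    have "coord (hankel_op a (shift_right x)) n
        = (\<Sum>m. a (n + Suc m) * coord (shift_right x) (Suc m)) + a (n + 0) * coord (shift_right x) 0"
      unfolding coord_hankel_op using suminf_split_head[OF summable_row[of n "shift_right x"]] by linarith
    then show ?thesis by (simp add: coord_shift_right shifted.coord_hankel_op)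
  qed
  then show ?thesis by (simp add: coord_inject[symmetric] fun_eq_iff)
qed

text \<open>In the outer sum the term with index 0 gives the rank one part; the remaining terms
  involve only shifted entries and shifted coordinates, that is, \<open>G\<close> twice.\<close>

lemma hankel_op_square: "hankel_op a (hankel_op a x) = G (G x) + inner x v *\<^sub>R v"
proof -
  have "coord (hankel_op a (hankel_op a x)) n = coord (G (G x)) n + inner x v * coord v n" for n
  proof -
    have "coord (hankel_op a (hankel_op a x)) n
        = (\<Sum>m. a (n + Suc m) * coord (hankel_op a x) (Suc m)) + a (n + 0) * coord (hankel_op a x) 0"
      unfolding coord_hankel_op[of "hankel_op a x"]
      using suminf_split_head[OF summable_row[of n "hankel_op a x"]] by linarith
    also have "(\<Sum>m. a (n + Suc m) * coord (hankel_op a x) (Suc m)) = coord (G (G x)) n"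
      by (simp only: shifted.coord_hankel_op[of "G x"] coord_G[of x] add_Suc_right)
    also have "coord (hankel_op a x) 0 = inner x v"
      by (simp add: coord_hankel_op inner_l2_def coord_v mult.commute)
    finally show ?thesis by (simp add: coord_v)
  qed
  then show ?thesis by (simp add: coord_inject[symmetric] fun_eq_iff plus_l2.rep_eq scaleR_l2.rep_eq)
qed

text \<open>
  If \<open>y\<close> lies in the common kernel, so does its backward shift as long as \<open>y\<^sub>0 = 0\<close>; the first
  nonzero coordinate then exhibits \<open>v\<close> as an element of the range of \<open>G\<close>.
\<close>

lemma kernels_trivial_iff:
  assumes symH: "\<And>x y. inner (hankel_op a x) y = inner x (hankel_op a y)"
    and symG: "\<And>x y. inner (G x) y = inner x (G y)"
  shows "(\<forall>x. hankel_op a x = 0 \<longrightarrow> x = 0) \<and> (\<forall>x. G x = 0 \<longrightarrow> x = 0) \<longleftrightarrow>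
    v \<notin> range G \<and> (\<forall>x. G x = 0 \<longrightarrow> inner x v = 0)"
proof -
  let ?H = "hankel_op a"
  have linH: "linear ?H" and linG: "linear G"
    using bounded_linear_hankel_op shifted.bounded_linear_hankel_op by (auto intro: bounded_linear.linear)
  show ?thesis
  proof (intro iffI conjI allI impI)
    assume triv: "(\<forall>x. ?H x = 0 \<longrightarrow> x = 0) \<and> (\<forall>x. G x = 0 \<longrightarrow> x = 0)"
    show "v \<notin> range G"
    proof
      assume "v \<in> range G"
      then obtain u where "v = G u" by blast
      \<comment> \<open>The image is \<open>v - G u\<close>, while the vector itself has first
        coordinate 1.\<close>
      then have "?H (unit_l2 0 - shift_right u) = 0"
        by (simp add: linear_diff[OF linH] hankel_op_shift_right flip: v_def)
      then have "unit_l2 0 - shift_right u = 0" by (rule triv[THEN conjunct1, rule_format])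
      then have "unit_l2 0 = shift_right u" by simp
      then have "coord (unit_l2 0) 0 = coord (shift_right u) 0" by simp
      then show False by (simp add: coord_unit_l2 coord_shift_right)
    qed
    fix x assume "G x = 0"
    then have "x = 0" by (rule triv[THEN conjunct2, rule_format])
    then show "inner x v = 0" by simp
  next
    assume *: "v \<notin> range G \<and> (\<forall>x. G x = 0 \<longrightarrow> inner x v = 0)"
    \<comment> \<open>The squared norm of \<open>?H x\<close> is the quadratic form of
      \<open>G^2\<close> plus the square of \<open>inner x v\<close>, and both vanish.\<close>
    have H_of_G: "?H x = 0" if "G x = 0" for x
    proof -
      have "inner (?H x) (?H x) = inner (?H (?H x)) x" by (simp only: symH)
      also have "\<dots> = 0" using that * by (simp add: hankel_op_square linear_0[OF linG])
      finally show ?thesis by simp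
    qed
    \<comment> \<open>By \<open>l2_decompose\<close>, \<open>?H x\<close> is
      \<open>coord x 0\<close> times \<open>v\<close> plus an element of the range of
      \<open>G\<close>; a nonzero first coordinate allows solving for \<open>v\<close>.\<close>
    have head: "v \<in> range G" if "?H x = 0" and x0: "coord x 0 \<noteq> 0" for x
    proof -
      have "?H (coord x 0 *\<^sub>R unit_l2 0 + shift_right (shift_left x)) = 0"
        unfolding l2_decompose[of x, symmetric] by (rule that(1))
      then have "coord x 0 *\<^sub>R v + G (shift_left x) = 0"
        by (simp add: linear_add[OF linH] linear_scale[OF linH] hankel_op_shift_right v_def)
      then have "coord x 0 *\<^sub>R v = G (- shift_left x)"
        by (simp add: linear_neg[OF linG] add_eq_0_iff2)
      from arg_cong[OF this, of "\<lambda>z. (1 / coord x 0) *\<^sub>R z"]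
      have "v = (1 / coord x 0) *\<^sub>R G (- shift_left x)" using x0 by simp
      also have "\<dots> = G ((1 / coord x 0) *\<^sub>R (- shift_left x))" by (simp only: linear_scale[OF linG])
      finally show ?thesis by blast
    qed
    have descent: "coord x k = 0" if "?H x = 0" for x k
      using that
    proof (induction k arbitrary: x)
      case 0
      show ?case
      proof (rule ccontr)
        assume x0: "coord x 0 \<noteq> 0"
        then have "v \<in> range G" using 0 by (intro head)
        then show False using * by blast
      qed
    next
      case (Suc k)
      have "coord x 0 = 0"
      proof (rule ccontr)
        assume x0: "coord x 0 \<noteq> 0"
        then have "v \<in> range G" using Suc.prems by (intro head)
        then show False using * by blast
      qed
      then have x: "shift_right (shift_left x) = x" by (subst (3) l2_decompose) simp
      have "G (shift_left x) = 0"
        unfolding hankel_op_shift_right[symmetric] x by (rule Suc.prems)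
      then have "coord (shift_left x) k = 0" by (intro Suc.IH H_of_G)
      then show ?case by (simp add: coord_shift_left)
    qed
    have H_triv: "x = 0" if "?H x = 0" for x
    proof -
      have "coord x = coord 0" by (rule ext) (simp only: descent[OF that] zero_l2.rep_eq)
      then show ?thesis by (simp only: coord_inject)
    qed
    show "x = 0" if "?H x = 0" for x using that by (rule H_triv)
    show "x = 0" if "G x = 0" for x by (rule H_triv[OF H_of_G[OF that]])
  qed
qed

end

section \<open>Real operators on the complex sequence space\<close>

definition emb :: "l2 \<Rightarrow> l2 \<Rightarrow> seq" where
  "emb u w = (\<lambda>n. Complex (coord u n) (coord w n))"

lemma emb_in_ell2: "emb u w \<in> ell2"
  unfolding ell2_def emb_def
  by (simp add: cmod_power2 summable_add summable_coord_square)

lemma ell2E: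
  assumes "x \<in> ell2"
  obtains u w where "x = emb u w"
proof
  have s: "summable (\<lambda>n. (Re (x n))\<^sup>2 + (Im (x n))\<^sup>2)"
    using assms by (simp add: ell2_def cmod_power2)
  have "summable (\<lambda>n. (Re (x n))\<^sup>2)" by (rule summable_comparison_test'[OF s]) simp
  moreover have "summable (\<lambda>n. (Im (x n))\<^sup>2)" by (rule summable_comparison_test'[OF s]) simp
  ultimately show "x = emb (l2_of_seq (\<lambda>n. Re (x n))) (l2_of_seq (\<lambda>n. Im (x n)))"
    by (simp add: emb_def l2_of_seq_inverse)
qed

lemma ell2_norm_emb_power2: "(ell2_norm (emb u w))\<^sup>2 = (norm u)\<^sup>2 + (norm w)\<^sup>2"
proof -
  have "(\<Sum>n. (cmod (emb u w n))\<^sup>2) = (norm u)\<^sup>2 + (norm w)\<^sup>2"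
    by (simp add: emb_def cmod_power2 norm_l2_square suminf_add summable_coord_square)
  then show ?thesis by (simp add: ell2_norm_def)
qed

lemma ell2_norm_nonneg: "x \<in> ell2 \<Longrightarrow> ell2_norm x \<ge> 0"
  unfolding ell2_def ell2_norm_def by (simp add: suminf_nonneg)

lemma emb_eq_iff: "emb u w = emb u' w' \<longleftrightarrow> u = u' \<and> w = w'"
  by (auto simp: emb_def fun_eq_iff coord_inject[symmetric])

lemma emb_0: "emb 0 0 = (\<lambda>n. 0)"
  by (simp add: emb_def zero_l2.rep_eq complex_eq_iff fun_eq_iff)

lemma ell2_inner_emb:
  "ell2_inner (emb a b) (emb u w) = Complex (inner a u + inner b w) (inner b u - inner a w)"
proof -
  have "(\<lambda>n. coord x n * coord y n) sums inner x y" for x y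
    unfolding inner_l2_def by (rule summable_sums[OF summable_coord_mult])
  then have "(\<lambda>n. emb a b n * cnj (emb u w n)) sums Complex (inner a u + inner b w) (inner b u - inner a w)"
    unfolding sums_complex_iff by (auto simp: emb_def intro!: sums_add sums_diff)
  then show ?thesis unfolding ell2_inner_def by (rule sums_unique[symmetric])
qed

lemma coord_sum: "coord (\<Sum>i\<in>I. f i) n = (\<Sum>i\<in>I. coord (f i) n)"
  by (induction I rule: infinite_finite_induct) (auto simp: zero_l2.rep_eq plus_l2.rep_eq)

text \<open>\<open>acts_as T P Q\<close> says that \<open>T\<close> is \<open>P + i Q\<close> with real operators \<open>P\<close>, \<open>Q\<close>.\<close>

definition acts_as :: "(seq \<Rightarrow> seq) \<Rightarrow> (l2 \<Rightarrow> l2) \<Rightarrow> (l2 \<Rightarrow> l2) \<Rightarrow> bool" where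
  "acts_as T P Q \<longleftrightarrow> (\<forall>u w. T (emb u w) = emb (P u - Q w) (Q u + P w))"

lemma acts_as_norm_le:
  assumes T: "acts_as T P Q" and P: "\<And>u. norm (P u) \<le> p * norm u" and Q: "\<And>u. norm (Q u) \<le> q * norm u"
    and pq: "p \<ge> 0" "q \<ge> 0" and x: "x \<in> ell2"
  shows "ell2_norm (T x) \<le> (p + q) * ell2_norm x"
proof -
  obtain u w where x_eq: "x = emb u w" using ell2E[OF x] .
  have "(ell2_norm (T x))\<^sup>2 = (norm (P u - Q w))\<^sup>2 + (norm (Q u + P w))\<^sup>2"
    using T by (simp add: x_eq acts_as_def ell2_norm_emb_power2)
  also have "\<dots> \<le> (p * norm u + q * norm w)\<^sup>2 + (q * norm u + p * norm w)\<^sup>2"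
    using order_trans[OF norm_triangle_ineq4 add_mono[OF P Q]] order_trans[OF norm_triangle_ineq add_mono[OF Q P]]
    by (intro add_mono power_mono) auto
  also have "\<dots> = (p\<^sup>2 + q\<^sup>2) * ((norm u)\<^sup>2 + (norm w)\<^sup>2) + 2 * p * q * (2 * norm u * norm w)"
    by (simp add: power2_eq_square algebra_simps)
  also have "\<dots> \<le> (p\<^sup>2 + q\<^sup>2) * ((norm u)\<^sup>2 + (norm w)\<^sup>2) + 2 * p * q * ((norm u)\<^sup>2 + (norm w)\<^sup>2)"
    using pq by (intro add_left_mono mult_left_mono sum_squares_bound) auto
  also have "\<dots> = ((p + q) * ell2_norm x)\<^sup>2"
    by (simp add: x_eq power_mult_distrib ell2_norm_emb_power2) (simp add: power2_eq_square algebra_simps)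
  finally show ?thesis
    using pq ell2_norm_nonneg[OF x] by (meson add_nonneg_nonneg mult_nonneg_nonneg power2_le_imp_le)
qed

lemma acts_as_in_ell2: "acts_as T P Q \<Longrightarrow> x \<in> ell2 \<Longrightarrow> T x \<in> ell2"
  by (metis acts_as_def ell2E emb_in_ell2)

lemma bounded_op_acts_as:
  assumes T: "acts_as T P Q" and P: "bounded_linear P" and Q: "bounded_linear Q"
  shows "bounded_op T"
  unfolding bounded_op_def
proof (intro conjI ballI allI)
  show "T x \<in> ell2" if "x \<in> ell2" for x using acts_as_in_ell2[OF T that] .
  obtain p where p: "p \<ge> 0" "\<And>u. norm (P u) \<le> p * norm u"
    using bounded_linear.nonneg_bounded[OF P] by (auto simp: mult.commute)
  obtain q where q: "q \<ge> 0" "\<And>u. norm (Q u) \<le> q * norm u"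
    using bounded_linear.nonneg_bounded[OF Q] by (auto simp: mult.commute)
  show "\<exists>C. \<forall>x\<in>ell2. ell2_norm (T x) \<le> C * ell2_norm x"
    using acts_as_norm_le[OF T p(2) q(2) p(1) q(1)] by blast
  fix x y a b assume "x \<in> ell2" "y \<in> ell2"
  then obtain u w u' w' where xy: "x = emb u w" "y = emb u' w'" by (metis ell2E)
  interpret P: bounded_linear P by fact
  interpret Q: bounded_linear Q by fact
  have "(\<lambda>n. a * x n + b * y n)
      = emb (Re a *\<^sub>R u - Im a *\<^sub>R w + (Re b *\<^sub>R u' - Im b *\<^sub>R w')) (Re a *\<^sub>R w + Im a *\<^sub>R u + (Re b *\<^sub>R w' + Im b *\<^sub>R u'))"
    by (simp add: xy emb_def complex_eq_iff fun_eq_iff plus_l2.rep_eq minus_l2.rep_eq scaleR_l2.rep_eq)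
  then show "T (\<lambda>n. a * x n + b * y n) = (\<lambda>n. a * T x n + b * T y n)"
    using T unfolding acts_as_def xy
    by (simp add: P.add P.diff P.scaleR Q.add Q.diff Q.scaleR)
      (simp add: emb_def complex_eq_iff fun_eq_iff plus_l2.rep_eq minus_l2.rep_eq scaleR_l2.rep_eq algebra_simps)
qed

lemma op_norm_le:
  assumes "\<And>x. x \<in> ell2 \<Longrightarrow> ell2_norm (T x) \<le> C * ell2_norm x" "C \<ge> 0"
  shows "op_norm T \<le> C"
  unfolding op_norm_def
proof (rule cSUP_least)
  have "emb 0 0 \<in> {x \<in> ell2. ell2_norm x \<le> 1}"
    using ell2_norm_emb_power2[of 0 0] by (simp add: emb_in_ell2)
  then show "{x \<in> ell2. ell2_norm x \<le> 1} \<noteq> {}" by blast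
  show "ell2_norm (T x) \<le> C" if "x \<in> {x \<in> ell2. ell2_norm x \<le> 1}" for x
  proof -
    have "ell2_norm (T x) \<le> C * ell2_norm x" using that assms(1) by simp
    also have "\<dots> \<le> C * 1" using that assms(2) by (intro mult_left_mono) auto
    finally show ?thesis by simp
  qed
qed

lemma ell2_norm_scale: "ell2_norm (\<lambda>n. a * x n) = cmod a * ell2_norm x" if "x \<in> ell2"
proof -
  have "(\<Sum>n. (cmod (a * x n))\<^sup>2) = (cmod a)\<^sup>2 * (\<Sum>n. (cmod (x n))\<^sup>2)"
    using that by (simp add: norm_mult power_mult_distrib suminf_mult ell2_def)
  then show ?thesis by (simp add: ell2_norm_def real_sqrt_mult)
qed

text \<open>\<open>op_norm\<close> is a supremum of reals and is meaningful only for a bounded set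
  of values, which the constant in \<open>bounded_op\<close> supplies; scaling to norm 1 does the
  rest.\<close>

lemma bounded_op_norm_le:
  assumes T: "bounded_op T" and x: "x \<in> ell2"
  shows "ell2_norm (T x) \<le> op_norm T * ell2_norm x"
proof -
  obtain C where C: "\<And>x. x \<in> ell2 \<Longrightarrow> ell2_norm (T x) \<le> C * ell2_norm x"
    using T unfolding bounded_op_def by blast
  have Tx: "T x \<in> ell2" using T x by (simp add: bounded_op_def)
  show ?thesis
  proof (cases "ell2_norm x = 0")
    case True
    then show ?thesis using C[OF x] by simp
  next
    case False
    then have pos: "ell2_norm x > 0" using ell2_norm_nonneg[OF x] by simp
    define a where "a = complex_of_real (1 / ell2_norm x)"
    define y where "y = (\<lambda>n. a * x n)"
    have Ty: "T y = (\<lambda>n. a * T x n)"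
      using T x unfolding bounded_op_def y_def
      by (metis (no_types, lifting) ext add_0_right mult_zero_left)
    have y: "y \<in> ell2"
      using x unfolding y_def ell2_def by (simp add: norm_mult power_mult_distrib summable_mult)
    have ny: "ell2_norm y = 1" unfolding y_def ell2_norm_scale[OF x] using pos by (simp add: a_def norm_divide)
    have "bdd_above ((\<lambda>x. ell2_norm (T x)) ` {x \<in> ell2. ell2_norm x \<le> 1})"
    proof (rule bdd_aboveI2)
      fix z assume z: "z \<in> {x \<in> ell2. ell2_norm x \<le> 1}"
      then have "ell2_norm (T z) \<le> C * ell2_norm z" using C by simp
      also have "\<dots> \<le> \<bar>C\<bar> * 1" using z ell2_norm_nonneg by (intro mult_mono) auto
      finally show "ell2_norm (T z) \<le> \<bar>C\<bar>" by simp
    qed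
    then have "ell2_norm (T y) \<le> op_norm T"
      unfolding op_norm_def using y ny by (intro cSUP_upper) auto
    then have "cmod a * ell2_norm (T x) \<le> op_norm T" unfolding Ty ell2_norm_scale[OF Tx] .
    then show ?thesis using pos by (simp add: a_def norm_divide divide_le_eq)
  qed
qed

lemma op_norm_nonneg: "bounded_op T \<Longrightarrow> op_norm T \<ge> 0"
  using bounded_op_norm_le[of T "emb (unit_l2 0) 0"] ell2_norm_emb_power2[of "unit_l2 0" 0]
    ell2_norm_nonneg[OF emb_in_ell2, of "unit_l2 0" 0] ell2_norm_nonneg[of "T (emb (unit_l2 0) 0)"]
    inner_unit_l2[of 0 "unit_l2 0"]
  by (auto simp: emb_in_ell2 bounded_op_def power2_norm_eq_inner coord_unit_l2 power2_eq_1_iff)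

section \<open>Polynomials of an operator and the functional calculus\<close>

lemma poly_map_poly_Re: "poly (map_poly Re p) t = Re (poly p (complex_of_real t))"
  by (induction p) (simp_all add: map_poly_pCons)

lemma poly_map_poly_Im: "poly (map_poly Im p) t = Im (poly p (complex_of_real t))"
  by (induction p) (simp_all add: map_poly_pCons)

lemma acts_as_funpow:
  assumes "acts_as T A (\<lambda>_. 0)"
  shows "(T ^^ k) (emb u w) = emb ((A ^^ k) u) ((A ^^ k) w)"
  using assms by (induction k) (auto simp: acts_as_def)

lemma acts_as_op_poly:
  assumes "acts_as T A (\<lambda>_. 0)"
  shows "acts_as (op_poly p T) (poly_op (map_poly Re p) A) (poly_op (map_poly Im p) A)"
  unfolding acts_as_def
proof (intro allI ext)
  fix u w n
  have deg: "degree (map_poly f p) \<le> degree p" if "f 0 = 0" for f :: "complex \<Rightarrow> real"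
    by (rule degree_le) (simp add: coeff_map_poly coeff_eq_0 that)
  have Re: "poly_op (map_poly Re p) A z = (\<Sum>k\<le>degree p. Re (coeff p k) *\<^sub>R (A ^^ k) z)" for z
    using poly_op_altdef[of "map_poly Re p" "degree p" A z] by (simp add: deg coeff_map_poly)
  have Im: "poly_op (map_poly Im p) A z = (\<Sum>k\<le>degree p. Im (coeff p k) *\<^sub>R (A ^^ k) z)" for z
    using poly_op_altdef[of "map_poly Im p" "degree p" A z] by (simp add: deg coeff_map_poly)
  show "op_poly p T (emb u w) n = emb (poly_op (map_poly Re p) A u - poly_op (map_poly Im p) A w)
      (poly_op (map_poly Im p) A u + poly_op (map_poly Re p) A w) n"
    unfolding op_poly_def acts_as_funpow[OF assms] unfolding emb_def Re Im
    by (simp add: complex_eq_iff minus_l2.rep_eq plus_l2.rep_eq scaleR_l2.rep_eq coord_sum sum_subtractf sum.distrib add.commute)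
qed

lemma op_poly_diff: "op_poly (p - q) T x n = op_poly p T x n - op_poly q T x n"
proof -
  have alt: "op_poly r T x n = (\<Sum>k\<le>m. coeff r k * (T ^^ k) x n)" if "degree r \<le> m" for r m
    unfolding op_poly_def using that by (intro sum.mono_neutral_left) (auto simp: coeff_eq_0)
  let ?m = "max (degree p) (degree q)"
  show ?thesis
    using alt[of "p - q" ?m] alt[of p ?m] alt[of q ?m]
    by (simp add: degree_diff_le left_diff_distrib sum_subtractf)
qed

context symmetric_operator
begin

lemma bounded_linear_poly_op: "bounded_linear (poly_op p A)"
proof (induction p)
  case 0
  show ?case by (simp add: fun_eq_iff bounded_linear_zero)
next
  case (pCons a p)
  have "bounded_linear (\<lambda>x. a *\<^sub>R x + A (poly_op p A x))"
    by (intro bounded_linear_add bounded_linear_scaleR_right bounded_linear_compose[OF bounded_linear_A] pCons.IH)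
  then show ?case by (simp add: poly_op_pCons[OF linear_A])
qed

end

text \<open>\<open>T\<close> is the complex extension of the square of a real symmetric operator, so
  its polynomials are controlled by their values on \<open>[0, op_norm T]\<close>.\<close>

locale real_square_op = symmetric_operator G for G :: "l2 \<Rightarrow> l2" +
  fixes T :: "seq \<Rightarrow> seq"
  assumes acts: "acts_as T A (\<lambda>_. 0)"
begin

lemma bounded_op_T: "bounded_op T"
  by (rule bounded_op_acts_as[OF acts bounded_linear_A bounded_linear_zero])

lemma bounded_op_poly: "bounded_op (op_poly p T)"
  by (rule bounded_op_acts_as[OF acts_as_op_poly[OF acts] bounded_linear_poly_op bounded_linear_poly_op])

lemma norm_G_le: "(norm (G x))\<^sup>2 \<le> op_norm T * (norm x)\<^sup>2"
proof -
  have n: "ell2_norm (emb y 0) = norm y" for y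
    using ell2_norm_emb_power2[of y 0] ell2_norm_nonneg[OF emb_in_ell2, of y 0] by (simp add: power2_eq_iff_nonneg)
  have "T (emb x 0) = emb (A x) 0"
    using acts linear_0[OF linear_A] by (simp add: acts_as_def)
  then have "norm (A x) \<le> op_norm T * norm x"
    using bounded_op_norm_le[OF bounded_op_T emb_in_ell2, of x 0] by (simp add: n)
  then have "norm (A x) * norm x \<le> op_norm T * norm x * norm x" by (intro mult_right_mono) auto
  moreover have "(norm (G x))\<^sup>2 \<le> norm (A x) * norm x"
    using norm_cauchy_schwarz[of "A x" x] by (simp add: inner_A)
  ultimately show ?thesis by (simp add: power2_eq_square mult.assoc)
qed

text \<open>Real and imaginary parts of the polynomial are estimated separately. The resulting
  factor 2 is harmless, as the bound is used only to show convergence to 0.\<close>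

lemma op_poly_norm_le:
  assumes "\<And>t. t \<in> {- op_norm T..op_norm T} \<Longrightarrow> cmod (poly q (complex_of_real t)) \<le> d" "d \<ge> 0" "x \<in> ell2"
  shows "ell2_norm (op_poly q T x) \<le> 2 * d * ell2_norm x"
proof -
  have N: "op_norm T \<ge> 0" by (rule op_norm_nonneg[OF bounded_op_T])
  have "norm (poly_op (map_poly Re q) A u) \<le> d * norm u" for u
    by (rule norm_poly_op_le[OF norm_G_le N _ assms(2)])
      (use assms(1) N order_trans[OF abs_Re_le_cmod] in \<open>auto simp: poly_map_poly_Re\<close>)
  moreover have "norm (poly_op (map_poly Im q) A u) \<le> d * norm u" for u
    by (rule norm_poly_op_le[OF norm_G_le N _ assms(2)])
      (use assms(1) N order_trans[OF abs_Im_le_cmod] in \<open>auto simp: poly_map_poly_Im\<close>)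
  ultimately have "ell2_norm (op_poly q T x) \<le> (d + d) * ell2_norm x"
    using assms by (intro acts_as_norm_le[OF acts_as_op_poly[OF acts]]) auto
  then show ?thesis by simp
qed

text \<open>Provides a witness for the choice in \<open>fun_calc\<close>: if \<open>\<phi>\<close>
  agrees with \<open>p\<close> on the interval, then \<open>ps j - p\<close> is uniformly small
  there, hence small as an operator.\<close>

lemma is_fun_calc_op_poly:
  assumes \<phi>: "\<And>t. t \<in> {- op_norm T..op_norm T} \<Longrightarrow> \<phi> t = poly p (complex_of_real t)"
  shows "is_fun_calc \<phi> T (op_poly p T)"
  unfolding is_fun_calc_def
proof (intro conjI allI impI)
  show "bounded_op (op_poly p T)" by (rule bounded_op_poly)
  fix ps :: "nat \<Rightarrow> complex poly"
  assume lim: "uniform_limit {- op_norm T..op_norm T} (\<lambda>j t. poly (ps j) (complex_of_real t)) \<phi> sequentially"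
  have diff: "op_minus (op_poly (ps j) T) (op_poly p T) = op_poly (ps j - p) T" for j
    by (simp add: op_minus_def fun_eq_iff op_poly_diff)
  show "(\<lambda>j. op_norm (op_minus (op_poly (ps j) T) (op_poly p T))) \<longlonglongrightarrow> 0"
    unfolding diff
  proof (rule LIMSEQ_I)
    fix e :: real assume e: "e > 0"
    have "\<forall>\<^sub>F j in sequentially. \<forall>t\<in>{- op_norm T..op_norm T}. dist (poly (ps j) (complex_of_real t)) (\<phi> t) < e / 3"
      using lim e by (intro uniform_limitD) auto
    then obtain n0 where n0: "\<And>j t. j \<ge> n0 \<Longrightarrow> t \<in> {- op_norm T..op_norm T} \<Longrightarrow>
        dist (poly (ps j) (complex_of_real t)) (\<phi> t) < e / 3"
      unfolding eventually_sequentially by blast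
    show "\<exists>n0. \<forall>j\<ge>n0. norm (op_norm (op_poly (ps j - p) T) - 0) < e"
    proof (intro exI allI impI)
      fix j assume j: "n0 \<le> j"
      have "op_norm (op_poly (ps j - p) T) \<le> 2 * (e / 3)"
      proof (rule op_norm_le)
        fix x assume "x \<in> ell2"
        then show "ell2_norm (op_poly (ps j - p) T x) \<le> 2 * (e / 3) * ell2_norm x"
          using n0[OF j] \<phi> e
          by (intro op_poly_norm_le) (fastforce simp: dist_norm intro: less_imp_le)+
      qed (use e in simp)
      then show "norm (op_norm (op_poly (ps j - p) T) - 0) < e"
        using e op_norm_nonneg[OF bounded_op_poly, of "ps j - p"] by simp
    qed
  qed
qed

text \<open>The chosen operator must be the limit for the constant sequence \<open>p\<close> too, so
  its distance from \<open>op_poly p T\<close> is 0.\<close>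

lemma fun_calc_eq_op_poly:
  assumes \<phi>: "\<And>t. t \<in> {- op_norm T..op_norm T} \<Longrightarrow> \<phi> t = poly p (complex_of_real t)" and x: "x \<in> ell2"
  shows "fun_calc \<phi> T x = op_poly p T x"
proof -
  have F: "is_fun_calc \<phi> T (fun_calc \<phi> T)"
    unfolding fun_calc_def by (rule someI[where x = "op_poly p T"], rule is_fun_calc_op_poly, rule \<phi>)
  let ?D = "op_minus (op_poly p T) (fun_calc \<phi> T)"
  have "uniform_limit {- op_norm T..op_norm T} (\<lambda>(j :: nat) t. poly p (complex_of_real t)) \<phi> sequentially"
    by (rule uniform_limitI) (simp add: \<phi>)
  then have "(\<lambda>j :: nat. op_norm ?D) \<longlonglongrightarrow> 0"
    by (rule F[unfolded is_fun_calc_def, THEN conjunct2, rule_format])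
  then have zero: "op_norm ?D = 0" by (simp add: LIMSEQ_const_iff)
  have bF: "bounded_op (fun_calc \<phi> T)" using F by (simp add: is_fun_calc_def)
  \<comment> \<open>Boundedness of the difference has to be known before
    \<open>op_norm ?D = 0\<close> can be read as the vanishing of \<open>?D\<close>.\<close>
  have "bounded_op ?D"
    unfolding bounded_op_def
  proof (intro conjI ballI allI)
    obtain C1 where C1: "\<And>x. x \<in> ell2 \<Longrightarrow> ell2_norm (op_poly p T x) \<le> C1 * ell2_norm x"
      using bounded_op_poly[of p] unfolding bounded_op_def by blast
    obtain C2 where C2: "\<And>x. x \<in> ell2 \<Longrightarrow> ell2_norm (fun_calc \<phi> T x) \<le> C2 * ell2_norm x"
      using bF unfolding bounded_op_def by blast
    have emb_diff: "(\<lambda>n. emb u w n - emb u' w' n) = emb (u - u') (w - w')" for u w u' w'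
      by (simp add: emb_def fun_eq_iff complex_eq_iff minus_l2.rep_eq)
    have D: "?D x \<in> ell2 \<and> ell2_norm (?D x) \<le> (2 * (\<bar>C1\<bar> + \<bar>C2\<bar>)) * ell2_norm x" if x: "x \<in> ell2" for x
    proof -
      have "op_poly p T x \<in> ell2" "fun_calc \<phi> T x \<in> ell2"
        using bounded_op_poly[of p] bF x by (auto simp: bounded_op_def)
      then obtain u w u' w' where eq: "op_poly p T x = emb u w" "fun_calc \<phi> T x = emb u' w'" by (metis ell2E)
      have Dx: "?D x = emb (u - u') (w - w')" by (simp add: op_minus_def eq emb_diff)
      let ?n = "ell2_norm x" and ?a = "ell2_norm (emb u w)" and ?b = "ell2_norm (emb u' w')"
      have n: "?n \<ge> 0" "?a \<ge> 0" "?b \<ge> 0" using ell2_norm_nonneg x emb_in_ell2 by auto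
      have par: "(norm (y - z))\<^sup>2 \<le> 2 * (norm y)\<^sup>2 + 2 * (norm z)\<^sup>2" for y z :: l2
      proof -
        have "2 * (norm y)\<^sup>2 + 2 * (norm z)\<^sup>2 - (norm (y - z))\<^sup>2 = (norm (y + z))\<^sup>2"
          by (simp add: power2_norm_eq_inner inner_add_left inner_add_right inner_diff_left inner_diff_right inner_commute)
        then show ?thesis by (metis diff_ge_0_iff_ge zero_le_power2)
      qed
      have "(ell2_norm (?D x))\<^sup>2 \<le> 2 * ?a\<^sup>2 + 2 * ?b\<^sup>2"
        unfolding Dx ell2_norm_emb_power2 using add_mono[OF par[of u u'] par[of w w']] by (simp add: algebra_simps)
      also have "\<dots> \<le> (2 * (?a + ?b))\<^sup>2" using n by (simp add: power2_eq_square algebra_simps)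
      finally have "ell2_norm (?D x) \<le> 2 * (?a + ?b)"
        by (rule power2_le_imp_le) (use n in simp)
      also have "\<dots> \<le> 2 * (\<bar>C1\<bar> * ?n + \<bar>C2\<bar> * ?n)"
      proof -
        have "C1 * ?n \<le> \<bar>C1\<bar> * ?n" "C2 * ?n \<le> \<bar>C2\<bar> * ?n" using n by (auto intro!: mult_right_mono)
        then show ?thesis using C1[OF x] C2[OF x] eq by simp
      qed
      finally show ?thesis by (simp add: Dx emb_in_ell2 algebra_simps)
    qed
    show "?D x \<in> ell2" if "x \<in> ell2" for x using D[OF that] ..
    show "\<exists>C. \<forall>x\<in>ell2. ell2_norm (?D x) \<le> C * ell2_norm x" using D by blast
    fix x y a b assume "x \<in> ell2" "y \<in> ell2"
    then show "?D (\<lambda>n. a * x n + b * y n) = (\<lambda>n. a * ?D x n + b * ?D y n)"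
      using bounded_op_poly[of p] bF by (simp add: bounded_op_def op_minus_def fun_eq_iff algebra_simps)
  qed
  then have "ell2_norm (?D x) \<le> 0" "?D x \<in> ell2"
    using bounded_op_norm_le[of ?D x] x zero by (auto simp: bounded_op_def)
  then obtain u w where eq: "?D x = emb u w" "(ell2_norm (emb u w))\<^sup>2 = 0"
    by (metis ell2E ell2_norm_nonneg order_antisym zero_power2)
  then have "u = 0" "w = 0" unfolding ell2_norm_emb_power2 by (simp_all add: add_nonneg_eq_0_iff)
  then have "?D x = (\<lambda>n. 0)" using eq by (simp add: emb_0)
  then show ?thesis by (simp add: op_minus_def fun_eq_iff)
qed

end

section \<open>The trace formula\<close>

lemma acts_as_hankel:
  assumes "weak_l1_seq a C"
  shows "acts_as (hankel (\<lambda>n. complex_of_real (a n))) (hankel_op a) (\<lambda>_. 0)"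
  unfolding acts_as_def
proof (intro allI ext)
  fix u w n
  interpret weak_l1_seq a C by fact
  have "(\<lambda>m. a (n + m) * coord x m) sums coord (hankel_op a x) n" for x
    unfolding coord_hankel_op by (rule summable_sums[OF summable_row])
  then have "(\<lambda>m. complex_of_real (a (n + m)) * emb u w m) sums emb (hankel_op a u) (hankel_op a w) n"
    unfolding sums_complex_iff by (simp add: emb_def)
  then show "hankel (\<lambda>n. complex_of_real (a n)) (emb u w) n = emb (hankel_op a u - 0) (0 + hankel_op a w) n"
    unfolding hankel_def by (simp add: sums_unique[symmetric])
qed

text \<open>The form at \<open>x + i y\<close> is real, and its imaginary part is
  \<open>inner (P y) x - inner (P x) y\<close>. Symmetry thus comes from positivity on complex
  vectors.\<close>

lemma positive_op_symmetric:
  assumes T: "acts_as T P (\<lambda>_. 0)" and pos: "positive_op T"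
  shows "inner (P x) y = inner x (P y)"
proof -
  have "ell2_inner (T (emb x y)) (emb x y) \<in> \<real>\<^sub>\<ge>\<^sub>0"
    using pos emb_in_ell2 by (simp add: positive_op_def)
  then have "inner (P y) x - inner (P x) y = 0"
    using T by (simp add: acts_as_def ell2_inner_emb complex_nonneg_Reals_iff)
  then show ?thesis by (simp add: inner_commute)
qed

lemma op_kernel_trivial_iff:
  assumes "acts_as T P (\<lambda>_. 0)" "linear P"
  shows "op_kernel T = {\<lambda>n. 0} \<longleftrightarrow> (\<forall>x. P x = 0 \<longrightarrow> x = 0)"
proof
  assume ker: "op_kernel T = {\<lambda>n. 0}"
  show "\<forall>x. P x = 0 \<longrightarrow> x = 0"
  proof (intro allI impI)
    fix x assume "P x = 0"
    then have "emb x 0 \<in> op_kernel T"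
      using assms linear_0[OF assms(2)] by (simp add: op_kernel_def emb_in_ell2 acts_as_def emb_0)
    then have "emb x 0 = emb 0 0" using ker by (simp add: emb_0)
    then show "x = 0" by (simp only: emb_eq_iff)
  qed
next
  assume triv: "\<forall>x. P x = 0 \<longrightarrow> x = 0"
  show "op_kernel T = {\<lambda>n. 0}"
  proof (intro set_eqI iffI)
    fix x assume "x \<in> op_kernel T"
    then have x: "x \<in> ell2" "T x = (\<lambda>n. 0)" by (auto simp: op_kernel_def)
    obtain u w where uw: "x = emb u w" using ell2E[OF x(1)] .
    have "emb (P u) (P w) = emb 0 0" using x(2) assms(1) by (simp add: uw acts_as_def emb_0)
    then have "P u = 0" "P w = 0" by (simp_all only: emb_eq_iff)
    then have "u = 0" "w = 0" using triv by blast+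
    then show "x \<in> {\<lambda>n. 0}" by (simp add: uw emb_0)
  next
    fix x :: seq assume "x \<in> {\<lambda>n. 0}"
    then have x: "x = emb 0 0" by (simp add: emb_0)
    have "T (emb 0 0) = emb 0 0"
      using assms linear_0[OF assms(2)] by (simp add: acts_as_def)
    then show "x \<in> op_kernel T"
      unfolding op_kernel_def x using emb_in_ell2[of 0 0] by (simp add: emb_0)
  qed
qed

lemma test_function_of_real:
  assumes "smooth g" "\<And>t. \<bar>t\<bar> > R \<Longrightarrow> g t = 0"
  shows "test_function (\<lambda>t. complex_of_real (g t))"
proof -
  obtain D where D: "D 0 = g" "\<And>k t. (D k has_real_derivative D (Suc k) t) (at t)"
    using assms(1) unfolding smooth_def by blast
  have "((\<lambda>t. complex_of_real (D k t)) has_vector_derivative complex_of_real (D (Suc k) t)) (at t)" for k t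
    using D(2)[of k t] unfolding has_real_derivative_iff_has_vector_derivative
    by (rule bounded_linear.has_vector_derivative[OF bounded_linear_of_real])
  then show ?thesis
    unfolding test_function_def using D(1) assms(2)
    by (intro conjI exI[of _ "\<lambda>k t. complex_of_real (D k t)"] exI[of _ R]) auto
qed

lemma poly_map_poly_of_real: "poly (map_poly complex_of_real p) (complex_of_real t) = complex_of_real (poly p t)"
  by (induction p) (simp_all add: map_poly_pCons)

lemma unit_seq_eq_emb: "unit_seq k = emb (unit_l2 k) 0"
  by (auto simp: unit_seq_def emb_def fun_eq_iff coord_unit_l2 zero_l2.rep_eq complex_eq_iff)

lemma (in real_square_op) op_poly_of_real_emb:
  "op_poly (map_poly complex_of_real p) T (emb x 0) = emb (poly_op p A x) 0"
proof -
  have "map_poly Re (map_poly complex_of_real p) = p" "map_poly Im (map_poly complex_of_real p) = 0"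
    by (simp_all add: poly_eq_iff coeff_map_poly)
  then show ?thesis
    using acts_as_op_poly[OF acts, of "map_poly complex_of_real p"] linear_0[OF bounded_linear.linear[OF bounded_linear_poly_op]]
    by (simp add: acts_as_def)
qed

text \<open>The test function equals one polynomial on an interval that covers both operator norms,
  so both functional calculi are that polynomial and the trace becomes a sum of real diagonal
  entries.\<close>

lemma trace_formula_real:
  assumes "real_square_op G TA" "real_square_op H TB"
    and ssf: "is_spectral_shift \<xi> TB TA"
    and g: "smooth g" "\<And>t. (g has_real_derivative g' t) (at t)" "\<And>t. \<bar>t\<bar> > R \<Longrightarrow> g t = 0"
    and a: "op_norm TA \<le> a" "op_norm TB \<le> a" and p: "\<And>t. t \<in> {-a..a} \<Longrightarrow> g t = poly p t"
    and s: "(\<lambda>k. coord (poly_op p (symmetric_operator.A H) (unit_l2 k) - poly_op p (symmetric_operator.A G) (unit_l2 k)) k) sums s"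
  shows "(LINT t|lborel. \<xi> t * g' t) = s"
proof -
  interpret GA: real_square_op G TA by fact
  interpret HB: real_square_op H TB by fact
  define \<phi> where "\<phi> t = complex_of_real (g t)" for t
  let ?p = "map_poly complex_of_real p"
  have \<phi>: "\<phi> t = poly ?p (complex_of_real t)" if "t \<in> {-a..a}" for t
    using p[OF that] by (simp add: \<phi>_def poly_map_poly_of_real)
  have "test_function \<phi>" unfolding \<phi>_def by (rule test_function_of_real[OF g(1,3)])
  then have tr: "op_trace (op_minus (fun_calc \<phi> TB) (fun_calc \<phi> TA)) = (LINT t|lborel. \<xi> t *\<^sub>R vector_derivative \<phi> (at t))"
    using ssf by (simp add: is_spectral_shift_def)
  have "ell2_inner (op_minus (fun_calc \<phi> TB) (fun_calc \<phi> TA) (unit_seq k)) (unit_seq k)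
      = complex_of_real (coord (poly_op p HB.A (unit_l2 k) - poly_op p GA.A (unit_l2 k)) k)" for k
  proof -
    have "fun_calc \<phi> TB (unit_seq k) = emb (poly_op p HB.A (unit_l2 k)) 0"
      unfolding unit_seq_eq_emb HB.op_poly_of_real_emb[symmetric]
      by (rule HB.fun_calc_eq_op_poly[OF \<phi> emb_in_ell2]) (use a in auto)
    moreover have "fun_calc \<phi> TA (unit_seq k) = emb (poly_op p GA.A (unit_l2 k)) 0"
      unfolding unit_seq_eq_emb GA.op_poly_of_real_emb[symmetric]
      by (rule GA.fun_calc_eq_op_poly[OF \<phi> emb_in_ell2]) (use a in auto)
    ultimately have "op_minus (fun_calc \<phi> TB) (fun_calc \<phi> TA) (unit_seq k)
        = emb (poly_op p HB.A (unit_l2 k) - poly_op p GA.A (unit_l2 k)) 0"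
      by (simp add: op_minus_def emb_def fun_eq_iff complex_eq_iff minus_l2.rep_eq zero_l2.rep_eq)
    then show ?thesis
      unfolding unit_seq_eq_emb
      by (simp add: ell2_inner_emb inner_commute[of _ "unit_l2 k"] inner_unit_l2 complex_of_real_def)
  qed
  then have "op_trace (op_minus (fun_calc \<phi> TB) (fun_calc \<phi> TA))
      = (\<Sum>k. complex_of_real (coord (poly_op p HB.A (unit_l2 k) - poly_op p GA.A (unit_l2 k)) k))"
    by (simp add: op_trace_def)
  also have "\<dots> = complex_of_real s"
    by (rule sums_unique[symmetric, OF sums_of_real[OF s]])
  finally have "(LINT t|lborel. \<xi> t *\<^sub>R vector_derivative \<phi> (at t)) = complex_of_real s" using tr by simp
  moreover have "vector_derivative \<phi> (at t) = complex_of_real (g' t)" for t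
    unfolding \<phi>_def
    by (rule vector_derivative_at)
      (use g(2)[of t] in \<open>simp add: has_real_derivative_iff_has_vector_derivative
        bounded_linear.has_vector_derivative[OF bounded_linear_of_real]\<close>)
  then have "(LINT t|lborel. \<xi> t *\<^sub>R vector_derivative \<phi> (at t)) = (LINT t|lborel. complex_of_real (\<xi> t * g' t))"
    by (simp add: scaleR_conv_of_real)
  also have "\<dots> = complex_of_real (LINT t|lborel. \<xi> t * g' t)" by (rule integral_complex_of_real)
  ultimately show ?thesis by (simp only: of_real_eq_iff)
qed

text \<open>Summing the diagonal entries of a rank one term gives the scalar product of its two
  vectors; \<open>rank_one_power_diff\<close> has finitely many such terms.\<close>

lemma rank_one_trace_sums:
  assumes "symmetric_operator G"
    and B: "\<And>x. B x = symmetric_operator.rank_one_perturbation G v x"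
  shows "(\<lambda>k. coord ((B ^^ n) (unit_l2 k) - (symmetric_operator.A G ^^ n) (unit_l2 k)) k) sums
    (\<Sum>j<n. inner ((B ^^ j) v) ((symmetric_operator.A G ^^ (n - 1 - j)) v))"
proof -
  interpret symmetric_operator G by fact
  have B_eq: "B = rank_one_perturbation v" using B by (simp add: fun_eq_iff)
  have "coord ((B ^^ n) (unit_l2 k) - (A ^^ n) (unit_l2 k)) k
      = (\<Sum>j<n. coord ((A ^^ (n - 1 - j)) v) k * coord ((B ^^ j) v) k)" for k
    unfolding B_eq rank_one_power_diff by (simp add: coord_sum scaleR_l2.rep_eq inner_unit_l2)
  moreover have "(\<lambda>k. \<Sum>j<n. coord ((A ^^ (n - 1 - j)) v) k * coord ((B ^^ j) v) k) sums
      (\<Sum>j<n. inner ((A ^^ (n - 1 - j)) v) ((B ^^ j) v))"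
    unfolding inner_l2_def by (intro sums_sum summable_sums summable_coord_mult)
  ultimately show ?thesis by (simp add: inner_commute)
qed

lemma smooth_power_cutoff:
  assumes "a \<ge> 0"
  obtains g g' R where "smooth g" "\<And>t. (g has_real_derivative g' t) (at t)" "\<And>t :: real. \<bar>t\<bar> > R \<Longrightarrow> g t = 0"
    "\<And>t. t \<in> {-a..a} \<Longrightarrow> g t = t ^ n" "\<And>t. t \<in> {-a..a} \<Longrightarrow> g' t = real n * t ^ (n - 1)"
proof -
  define g where "g t = t ^ n * (smooth_step (1 * t + (a + 2)) * smooth_step ((-1) * t + (a + 2)))" for t
  have "smooth g"
    unfolding g_def by (intro smooth_mult smooth_power smooth_ident smooth_affine smooth_smooth_step)
  then obtain g' where g': "\<And>t. (g has_real_derivative g' t) (at t)" using smooth_derivE by blast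
  \<comment> \<open>The agreement extends to an open neighbourhood of \<open>[-a, a]\<close>, which
    fixes the derivative at the endpoints as well.\<close>
  have eq: "g t = t ^ n" if "t \<in> {-a-1<..<a+1}" for t
    using that by (simp add: g_def smooth_step_1)
  have "g' t = real n * t ^ (n - 1)" if "t \<in> {-a..a}" for t
  proof (rule DERIV_unique[OF g'])
    have "((\<lambda>t. t ^ n) has_real_derivative real n * t ^ (n - 1)) (at t)"
      by (auto intro!: derivative_eq_intros)
    then show "(g has_real_derivative real n * t ^ (n - 1)) (at t)"
      by (rule has_field_derivative_transform_within_open[of _ _ _ "{-a-1<..<a+1}"]) (use that eq in auto)
  qed
  moreover have "g t = 0" if "\<bar>t\<bar> > a + 2" for t
    using that by (cases "t > 0") (auto simp: g_def smooth_step_0)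
  ultimately show ?thesis
    using \<open>smooth g\<close> g' eq by (intro that[of g g' "a + 2"]) auto
qed

theorem theorem3p2:
  fixes \<alpha> :: "nat \<Rightarrow> complex" and \<xi> :: "real \<Rightarrow> real"
  assumes "\<alpha> \<in> weak_ell1_pp"
    and "is_spectral_shift \<xi> (hankel \<alpha> ^^ 2) (hankel (shift \<alpha>) ^^ 2)"
  shows "(op_kernel (hankel \<alpha>) = {\<lambda>n. 0} \<and> op_kernel (hankel (shift \<alpha>)) = {\<lambda>n. 0}) \<longleftrightarrow>
    ((\<integral>\<^sup>+t\<in>{0..1}. ennreal (\<xi> t / t) \<partial>lborel) = \<infinity> \<and>
     (\<integral>\<^sup>+t\<in>{0..1}. ennreal ((1 - \<xi> t) / t) \<partial>lborel) = \<infinity>)"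
proof -
  define a where "a n = Re (\<alpha> n)" for n
  have \<alpha>: "\<alpha> = (\<lambda>n. complex_of_real (a n))"
    using assms(1) by (auto simp: weak_ell1_pp_def a_def fun_eq_iff complex_is_Real_iff complex_eq_iff)
  have shift_\<alpha>: "shift \<alpha> = (\<lambda>n. complex_of_real (a (Suc n)))" by (simp add: \<alpha> shift_def)
  obtain C where "\<And>n. real (n + 1) * cmod (\<alpha> n) \<le> C"
    using assms(1) by (auto simp: weak_ell1_pp_def weak_ell1_def bdd_above_def)
  then interpret weak_l1_seq a C by unfold_locales (simp add: \<alpha>)
  interpret shifted: weak_l1_seq "\<lambda>n. a (Suc n)" C by (rule weak_l1_seq_Suc)
  let ?H = "hankel_op a"
  have actsH: "acts_as (hankel \<alpha>) ?H (\<lambda>_. 0)" unfolding \<alpha> by (rule acts_as_hankel) unfold_locales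
  have actsG: "acts_as (hankel (shift \<alpha>)) G (\<lambda>_. 0)" unfolding shift_\<alpha> by (rule acts_as_hankel) unfold_locales
  have symH: "inner (?H x) y = inner x (?H y)" for x y
    by (rule positive_op_symmetric[OF actsH]) (use assms(1) in \<open>simp add: weak_ell1_pp_def\<close>)
  have symG: "inner (G x) y = inner x (G y)" for x y
    by (rule positive_op_symmetric[OF actsG]) (use assms(1) in \<open>simp add: weak_ell1_pp_def\<close>)
  define TB where "TB = hankel \<alpha> ^^ 2"
  define TA where "TA = hankel (shift \<alpha>) ^^ 2"
  interpret SH: symmetric_operator ?H by (rule symmetric_operator.intro[OF bounded_linear_hankel_op symH])
  interpret SG: symmetric_operator G by (rule symmetric_operator.intro[OF shifted.bounded_linear_hankel_op symG])
  have rB: "real_square_op ?H TB"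
    by unfold_locales (use actsH in \<open>auto simp: TB_def acts_as_def numeral_2_eq_2 SH.A_def\<close>)
  have rA: "real_square_op G TA"
    by unfold_locales (use actsG in \<open>auto simp: TA_def acts_as_def numeral_2_eq_2 SG.A_def\<close>)
  interpret HB: real_square_op ?H TB by (rule rB)
  interpret GA: real_square_op G TA by (rule rA)
  have B: "SH.A x = SG.rank_one_perturbation v x" for x
    by (simp add: SH.A_def SG.rank_one_perturbation_def SG.A_def hankel_op_square)
  have ssf: "is_spectral_shift \<xi> TB TA" using assms(2) by (simp add: TA_def TB_def)
  have \<xi>_int: "integrable lborel \<xi>" using ssf by (simp add: is_spectral_shift_def)
  \<comment> \<open>A single interval has to serve both operators, since the same test function is
    inserted into each.\<close>
  define r where "r = max (op_norm TA) (op_norm TB)"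
  have r: "op_norm TA \<le> r" "op_norm TB \<le> r" "r \<ge> 0"
    using op_norm_nonneg[OF GA.bounded_op_T] by (auto simp: r_def)
  \<comment> \<open>The added 1 keeps \<open>c\<close> positive even if \<open>TA\<close> has norm
    0.\<close>
  define c where "c = op_norm TA + 1"
  have c: "c > 0" using op_norm_nonneg[OF GA.bounded_op_T] by (simp add: c_def)
  have norm_G: "(norm (G x))\<^sup>2 \<le> c * (norm x)\<^sup>2" for x
  proof -
    have "op_norm TA * (norm x)\<^sup>2 \<le> c * (norm x)\<^sup>2" by (intro mult_right_mono) (auto simp: c_def)
    then show ?thesis using GA.norm_G_le[of x] by linarith
  qed
  interpret BG: bounded_symmetric_operator G c by unfold_locales (rule c, rule norm_G)
  interpret L: interval_positive_functional "\<lambda>p. inner (poly_op p SG.A v) v" c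
    by (rule SG.interval_positive_functional[OF norm_G c])
  \<comment> \<open>A test function that vanishes on \<open>[-r, r]\<close> agrees there with the
    zero polynomial, so its trace is 0.\<close>
  have support: "AE t in lborel. t \<notin> {-r..r} \<longrightarrow> \<xi> t = 0"
  proof (rule AE_zero_outside_support[OF \<xi>_int])
    fix g g' :: "real \<Rightarrow> real" and R
    assume g: "smooth g" "\<And>t. (g has_real_derivative g' t) (at t)" "\<And>t. \<bar>t\<bar> > R \<Longrightarrow> g t = 0"
      "\<And>t. t \<in> {-r..r} \<Longrightarrow> g t = 0"
    show "(LINT t|lborel. \<xi> t * g' t) = 0"
      by (rule trace_formula_real[OF rA rB ssf g(1-3) r(1,2), where p = 0])
        (use g(4) in \<open>simp_all add: zero_l2.rep_eq\<close>)
  qed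
  define T where "T = Abs_fps (\<lambda>n. \<Sum>j<n. inner ((SH.A ^^ j) v) ((SG.A ^^ (n - 1 - j)) v))"
  have SH_A: "SH.A = SG.rank_one_perturbation v" using B by (simp add: fun_eq_iff)
  have mf: "L.moment_fps = Abs_fps (\<lambda>n. inner ((SG.A ^^ n) v) v)"
    by (simp add: L.moment_fps_def poly_op_X_power[OF SG.linear_A])
  have T: "T * (1 - fps_X * L.moment_fps) = fps_X * fps_deriv (fps_X * L.moment_fps)"
    unfolding T_def mf SH_A by (rule SG.trace_moments_fps)
  have moments: "fps_nth T n = (LINT x|lborel. \<xi> x * indicator {-r..r} x * (real n * x ^ (n - 1)))" for n
  proof -
    obtain g g' R where g: "smooth g" "\<And>t. (g has_real_derivative g' t) (at t)" "\<And>t :: real. \<bar>t\<bar> > R \<Longrightarrow> g t = 0"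
      "\<And>t. t \<in> {-r..r} \<Longrightarrow> g t = t ^ n" "\<And>t. t \<in> {-r..r} \<Longrightarrow> g' t = real n * t ^ (n - 1)"
      using smooth_power_cutoff[OF r(3), of n] by blast
    have "(LINT t|lborel. \<xi> t * g' t) = fps_nth T n"
    proof (rule trace_formula_real[OF rA rB ssf g(1-3) r(1,2)])
      show "g t = poly ([:0, 1:] ^ n) t" if "t \<in> {-r..r}" for t using g(4)[OF that] by simp
      show "(\<lambda>k. coord (poly_op ([:0, 1:] ^ n) SH.A (unit_l2 k) - poly_op ([:0, 1:] ^ n) SG.A (unit_l2 k)) k) sums fps_nth T n"
        unfolding poly_op_X_power[OF SG.linear_A] poly_op_X_power[OF SH.linear_A] T_def fps_nth_Abs_fps
        by (rule rank_one_trace_sums[OF SG.symmetric_operator_axioms B])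
    qed
    \<comment> \<open>The derivative of the cutoff power is known only on \<open>[-r, r]\<close>;
      outside, \<open>\<xi>\<close> vanishes almost everywhere.\<close>
    moreover have "(LINT t|lborel. \<xi> t * g' t) = (LINT x|lborel. \<xi> x * indicator {-r..r} x * (real n * x ^ (n - 1)))"
    proof (rule integral_cong_AE)
      obtain g'' where "smooth g''" "\<And>t. (g has_real_derivative g'' t) (at t)" using smooth_derivE[OF g(1)] by blast
      then have "g' = g''" using g(2) DERIV_unique by blast
      then have "continuous_on UNIV g'" using smooth_continuous \<open>smooth g''\<close> by simp
      then have [measurable]: "g' \<in> borel_measurable borel" by (rule borel_measurable_continuous_onI)
      have [measurable]: "\<xi> \<in> borel_measurable borel" using \<xi>_int by auto
      show "(\<lambda>t. \<xi> t * g' t) \<in> borel_measurable lborel" by measurable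
      show "(\<lambda>x. \<xi> x * indicator {-r..r} x * (real n * x ^ (n - 1))) \<in> borel_measurable lborel" by measurable
      show "AE x in lborel. \<xi> x * g' x = \<xi> x * indicator {-r..r} x * (real n * x ^ (n - 1))"
        using support by eventually_elim (auto simp: g(5) indicator_def)
    qed
    ultimately show ?thesis by simp
  qed
  note shift_facts = L.spectral_shift_of_moments[OF \<xi>_int support T moments]
  define b where "b = c + inner (poly_op 1 SG.A v) v + 1"
  have b: "b \<ge> 0" using c by (simp add: b_def)
  have dL: "(\<Sum>j<n. inner (poly_op ([:1, - 1 / c:] ^ j) SG.A v) v) = (\<Sum>j<n. BG.d v j)" for n
    by (simp add: BG.d_def BG.E_def)
  have criteria: "(\<exists>K. \<forall>n. (\<Sum>j<n. BG.d v j) \<le> K) \<longleftrightarrow> (\<integral>\<^sup>+t\<in>{0..1}. ennreal (\<xi> t / t) \<partial>lborel) \<noteq> \<infinity>"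
    "BG.d v \<longlonglongrightarrow> 0 \<longleftrightarrow> (\<integral>\<^sup>+t\<in>{0..1}. ennreal ((1 - \<xi> t) / t) \<partial>lborel) = \<infinity>"
    using divergence_criteria[OF \<xi>_int shift_facts(1) shift_facts(2)[folded b_def] c b
        shift_facts(3)[unfolded dL] shift_facts(4)[unfolded dL] BG.d_nonneg] BG.d_antimono
    by (simp_all add: decseq_def)
  have "op_kernel (hankel \<alpha>) = {\<lambda>n. 0} \<and> op_kernel (hankel (shift \<alpha>)) = {\<lambda>n. 0} \<longleftrightarrow>
      (\<forall>x. ?H x = 0 \<longrightarrow> x = 0) \<and> (\<forall>x. G x = 0 \<longrightarrow> x = 0)"
    by (simp only: op_kernel_trivial_iff[OF actsH SH.linear_G] op_kernel_trivial_iff[OF actsG SG.linear_G])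
  also have "\<dots> \<longleftrightarrow> v \<notin> range G \<and> (\<forall>x. G x = 0 \<longrightarrow> inner x v = 0)"
    by (rule kernels_trivial_iff[OF symH symG])
  also have "\<dots> \<longleftrightarrow> \<not> (\<exists>K. \<forall>n. (\<Sum>j<n. BG.d v j) \<le> K) \<and> BG.d v \<longlonglongrightarrow> 0"
    by (simp only: BG.bounded_sum_d_iff BG.d_tendsto_0_iff)
  also have "\<dots> \<longleftrightarrow> (\<integral>\<^sup>+t\<in>{0..1}. ennreal (\<xi> t / t) \<partial>lborel) = \<infinity> \<and>
     (\<integral>\<^sup>+t\<in>{0..1}. ennreal ((1 - \<xi> t) / t) \<partial>lborel) = \<infinity>"
    by (simp only: criteria not_not)
  finally show ?thesis .
qed

end
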